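(* Let $\mathfrak{g}$ be a finite-dimensional real Lie algebra whose solvable radical $\mathfrak{r}$ is abelian. Suppose $\mathfrak{g}$ is equipped with a nil-invariant symmetric bilinear form $\langle\cdot,\cdot\rangle$ such that the kernel $\mathfrak{g}^\perp$ of $\langle\cdot,\cdot\rangle$ does not contain a non-trivial ideal of $\mathfrak{g}$. Let $\mathfrak{k}\times\mathfrak{s}$ be a Levi subalgebra of $\mathfrak{g}$, where $\mathfrak{k}$ is of compact type and $\mathfrak{s}$ has no simple factors of compact type. Then $\mathfrak{g}$ is an orthogonal direct product of ideals \[ \mathfrak{g}=\mathfrak{g}_1\times\mathfrak{g}_2\times\mathfrak{g}_3, \] with \[ \mathfrak{g}_1=\mathfrak{k}\ltimes\mathfrak{a},\qquad \mathfrak{g}_2=\mathfrak{s}_0,\qquad \mathfrak{g}_3=\mathfrak{s}_1\ltimes\mathfrak{s}_1^*, \] where $\mathfrak{r}=\mathfrak{a}\times\mathfrak{s}_1^*$ and $\mathfrak{s}=\mathfrak{s}_0\times\mathfrak{s}_1$ are orthogonal direct products, and $\mathfrak{g}_3$ is a metric cotangent algebra. The restrictions of $\langle\cdot,\cdot\rangle$ to $\mathfrak{g}_2$ and $\mathfrak{g}_3$ are invariant and non-degenerate. In particular, $\mathfrak{g}^\perp\subseteq\mathfrak{g}_1$.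
   Context: Let $\mathrm{Inn}(\mathfrak{g})$ be the inner automorphism group of $\mathfrak{g}$ and $\overline{\mathrm{Inn}(\mathfrak{g})}^{\rm z}$ its Zariski closure in $\mathrm{Aut}(\mathfrak{g})$. A symmetric bilinear form on $\mathfrak{g}$ is nil-invariant if $\langle\varphi x_1,x_2\rangle=-\langle x_1,\varphi x_2\rangle$ for all $x_1,x_2\in\mathfrak{g}$ and all nilpotent elements $\varphi$ of the Lie algebra of $\overline{\mathrm{Inn}(\mathfrak{g})}^{\rm z}$. Its kernel is $\mathfrak{g}^\perp=\{x\in\mathfrak{g}\mid\langle x,y\rangle=0\text{ for all }y\in\mathfrak{g}\}$. A bilinear form on a Lie algebra is invariant if all operators $\mathrm{ad}(x)$ are skew-symmetric for it. A semisimple Lie algebra is of compact type if its Killing form is definite. A cotangent algebra constructed from a Lie algebra $\mathfrak{l}$ is $\mathfrak{l}\ltimes\mathfrak{l}^*$, where $\mathfrak{l}$ acts on the abelian ideal $\mathfrak{l}^*$ by the coadjoint representation; it is a metric cotangent algebra if it has a non-degenerate invariant scalar product (here the restriction of $\langle\cdot,\cdot\rangle$) such that $\mathfrak{l}^*$ is totally isotropic. Orthogonality is with respect to $\langle\cdot,\cdot\rangle$. *)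

theory Defs
  imports "HOL-Analysis.Analysis"
begin

text \<open>
  A finite-dimensional real Lie algebra is a finite-dimensional space \<open>'a\<close> with a bracket
  \<open>br\<close>. The class \<open>real_normed_vector\<close>, rather than \<open>euclidean_space\<close>, keeps the zero algebra
  among the instances. The norm only supplies the (unique) vector space topology in which the
  exponential series converges. Subalgebras and ideals are subsets of \<open>'a\<close>, and notions relative
  to a subalgebra \<open>h\<close> take \<open>h\<close> as an argument.
\<close>

definition lie_algebra :: "('a::real_vector \<Rightarrow> 'a \<Rightarrow> 'a) \<Rightarrow> bool" where
  "lie_algebra br \<longleftrightarrow> bilinear br \<and> (\<forall>x. br x x = 0) \<and>
     (\<forall>x y z. br x (br y z) + br y (br z x) + br z (br x y) = 0)"

definition finite_dimensional :: "'a::real_vector itself \<Rightarrow> bool" where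
  "finite_dimensional _ \<longleftrightarrow> (\<exists>B::'a set. finite B \<and> span B = UNIV)"

definition lie_subalgebra :: "('a::real_vector \<Rightarrow> 'a \<Rightarrow> 'a) \<Rightarrow> 'a set \<Rightarrow> bool" where
  "lie_subalgebra br h \<longleftrightarrow> subspace h \<and> (\<forall>x\<in>h. \<forall>y\<in>h. br x y \<in> h)"

definition lie_ideal :: "('a::real_vector \<Rightarrow> 'a \<Rightarrow> 'a) \<Rightarrow> 'a set \<Rightarrow> 'a set \<Rightarrow> bool" where
  "lie_ideal br I h \<longleftrightarrow> subspace I \<and> I \<subseteq> h \<and> (\<forall>x\<in>h. \<forall>y\<in>I. br x y \<in> I)"

definition abelian_on :: "('a::real_vector \<Rightarrow> 'a \<Rightarrow> 'a) \<Rightarrow> 'a set \<Rightarrow> bool" where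
  "abelian_on br h \<longleftrightarrow> (\<forall>x\<in>h. \<forall>y\<in>h. br x y = 0)"

definition derived :: "('a::real_vector \<Rightarrow> 'a \<Rightarrow> 'a) \<Rightarrow> 'a set \<Rightarrow> 'a set" where
  "derived br h = span {br x y |x y. x \<in> h \<and> y \<in> h}"

definition solvable_on :: "('a::real_vector \<Rightarrow> 'a \<Rightarrow> 'a) \<Rightarrow> 'a set \<Rightarrow> bool" where
  "solvable_on br h \<longleftrightarrow> (\<exists>n. (derived br ^^ n) h = {0})"

text \<open>The sum of all solvable ideals; in finite dimension, the largest solvable ideal.\<close>

definition lie_radical :: "('a::real_vector \<Rightarrow> 'a \<Rightarrow> 'a) \<Rightarrow> 'a set \<Rightarrow> 'a set" where
  "lie_radical br h = span (\<Union>{I. lie_ideal br I h \<and> solvable_on br I})"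

definition lie_semisimple :: "('a::real_vector \<Rightarrow> 'a \<Rightarrow> 'a) \<Rightarrow> 'a set \<Rightarrow> bool" where
  "lie_semisimple br h \<longleftrightarrow> lie_subalgebra br h \<and> lie_radical br h = {0}"

definition lie_simple :: "('a::real_vector \<Rightarrow> 'a \<Rightarrow> 'a) \<Rightarrow> 'a set \<Rightarrow> bool" where
  "lie_simple br h \<longleftrightarrow> lie_subalgebra br h \<and> \<not> abelian_on br h \<and>
     (\<forall>I. lie_ideal br I h \<longrightarrow> I = {0} \<or> I = h)"

text \<open>Trace of a linear operator on a finite-dimensional subspace \<open>V\<close> that it preserves; the
  value does not depend on the chosen basis.\<close>

definition trace_on :: "'a::real_vector set \<Rightarrow> ('a \<Rightarrow> 'a) \<Rightarrow> real" where
  "trace_on V f = (let C = (SOME C. independent C \<and> span C = V)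
                   in \<Sum>b\<in>C. representation C (f b) b)"

definition killing_form :: "('a::real_vector \<Rightarrow> 'a \<Rightarrow> 'a) \<Rightarrow> 'a set \<Rightarrow> 'a \<Rightarrow> 'a \<Rightarrow> real" where
  "killing_form br h x y = trace_on h (br x \<circ> br y)"

definition definite_on :: "('a::real_vector \<Rightarrow> 'a \<Rightarrow> real) \<Rightarrow> 'a set \<Rightarrow> bool" where
  "definite_on form h \<longleftrightarrow> (\<forall>x\<in>h. x \<noteq> 0 \<longrightarrow> form x x > 0) \<or> (\<forall>x\<in>h. x \<noteq> 0 \<longrightarrow> form x x < 0)"

definition compact_type :: "('a::real_vector \<Rightarrow> 'a \<Rightarrow> 'a) \<Rightarrow> 'a set \<Rightarrow> bool" where
  "compact_type br h \<longleftrightarrow> lie_semisimple br h \<and> definite_on (killing_form br h) h"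

text \<open>For semisimple \<open>h\<close>, the simple factors are exactly the ideals of \<open>h\<close> that are simple.\<close>

definition no_compact_factors :: "('a::real_vector \<Rightarrow> 'a \<Rightarrow> 'a) \<Rightarrow> 'a set \<Rightarrow> bool" where
  "no_compact_factors br h \<longleftrightarrow>
     (\<forall>I. lie_ideal br I h \<and> lie_simple br I \<longrightarrow> \<not> compact_type br I)"

text \<open>\<open>listset Fs\<close> is the set of tuples with one entry from each member of \<open>Fs\<close>, so this says that
  every element of \<open>h\<close> is uniquely a sum of such entries, and that all these sums lie in \<open>h\<close>.\<close>

definition direct_sum :: "'a::real_vector set \<Rightarrow> 'a set list \<Rightarrow> bool" where
  "direct_sum h Fs \<longleftrightarrow> bij_betw sum_list (listset Fs) h"

definition direct_product ::
    "('a::real_vector \<Rightarrow> 'a \<Rightarrow> 'a) \<Rightarrow> 'a set \<Rightarrow> 'a set list \<Rightarrow> bool" where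
  "direct_product br h Fs \<longleftrightarrow> (\<forall>F\<in>set Fs. lie_ideal br F h) \<and> direct_sum h Fs"

text \<open>\<open>sorted_wrt\<close> demands orthogonality of any two members of the list at different positions
  (for a symmetric form).\<close>

definition orthogonal_direct_product ::
    "('a::real_vector \<Rightarrow> 'a \<Rightarrow> 'a) \<Rightarrow> ('a \<Rightarrow> 'a \<Rightarrow> real) \<Rightarrow> 'a set \<Rightarrow> 'a set list \<Rightarrow> bool" where
  "orthogonal_direct_product br form h Fs \<longleftrightarrow> direct_product br h Fs \<and>
     sorted_wrt (\<lambda>F G. \<forall>x\<in>F. \<forall>y\<in>G. form x y = 0) Fs"

text \<open>\<open>h\<close> is the internal semidirect product of the subalgebra \<open>l\<close> and the ideal \<open>a\<close>.\<close>

definition semidirect_product ::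
    "('a::real_vector \<Rightarrow> 'a \<Rightarrow> 'a) \<Rightarrow> 'a set \<Rightarrow> 'a set \<Rightarrow> 'a set \<Rightarrow> bool" where
  "semidirect_product br h l a \<longleftrightarrow>
     lie_subalgebra br h \<and> lie_subalgebra br l \<and> lie_ideal br a h \<and> direct_sum h [l, a]"

definition levi_subalgebra :: "('a::real_vector \<Rightarrow> 'a \<Rightarrow> 'a) \<Rightarrow> 'a set \<Rightarrow> bool" where
  "levi_subalgebra br l \<longleftrightarrow> lie_semisimple br l \<and> direct_sum UNIV [l, lie_radical br UNIV]"

text \<open>Automorphisms, the inner automorphism group generated by all \<open>exp (ad x)\<close>, and its Zariski
  closure. Linear operators are plain functions; \<open>Blinfun\<close> turns them into elements of the
  vector space \<open>'a \<Rightarrow>\<^sub>L 'a\<close>, which in finite dimension consists of all linear operators,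
  and on which \<open>real_polynomial_function\<close> describes the usual polynomial functions.\<close>

definition lie_aut :: "('a::real_vector \<Rightarrow> 'a \<Rightarrow> 'a) \<Rightarrow> ('a \<Rightarrow> 'a) set" where
  "lie_aut br = {\<phi>. linear \<phi> \<and> bij \<phi> \<and> (\<forall>x y. \<phi> (br x y) = br (\<phi> x) (\<phi> y))}"

definition op_exp :: "('a::real_normed_vector \<Rightarrow> 'a) \<Rightarrow> 'a \<Rightarrow> 'a" where
  "op_exp A x = (\<Sum>n. (1 / fact n) *\<^sub>R (A ^^ n) x)"

inductive_set inn :: "('a::real_normed_vector \<Rightarrow> 'a \<Rightarrow> 'a) \<Rightarrow> ('a \<Rightarrow> 'a) set"
  for br :: "'a \<Rightarrow> 'a \<Rightarrow> 'a" where
  inn_exp: "op_exp (br x) \<in> inn br"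
| inn_id: "id \<in> inn br"
| inn_comp: "\<phi> \<in> inn br \<Longrightarrow> \<psi> \<in> inn br \<Longrightarrow> \<phi> \<circ> \<psi> \<in> inn br"
| inn_inv: "\<phi> \<in> inn br \<Longrightarrow> inv \<phi> \<in> inn br"

definition zariski_closure_in ::
    "('a::real_normed_vector \<Rightarrow> 'a) set \<Rightarrow> ('a \<Rightarrow> 'a) set \<Rightarrow> ('a \<Rightarrow> 'a) set" where
  "zariski_closure_in X S = {\<phi> \<in> X. \<forall>p :: ('a \<Rightarrow>\<^sub>L 'a) \<Rightarrow> real.
     real_polynomial_function p \<and> (\<forall>\<psi>\<in>S. p (Blinfun \<psi>) = 0) \<longrightarrow> p (Blinfun \<phi>) = 0}"

text \<open>Lie algebra of a closed linear group \<open>G\<close>: the generators of its one-parameter subgroups.\<close>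

definition lie_algebra_of_group :: "('a::real_normed_vector \<Rightarrow> 'a) set \<Rightarrow> ('a \<Rightarrow> 'a) set" where
  "lie_algebra_of_group G = {\<phi>. linear \<phi> \<and> (\<forall>t::real. op_exp (\<lambda>x. t *\<^sub>R \<phi> x) \<in> G)}"

definition nilpotent_op :: "('a::real_vector \<Rightarrow> 'a) \<Rightarrow> bool" where
  "nilpotent_op \<phi> \<longleftrightarrow> (\<exists>n. \<forall>x. (\<phi> ^^ n) x = 0)"

definition symmetric_bilinear :: "('a::real_vector \<Rightarrow> 'a \<Rightarrow> real) \<Rightarrow> bool" where
  "symmetric_bilinear form \<longleftrightarrow> bilinear form \<and> (\<forall>x y. form x y = form y x)"

definition nil_invariant ::
    "('a::real_normed_vector \<Rightarrow> 'a \<Rightarrow> 'a) \<Rightarrow> ('a \<Rightarrow> 'a \<Rightarrow> real) \<Rightarrow> bool" where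
  "nil_invariant br form \<longleftrightarrow>
     (\<forall>\<phi> \<in> lie_algebra_of_group (zariski_closure_in (lie_aut br) (inn br)).
        nilpotent_op \<phi> \<longrightarrow> (\<forall>x y. form (\<phi> x) y = - form x (\<phi> y)))"

definition form_kernel :: "('a::real_vector \<Rightarrow> 'a \<Rightarrow> real) \<Rightarrow> 'a set" where
  "form_kernel form = {x. \<forall>y. form x y = 0}"

text \<open>The next two concern the restriction of \<open>form\<close> to the subalgebra \<open>h\<close>.\<close>

definition invariant_on ::
    "('a::real_vector \<Rightarrow> 'a \<Rightarrow> 'a) \<Rightarrow> ('a \<Rightarrow> 'a \<Rightarrow> real) \<Rightarrow> 'a set \<Rightarrow> bool" where
  "invariant_on br form h \<longleftrightarrow>
     (\<forall>x\<in>h. \<forall>y\<in>h. \<forall>z\<in>h. form (br x y) z = - form y (br x z))"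

definition nondegenerate_on :: "('a::real_vector \<Rightarrow> 'a \<Rightarrow> real) \<Rightarrow> 'a set \<Rightarrow> bool" where
  "nondegenerate_on form h \<longleftrightarrow> (\<forall>x\<in>h. (\<forall>y\<in>h. form x y = 0) \<longrightarrow> x = 0)"

definition totally_isotropic :: "('a::real_vector \<Rightarrow> 'a \<Rightarrow> real) \<Rightarrow> 'a set \<Rightarrow> bool" where
  "totally_isotropic form V \<longleftrightarrow> (\<forall>x\<in>V. \<forall>y\<in>V. form x y = 0)"

text \<open>The dual space of a subspace \<open>l\<close>, its functionals being extended by 0 outside \<open>l\<close> to make
  them unique as functions on \<open>'a\<close>, and the coadjoint representation of \<open>l\<close> on it.\<close>

definition dual_space :: "'a::real_vector set \<Rightarrow> ('a \<Rightarrow> real) set" where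
  "dual_space l = {f. (\<forall>x\<in>l. \<forall>y\<in>l. f (x + y) = f x + f y) \<and>
                      (\<forall>c. \<forall>x\<in>l. f (c *\<^sub>R x) = c * f x) \<and> (\<forall>x. x \<notin> l \<longrightarrow> f x = 0)}"

definition coadjoint ::
    "('a::real_vector \<Rightarrow> 'a \<Rightarrow> 'a) \<Rightarrow> 'a set \<Rightarrow> 'a \<Rightarrow> ('a \<Rightarrow> real) \<Rightarrow> 'a \<Rightarrow> real" where
  "coadjoint br l x f = (\<lambda>y. if y \<in> l then - f (br x y) else 0)"

text \<open>\<open>h\<close> is the semidirect product of \<open>l\<close> and an abelian ideal \<open>V\<close> which, as an \<open>l\<close>-module, is the
  coadjoint module of \<open>l\<close> (via \<open>T\<close>).\<close>

definition cotangent_algebra ::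
    "('a::real_vector \<Rightarrow> 'a \<Rightarrow> 'a) \<Rightarrow> 'a set \<Rightarrow> 'a set \<Rightarrow> 'a set \<Rightarrow> bool" where
  "cotangent_algebra br h l V \<longleftrightarrow> semidirect_product br h l V \<and> abelian_on br V \<and>
     (\<exists>T. bij_betw T V (dual_space l) \<and>
          (\<forall>u\<in>V. \<forall>v\<in>V. T (u + v) = (\<lambda>y. T u y + T v y)) \<and>
          (\<forall>c. \<forall>v\<in>V. T (c *\<^sub>R v) = (\<lambda>y. c * T v y)) \<and>
          (\<forall>x\<in>l. \<forall>v\<in>V. T (br x v) = coadjoint br l x (T v)))"

definition metric_cotangent_algebra ::
    "('a::real_vector \<Rightarrow> 'a \<Rightarrow> 'a) \<Rightarrow> ('a \<Rightarrow> 'a \<Rightarrow> real) \<Rightarrow> 'a set \<Rightarrow> 'a set \<Rightarrow> 'a set \<Rightarrow> bool"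
  where
  "metric_cotangent_algebra br form h l V \<longleftrightarrow> cotangent_algebra br h l V \<and>
     invariant_on br form h \<and> nondegenerate_on form h \<and> totally_isotropic form V"

end

theory Submission
  imports Defs
    "HOL-Computational_Algebra.Fundamental_Theorem_Algebra"
    "HOL-Computational_Algebra.Field_as_Ring"
    "Jordan_Normal_Form.Schur_Decomposition"
begin

text \<open>
  The radical \<open>r\<close> is abelian, so \<open>ad x\<close> squares to zero for \<open>x \<in> r\<close>, and nil-invariance makes it
  skew. The point that needs structure theory is that \<open>ad x\<close> is skew for \<open>x \<in> s\<close> as well.
  Skewness of \<open>ad x\<close> is linear in \<open>x\<close>, so it is enough that \<open>s\<close> is spanned by elements that act
  nilpotently on the whole algebra. Such elements arise as eigenvectors \<open>M u = a u\<close>, \<open>a \<noteq> 0\<close>, of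
  a diagonalizable derivation \<open>M\<close>: then \<open>ad u\<close> shifts the eigenspaces of \<open>M\<close>. For every \<open>x \<in> s\<close>
  one such \<open>M\<close> is the ``real part'' of \<open>ad x\<close>, which acts by \<open>Re \<lambda>\<close> on the generalised
  eigenspace of \<open>\<lambda>\<close> (\<open>real_part_operator\<close>). The span \<open>n\<close> of all these eigenvectors is an ideal
  (\<open>graded_span_ideal\<close>). On the complement of \<open>n\<close> in \<open>s\<close> all eigenvalues of \<open>ad x\<close> are purely
  imaginary, because the eigenvectors of the others lie in \<open>n\<close>; hence the Killing form is
  negative definite there, and a minimal ideal in the complement would be a compact simple
  factor. So \<open>n = s\<close> (\<open>graded_elements_span_semisimple\<close>).

  This argument uses that a semisimple algebra is the direct sum of any ideal and its Killing
  complement, that is, Cartan's criterion (\<open>cartan_perfect\<close>). The real-part operator serves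
  there too: if \<open>P\<close> is nonzero and perfect with vanishing Killing form, then \<open>tr (ad x \<circ> M) = \<Sum>
  (Re \<lambda>)\<^sup>2\<close> vanishes for the real part \<open>M\<close> of \<open>ad x\<close>, as \<open>M\<close> is a derivation, and \<open>tr ((ad x)\<^sup>2)
  = \<Sum> \<lambda>\<^sup>2\<close> vanishes by assumption. So all \<open>ad x\<close> are nilpotent, which contradicts Engel's
  theorem. The traces are read off from a triangular form over the complex numbers
  (\<open>trace_power_sums\<close>).

  Once the form is known to be skew under \<open>s\<close> and \<open>r\<close>, the decomposition is explicit. The
  candidate for the dual of \<open>s1\<close> is \<open>sr = [s, r]\<close>, and \<open>a\<close> consists of the elements of \<open>r\<close>
  orthogonal to \<open>s\<close>. Three subspaces turn out to be ideals in the kernel of the form and hence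
  vanish: \<open>[k, sr]\<close>, \<open>sr \<inter> a\<close>, and the kernel of the form on \<open>s0\<close>, the part of \<open>s\<close> orthogonal to
  \<open>r\<close>. With \<open>s1\<close> the Killing complement of \<open>s0\<close> in \<open>s\<close>, the form pairs \<open>sr\<close> perfectly with \<open>s1\<close>,
  which identifies \<open>sr\<close> with the coadjoint module of \<open>s1\<close> and gives \<open>r = a \<oplus> sr\<close>.
\<close>

(* These notions for abstract modules would shadow the ones meant below. *)
hide_const (open) VectorSpace.subspace SumSpaces.direct_sum

section \<open>Linear algebra\<close>

lemma finite_dimensional_subspace_basis:
  fixes V :: "'a::real_vector set"
  assumes "finite_dimensional TYPE('a)" "subspace V"
  obtains C where "finite C" "independent C" "span C = V"
proof -
  obtain B :: "'a set" where B: "finite B" "span B = UNIV"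
    using assms(1) unfolding finite_dimensional_def by blast
  obtain C where C: "C \<subseteq> V" "independent C" "V \<subseteq> span C"
    using real_vector.maximal_independent_subset[of V] by blast
  have "finite C" using real_vector.independent_span_bound[OF B(1) C(2)] B(2) by simp
  moreover have "span C = V" using C assms(2) by (simp add: span_minimal subset_antisym)
  ultimately show ?thesis using that C(2) by blast
qed

lemma independent_finite_of_finite_dimensional:
  fixes C :: "'a::real_vector set"
  assumes "finite_dimensional TYPE('a)" "independent C"
  shows "finite C"
  using assms real_vector.independent_span_bound[of _ C] unfolding finite_dimensional_def by auto

lemma dim_strict_mono:
  fixes U V :: "'a::real_vector set"
  assumes fd: "finite_dimensional TYPE('a)" and "subspace U" "subspace V" "U \<subset> V"
  shows "dim U < dim V"
proof -
  obtain B :: "'a set" where B: "finite B" "independent B" "span B = UNIV"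
    using finite_dimensional_subspace_basis[OF fd subspace_UNIV] .
  interpret F: finite_dimensional_vector_space "scaleR :: real \<Rightarrow> 'a \<Rightarrow> 'a" B
    by unfold_locales (use B in \<open>simp_all add: dependent_raw_def[symmetric] span_raw_def[symmetric]\<close>)
  have "span U \<subset> span V" using assms by (metis span_eq_iff)
  then show ?thesis using F.dim_psubset[of U V] by (simp add: dim_raw_def span_raw_def)
qed

text \<open>
  Extends data given on a subspace, such as a Killing form, to the whole space.
\<close>

lemma subspace_projection:
  fixes W :: "'a::real_vector set"
  assumes "subspace W"
  shows "\<exists>\<pi>. linear \<pi> \<and> (\<forall>x\<in>W. \<pi> x = x) \<and> range \<pi> \<subseteq> W"
proof -
  obtain C where C: "C \<subseteq> W" "independent C" "W \<subseteq> span C"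
    using real_vector.maximal_independent_subset[of W] by blast
  have spC: "span C = W" using C assms by (simp add: span_minimal subset_antisym)
  obtain g where g: "linear g" "\<forall>x\<in>C. g x = id x" "range g = span (id ` C)"
    using real_vector.linear_independent_extend_subspace[OF C(2), of id] by (auto simp: linear_def)
  have "g x = x" if "x \<in> span C" for x
    using that by (induction x rule: span_induct_alt)
      (use g in \<open>simp_all add: linear_0 linear_add linear_scale\<close>)
  then show ?thesis using g spC by auto
qed

lemma span_subset_zero: "S \<subseteq> {0} \<Longrightarrow> span S = {0}" for S :: "'a::real_vector set"
  using span_minimal[of S "{0}"] span_zero[of S] by auto

text \<open>
  Induction on \<open>C\<close>: given dual vectors \<open>w d\<close> for the old elements, the vector \<open>c - \<Sum>d. B (w d) c
  *\<^sub>R d\<close> is nonzero by independence, so some \<open>v\<close> detects it; clearing the components of \<open>v\<close>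
  along the \<open>w d\<close> leaves a vector that sees only \<open>c\<close>.
\<close>

lemma nondegenerate_pairing_dual_vectors:
  fixes B :: "'a::real_vector \<Rightarrow> 'b::real_vector \<Rightarrow> real"
  assumes B: "bilinear B" and V: "subspace V" and "finite C" "independent C"
    and nd: "\<And>u. u \<in> span C \<Longrightarrow> (\<And>v. v \<in> V \<Longrightarrow> B v u = 0) \<Longrightarrow> u = 0"
  shows "\<exists>w. \<forall>c\<in>C. w c \<in> V \<and> (\<forall>d\<in>C. B (w c) d = (if d = c then 1 else 0))"
  using assms(3,4,5)
proof (induction C rule: finite_induct)
  case empty
  then show ?case by simp
next
  case (insert c C)
  have indC: "independent C" using insert.prems(1) by (simp add: independent_insert split: if_splits)
  have "\<exists>w. \<forall>c\<in>C. w c \<in> V \<and> (\<forall>d\<in>C. B (w c) d = (if d = c then 1 else 0))"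
    by (rule insert.IH[OF indC]) (use insert.prems(2) span_mono[of C "insert c C"] in blast)
  then obtain w where w: "\<And>c. c \<in> C \<Longrightarrow> w c \<in> V"
      "\<And>c d. c \<in> C \<Longrightarrow> d \<in> C \<Longrightarrow> B (w c) d = (if d = c then 1 else 0)" by blast
  have ne: "c - (\<Sum>d\<in>C. B (w d) c *\<^sub>R d) \<noteq> 0"
  proof
    assume "c - (\<Sum>d\<in>C. B (w d) c *\<^sub>R d) = 0"
    then have "c = (\<Sum>d\<in>C. B (w d) c *\<^sub>R d)" by simp
    moreover have "(\<Sum>d\<in>C. B (w d) c *\<^sub>R d) \<in> span C" by (intro span_sum span_scale span_base)
    ultimately show False using insert.prems(1) insert.hyps by (simp add: independent_insert)
  qed
  have in_span: "c - (\<Sum>d\<in>C. B (w d) c *\<^sub>R d) \<in> span (insert c C)"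
    by (intro span_diff span_base span_sum span_scale) auto
  obtain v where v: "v \<in> V" "B v (c - (\<Sum>d\<in>C. B (w d) c *\<^sub>R d)) \<noteq> 0"
    using insert.prems(2)[OF in_span] ne by blast
  \<comment> \<open>\<open>B v'\<close> vanishes on \<open>C\<close>, and its value at \<open>c\<close> is the nonzero number just obtained.\<close>
  define v' where "v' = v - (\<Sum>d\<in>C. B v d *\<^sub>R w d)"
  have v'V: "v' \<in> V" unfolding v'_def using v w V
    by (intro subspace_diff subspace_sum subspace_scale) auto
  have Bl: "linear (\<lambda>x. B x y)" and Br: "linear (B x)" for x y using B by (auto simp: bilinear_def)
  have v'C: "B v' d = 0" if "d \<in> C" for d
  proof -
    have "B v' d = B v d - (\<Sum>e\<in>C. B v e * B (w e) d)"
      unfolding v'_def using Bl by (simp add: linear_diff[OF Bl] linear_sum[OF Bl] linear_scale[OF Bl])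
    also have "(\<Sum>e\<in>C. B v e * B (w e) d) = (\<Sum>e\<in>C. if e = d then B v e else 0)"
      using w(2) that by (intro sum.cong) auto
    finally show ?thesis using that insert.hyps by simp
  qed
  have v'c: "B v' c \<noteq> 0"
    using v(2) unfolding v'_def
    by (simp add: linear_diff[OF Bl] linear_sum[OF Bl] linear_scale[OF Bl]
        linear_diff[OF Br] linear_sum[OF Br] linear_scale[OF Br] mult.commute)
  define w' where "w' = (\<lambda>d. if d = c then (1 / B v' c) *\<^sub>R v' else w d - (B (w d) c / B v' c) *\<^sub>R v')"
  have "w' e \<in> V \<and> (\<forall>d\<in>insert c C. B (w' e) d = (if d = e then 1 else 0))" if "e \<in> insert c C" for e
    using that w v'V v'C v'c insert.hyps V
    by (auto simp: w'_def linear_diff[OF Bl] linear_scale[OF Bl] intro!: subspace_diff subspace_scale)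
  then show ?case by blast
qed

text \<open>
  The combination of dual vectors for a basis of \<open>U\<close> with the values of \<open>f\<close> as coefficients
  represents \<open>f\<close>.
\<close>

lemma nondegenerate_pairing_represents:
  fixes B :: "'a::real_vector \<Rightarrow> 'a \<Rightarrow> real"
  assumes fd: "finite_dimensional TYPE('a)" and B: "bilinear B" and V: "subspace V" and U: "subspace U"
    and nd: "\<And>u. u \<in> U \<Longrightarrow> (\<And>v. v \<in> V \<Longrightarrow> B v u = 0) \<Longrightarrow> u = 0"
    and f: "\<And>x y. x \<in> U \<Longrightarrow> y \<in> U \<Longrightarrow> f (x + y) = f x + f y"
      "\<And>c x. x \<in> U \<Longrightarrow> f (c *\<^sub>R x) = c * f x"
  shows "\<exists>v\<in>V. \<forall>u\<in>U. B v u = f u"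
proof -
  obtain C where C: "finite C" "independent C" "span C = U"
    using finite_dimensional_subspace_basis[OF fd U] .
  have nd': "u = 0" if "u \<in> span C" "\<And>v. v \<in> V \<Longrightarrow> B v u = 0" for u
    using nd[of u] that unfolding C(3) by simp
  from nondegenerate_pairing_dual_vectors[OF B V C(1,2) nd']
  obtain w where w: "\<And>c. c \<in> C \<Longrightarrow> w c \<in> V"
      "\<And>c d. c \<in> C \<Longrightarrow> d \<in> C \<Longrightarrow> B (w c) d = (if d = c then 1 else 0)"
    by (metis (no_types, lifting))
  define v where "v = (\<Sum>c\<in>C. f c *\<^sub>R w c)"
  have vV: "v \<in> V" unfolding v_def using w V by (intro subspace_sum subspace_scale) auto
  have Bl: "linear (\<lambda>x. B x y)" and Br: "linear (B x)" for x y using B by (auto simp: bilinear_def)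
  have vC: "B v d = f d" if "d \<in> C" for d
  proof -
    have "B v d = (\<Sum>c\<in>C. f c * B (w c) d)"
      unfolding v_def by (simp add: linear_sum[OF Bl] linear_scale[OF Bl])
    also have "\<dots> = (\<Sum>c\<in>C. if c = d then f c else 0)" using w(2) that by (intro sum.cong) auto
    finally show ?thesis using that C(1) by simp
  qed
  have "B v u = f u \<and> u \<in> U" if "u \<in> span C" for u
    using that
  proof (induction u rule: span_induct_alt)
    case base
    show ?case using f(2)[of 0 0] subspace_0[OF U] linear_0[OF Br] by simp
  next
    case (step c x y)
    have "x \<in> U" using step C span_base by blast
    then show ?case using step f vC U
      by (simp add: linear_add[OF Br] linear_scale[OF Br] subspace_add subspace_scale)
  qed
  then show ?thesis using vV C(3) by blast
qed

lemma direct_sum_pair_iff: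
  fixes A B h :: "'a::real_vector set"
  assumes "subspace A" "subspace B"
  shows "direct_sum h [A, B] \<longleftrightarrow> h = {x + y |x y. x \<in> A \<and> y \<in> B} \<and> A \<inter> B = {0}"
proof -
  have ls: "listset [A, B] = {[x, y] |x y. x \<in> A \<and> y \<in> B}"
    by (auto simp: set_Cons_def)
  have inj: "inj_on sum_list {[x, y] |x y. x \<in> A \<and> y \<in> B} \<longleftrightarrow> A \<inter> B = {0}" (is "?L \<longleftrightarrow> ?R")
  proof
    assume ?L
    show ?R
    proof (rule equalityI; rule subsetI)
      fix z assume z: "z \<in> A \<inter> B"
      have "[z, -z] = [0, 0]"
        by (rule inj_onD[OF \<open>?L\<close>]) (use z assms in \<open>auto simp: subspace_neg subspace_0\<close>)
      then show "z \<in> {0}" by simp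
    qed (use assms in \<open>auto simp: subspace_0\<close>)
  next
    assume R: ?R
    show ?L
    proof (rule inj_onI, clarsimp)
      fix x y x' y' assume *: "x \<in> A" "y \<in> B" "x' \<in> A" "y' \<in> B" "x + y = x' + y'"
      have "x - x' = y' - y" using *(5) by (simp add: algebra_simps)
      then have "x - x' \<in> A \<inter> B"
        using subspace_diff[OF assms(1) *(1,3)] subspace_diff[OF assms(2) *(4,2)] by simp
      then have "x = x'" using R by simp
      then show "x = x' \<and> y = y'" using * by simp
    qed
  qed
  have im: "sum_list ` {[x, y] |x y. x \<in> A \<and> y \<in> B} = {x + y |x y. x \<in> A \<and> y \<in> B}"
  proof (intro equalityI subsetI)
    fix z assume "z \<in> {x + y |x y. x \<in> A \<and> y \<in> B}"
    then obtain x y where "x \<in> A" "y \<in> B" "z = sum_list [x, y]" by auto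
    then show "z \<in> sum_list ` {[x, y] |x y. x \<in> A \<and> y \<in> B}" by blast
  next
    fix z assume "z \<in> sum_list ` {[x, y] |x y. x \<in> A \<and> y \<in> B}"
    then obtain x y where "x \<in> A" "y \<in> B" "z = x + y" by auto
    then show "z \<in> {x + y |x y. x \<in> A \<and> y \<in> B}" by blast
  qed
  have "direct_sum h [A, B] \<longleftrightarrow> A \<inter> B = {0} \<and> {x + y |x y. x \<in> A \<and> y \<in> B} = h"
    unfolding Defs.direct_sum_def ls bij_betw_def inj im by (rule refl)
  then show ?thesis by (simp only: conj_commute eq_commute[of h])
qed

lemma direct_sum_triple:
  fixes A B C h :: "'a::real_vector set"
  assumes "subspace A" "subspace B" "subspace C"
    and sum: "h = {x + y + z |x y z. x \<in> A \<and> y \<in> B \<and> z \<in> C}"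
    and ind: "\<And>x y z. x \<in> A \<Longrightarrow> y \<in> B \<Longrightarrow> z \<in> C \<Longrightarrow> x + y + z = 0 \<Longrightarrow> x = 0 \<and> y = 0 \<and> z = 0"
  shows "direct_sum h [A, B, C]"
proof -
  have ls: "listset [A, B, C] = {[x, y, z] |x y z. x \<in> A \<and> y \<in> B \<and> z \<in> C}"
    by (auto simp: set_Cons_def)
  have "inj_on sum_list {[x, y, z] |x y z. x \<in> A \<and> y \<in> B \<and> z \<in> C}"
  proof (rule inj_onI, clarsimp)
    fix x y z x' y' z'
    assume *: "x \<in> A" "y \<in> B" "z \<in> C" "x' \<in> A" "y' \<in> B" "z' \<in> C" "x + (y + z) = x' + (y' + z')"
    have "(x - x') + (y - y') + (z - z') = 0" using *(7) by (simp add: algebra_simps)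
    from ind[OF _ _ _ this] show "x = x' \<and> y = y' \<and> z = z'"
      using * assms by (simp add: subspace_diff)
  qed
  moreover have "sum_list ` {[x, y, z] |x y z. x \<in> A \<and> y \<in> B \<and> z \<in> C} = h"
  proof (intro equalityI subsetI)
    fix w assume "w \<in> h"
    then obtain x y z where "x \<in> A" "y \<in> B" "z \<in> C" "w = sum_list [x, y, z]"
      unfolding sum by (auto simp: add.assoc)
    then show "w \<in> sum_list ` {[x, y, z] |x y z. x \<in> A \<and> y \<in> B \<and> z \<in> C}" by blast
  next
    fix w assume "w \<in> sum_list ` {[x, y, z] |x y z. x \<in> A \<and> y \<in> B \<and> z \<in> C}"
    then obtain x y z where xyz: "x \<in> A" "y \<in> B" "z \<in> C" "w = x + y + z" by (auto simp: add.assoc)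
    then show "w \<in> h" unfolding sum by blast
  qed
  ultimately show ?thesis unfolding Defs.direct_sum_def ls bij_betw_def by simp
qed

section \<open>The trace on an invariant subspace\<close>

text \<open>
  Expanding \<open>f b\<close> in the basis \<open>D\<close> turns both sides into the same double sum over \<open>C \<times> D\<close>.
\<close>

lemma trace_sum_basis_independent:
  fixes f :: "'a::real_vector \<Rightarrow> 'a"
  assumes C: "finite C" "independent C" "span C = V" and D: "finite D" "independent D" "span D = V"
    and f: "linear f" "f ` V \<subseteq> V"
  shows "(\<Sum>b\<in>C. representation C (f b) b) = (\<Sum>d\<in>D. representation D (f d) d)"
proof -
  have CV: "b \<in> V" if "b \<in> C" for b using C(3) that span_base by blast
  have DV: "b \<in> V" if "b \<in> D" for b using D(3) that span_base by blast
  have 1: "representation C (f b) b = (\<Sum>d\<in>D. representation D (f b) d * representation C d b)"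
    if b: "b \<in> C" for b
  proof -
    have "f b \<in> V" using f CV b by blast
    then have "f b = (\<Sum>d\<in>D. representation D (f b) d *\<^sub>R d)"
      using real_vector.sum_representation_eq[OF D(2) _ D(1) order_refl] D(3) by auto
    then have "representation C (f b) b = representation C (\<Sum>d\<in>D. representation D (f b) d *\<^sub>R d) b"
      by simp
    also have "\<dots> = (\<Sum>d\<in>D. representation C (representation D (f b) d *\<^sub>R d) b)"
      using C DV by (subst real_vector.representation_sum) (auto intro: span_scale)
    also have "\<dots> = (\<Sum>d\<in>D. representation D (f b) d * representation C d b)"
      using C DV by (intro sum.cong refl) (simp add: real_vector.representation_scale)
    finally show ?thesis .
  qed
  have 2: "representation D (f d) d = (\<Sum>b\<in>C. representation D (f b) d * representation C d b)"
    if d: "d \<in> D" for d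
  proof -
    have "d = (\<Sum>b\<in>C. representation C d b *\<^sub>R b)"
      using real_vector.sum_representation_eq[OF C(2) _ C(1) order_refl] C(3) DV[OF d] by auto
    then have "f d = f (\<Sum>b\<in>C. representation C d b *\<^sub>R b)" by simp
    also have "\<dots> = (\<Sum>b\<in>C. representation C d b *\<^sub>R f b)"
      using f(1) by (simp add: linear_sum linear_scale)
    finally have "representation D (f d) d = representation D (\<Sum>b\<in>C. representation C d b *\<^sub>R f b) d"
      by simp
    also have "\<dots> = (\<Sum>b\<in>C. representation D (representation C d b *\<^sub>R f b) d)"
      using D f(2) CV by (subst real_vector.representation_sum) (auto intro: span_scale)
    also have "\<dots> = (\<Sum>b\<in>C. representation C d b * representation D (f b) d)"
      using D f(2) CV by (intro sum.cong refl) (auto simp: real_vector.representation_scale image_subset_iff)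
    finally show ?thesis by (simp add: mult.commute)
  qed
  have "(\<Sum>b\<in>C. representation C (f b) b)
      = (\<Sum>b\<in>C. \<Sum>d\<in>D. representation D (f b) d * representation C d b)"
    using 1 by (intro sum.cong) auto
  also have "\<dots> = (\<Sum>d\<in>D. \<Sum>b\<in>C. representation D (f b) d * representation C d b)"
    by (rule sum.swap)
  also have "\<dots> = (\<Sum>d\<in>D. representation D (f d) d)"
    using 2 by (intro sum.cong) auto
  finally show ?thesis .
qed

lemma trace_on_eq:
  fixes f :: "'a::real_vector \<Rightarrow> 'a"
  assumes "finite C" "independent C" "span C = V" and f: "linear f" "f ` V \<subseteq> V"
  shows "trace_on V f = (\<Sum>b\<in>C. representation C (f b) b)"
proof -
  define D where "D = (SOME C. independent C \<and> span C = V)"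
  have D: "independent D \<and> span D = V"
    unfolding D_def by (rule someI[of _ C]) (use assms in auto)
  have "D \<subseteq> span C" using D assms(3) span_superset by blast
  then have "finite D" using real_vector.independent_span_bound[OF assms(1)] D by blast
  then show ?thesis
    using trace_sum_basis_independent[OF _ _ _ assms(1-3) f, of D] D
    by (simp add: trace_on_def D_def[symmetric] Let_def)
qed

context
  fixes V :: "'a::real_vector set"
  assumes fd: "finite_dimensional TYPE('a)" and V: "subspace V"
begin

lemma trace_on_add:
  assumes "linear f" "f ` V \<subseteq> V" "linear g" "g ` V \<subseteq> V"
  shows "trace_on V (\<lambda>x. f x + g x) = trace_on V f + trace_on V g"
proof -
  obtain C where C: "finite C" "independent C" "span C = V"
    using finite_dimensional_subspace_basis[OF fd V] .
  have CV: "f b \<in> span C" "g b \<in> span C" if "b \<in> C" for b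
    using C(3) that span_base assms(2,4) by blast+
  have "(\<lambda>x. f x + g x) ` V \<subseteq> V" using assms V by (auto intro: subspace_add)
  then show ?thesis
    using trace_on_eq[OF C assms(1,2)] trace_on_eq[OF C assms(3,4)]
      trace_on_eq[OF C linear_compose_add[OF assms(1,3)]]
      CV C(2) by (simp add: real_vector.representation_add sum.distrib)
qed

lemma trace_on_scale:
  assumes "linear f" "f ` V \<subseteq> V"
  shows "trace_on V (\<lambda>x. c *\<^sub>R f x) = c * trace_on V f"
proof -
  obtain C where C: "finite C" "independent C" "span C = V"
    using finite_dimensional_subspace_basis[OF fd V] .
  have CV: "f b \<in> span C" if "b \<in> C" for b
    using C(3) that span_base assms(2) by blast
  have "(\<lambda>x. c *\<^sub>R f x) ` V \<subseteq> V" using assms V by (auto intro: subspace_scale)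
  then show ?thesis
    using trace_on_eq[OF C assms(1,2)]
      trace_on_eq[OF C linear_compose_scale_right[OF assms(1), of c]]
      CV C(2) by (simp add: real_vector.representation_scale sum_distrib_left)
qed

lemma trace_on_diff:
  assumes "linear f" "f ` V \<subseteq> V" "linear g" "g ` V \<subseteq> V"
  shows "trace_on V (\<lambda>x. f x - g x) = trace_on V f - trace_on V g"
proof -
  have g': "linear (\<lambda>x. (-1) *\<^sub>R g x)" "(\<lambda>x. (-1) *\<^sub>R g x) ` V \<subseteq> V"
    using assms V linear_compose_scale_right[OF assms(3), of "-1"] by (auto intro: subspace_neg)
  then show ?thesis
    using trace_on_add[OF assms(1,2) g'] trace_on_scale[OF assms(3,4), of "-1"] by simp
qed

lemma trace_on_sum:
  assumes "finite A" "\<And>i. i \<in> A \<Longrightarrow> linear (f i)" "\<And>i. i \<in> A \<Longrightarrow> f i ` V \<subseteq> V"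
  shows "trace_on V (\<lambda>x. \<Sum>i\<in>A. f i x) = (\<Sum>i\<in>A. trace_on V (f i))"
  using assms
proof (induction A rule: finite_induct)
  case empty
  have "trace_on V (\<lambda>x. 0) = 0"
    using trace_on_scale[of "\<lambda>x. x" 0] by (simp add: linear_iff)
  then show ?case by simp
next
  case (insert i A)
  have "linear (\<lambda>x. \<Sum>i\<in>A. f i x)" using insert by (intro linear_compose_sum) auto
  moreover have "(\<lambda>x. \<Sum>i\<in>A. f i x) ` V \<subseteq> V" using insert V by (auto intro!: subspace_sum)
  ultimately show ?case
    using insert trace_on_add[of "f i" "\<lambda>x. \<Sum>i\<in>A. f i x"] by simp
qed

lemma trace_on_commute:
  assumes "linear f" "f ` V \<subseteq> V" "linear g" "g ` V \<subseteq> V"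
  shows "trace_on V (f \<circ> g) = trace_on V (g \<circ> f)"
proof -
  obtain C where C: "finite C" "independent C" "span C = V"
    using finite_dimensional_subspace_basis[OF fd V] .
  have CV: "b \<in> V" if "b \<in> C" for b using C(3) that span_base by blast
  have key: "representation C (f (g b)) b
      = (\<Sum>d\<in>C. representation C (g b) d * representation C (f d) b)"
    if fg: "linear f" "f ` V \<subseteq> V" "linear g" "g ` V \<subseteq> V" and b: "b \<in> C"
    for f g :: "'a \<Rightarrow> 'a" and b
  proof -
    have gb: "g b \<in> V" using fg CV b by blast
    then have "g b = (\<Sum>d\<in>C. representation C (g b) d *\<^sub>R d)"
      using real_vector.sum_representation_eq[OF C(2) _ C(1) order_refl] C(3) by auto
    then have "f (g b) = f (\<Sum>d\<in>C. representation C (g b) d *\<^sub>R d)" by simp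
    also have "\<dots> = (\<Sum>d\<in>C. representation C (g b) d *\<^sub>R f d)"
      using fg(1) by (simp add: linear_sum linear_scale)
    finally have "representation C (f (g b)) b
        = representation C (\<Sum>d\<in>C. representation C (g b) d *\<^sub>R f d) b" by simp
    also have "\<dots> = (\<Sum>d\<in>C. representation C (representation C (g b) d *\<^sub>R f d) b)"
      using C fg(2) CV by (subst real_vector.representation_sum) (auto intro: span_scale)
    also have "\<dots> = (\<Sum>d\<in>C. representation C (g b) d * representation C (f d) b)"
      using C fg(2) CV
      by (intro sum.cong refl) (auto simp: real_vector.representation_scale image_subset_iff)
    finally show ?thesis .
  qed
  have lin: "linear (f \<circ> g)" "(f \<circ> g) ` V \<subseteq> V" "linear (g \<circ> f)" "(g \<circ> f) ` V \<subseteq> V"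
    using assms by (auto intro: linear_compose)
  have "trace_on V (f \<circ> g)
      = (\<Sum>b\<in>C. \<Sum>d\<in>C. representation C (g b) d * representation C (f d) b)"
    using trace_on_eq[OF C lin(1,2)] key[OF assms] by simp
  also have "\<dots> = (\<Sum>d\<in>C. \<Sum>b\<in>C. representation C (f d) b * representation C (g b) d)"
    by (subst sum.swap) (simp add: mult.commute)
  also have "\<dots> = trace_on V (g \<circ> f)"
    using trace_on_eq[OF C lin(3,4)] key[OF assms(3,4,1,2)] by simp
  finally show ?thesis .
qed

text \<open>
  This is what makes the Killing form of an ideal the restriction of the Killing form: a basis
  of \<open>W\<close> extends to one of \<open>V\<close>, and the additional basis vectors contribute nothing.
\<close>

lemma trace_on_range_subset:
  assumes "linear f" "subspace W" "W \<subseteq> V" "f ` V \<subseteq> W"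
  shows "trace_on V f = trace_on W f"
proof -
  obtain C where C: "finite C" "independent C" "span C = W"
    using finite_dimensional_subspace_basis[OF fd assms(2)] .
  have "C \<subseteq> V" using C assms(3) span_superset by blast
  then obtain D where D: "C \<subseteq> D" "D \<subseteq> V" "independent D" "V \<subseteq> span D"
    using real_vector.maximal_independent_subset_extend[OF _ C(2)] by blast
  have D': "finite D" "span D = V"
    using independent_finite_of_finite_dimensional[OF fd D(3)] D V
    by (auto simp: span_minimal subset_antisym)
  have fDW: "f b \<in> span C" if "b \<in> D" for b using that D assms C by blast
  have rep: "representation D (f b) = representation C (f b)" if "b \<in> D" for b
    using real_vector.representation_extend[OF D(3) fDW[OF that] D(1)] .
  have "trace_on V f = (\<Sum>b\<in>D. representation C (f b) b)"
    using trace_on_eq[OF D'(1) D(3) D'(2) assms(1)] assms rep by (simp add: subset_trans)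
  also have "\<dots> = (\<Sum>b\<in>C. representation C (f b) b)"
  proof (rule sum.mono_neutral_right[OF D'(1) D(1)], rule ballI)
    fix b assume "b \<in> D - C"
    then show "representation C (f b) b = 0"
      using real_vector.representation_ne_zero[of C "f b" b] by auto
  qed
  also have "\<dots> = trace_on W f"
    by (rule trace_on_eq[OF C assms(1), symmetric]) (use assms(3,4) in blast)
  finally show ?thesis .
qed

end

section \<open>Polynomials in an operator\<close>

text \<open>
  A polynomial in an operator \<open>T\<close>, over any field of scalars: it is applied to an operator on
  the real space and to its complexification.
\<close>

locale operator_polynomial = vector_space scale
  for scale :: "'f::field \<Rightarrow> 'b::ab_group_add \<Rightarrow> 'b" +
  fixes T :: "'b \<Rightarrow> 'b"
  assumes T_add: "T (x + y) = T x + T y"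
    and T_scale: "T (scale c x) = scale c (T x)"
begin

definition pop :: "'f poly \<Rightarrow> 'b \<Rightarrow> 'b" where
  "pop p x = (\<Sum>i\<le>degree p. scale (coeff p i) ((T ^^ i) x))"

lemma T_0: "T 0 = 0"
  using T_scale[of 0 0] by simp

lemma T_sum: "T (\<Sum>i\<in>A. f i) = (\<Sum>i\<in>A. T (f i))"
  by (induction A rule: infinite_finite_induct) (simp_all add: T_0 T_add)

lemma pow_add: "(T ^^ i) (x + y) = (T ^^ i) x + (T ^^ i) y"
  by (induction i) (simp_all add: T_add)

lemma pow_scale: "(T ^^ i) (scale c x) = scale c ((T ^^ i) x)"
  by (induction i) (simp_all add: T_scale)

lemma pop_altdef: "degree p \<le> n \<Longrightarrow> pop p x = (\<Sum>i\<le>n. scale (coeff p i) ((T ^^ i) x))"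
  unfolding pop_def by (rule sum.mono_neutral_left) (auto simp: coeff_eq_0)

lemma pop_0 [simp]: "pop 0 x = 0"
  by (simp add: pop_def)

lemma pop_pCons: "pop (pCons c p) x = scale c x + T (pop p x)"
proof -
  have "pop (pCons c p) x = (\<Sum>i\<le>Suc (degree p). scale (coeff (pCons c p) i) ((T ^^ i) x))"
    by (rule pop_altdef) (simp add: degree_pCons_le)
  also have "\<dots> = scale c x + (\<Sum>i\<le>degree p. scale (coeff p i) (T ((T ^^ i) x)))"
    by (subst sum.atMost_Suc_shift) simp
  finally show ?thesis by (simp add: pop_def T_sum T_scale)
qed

lemma pop_1 [simp]: "pop 1 x = x"
  by (simp add: pop_def)

lemma pop_add: "pop (p + q) x = pop p x + pop q x"
proof -
  let ?n = "max (degree p) (degree q)"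
  have "degree (p + q) \<le> ?n" by (rule degree_add_le) auto
  then show ?thesis
    by (simp add: pop_altdef[of _ ?n] scale_left_distrib sum.distrib)
qed

lemma pop_smult: "pop (Polynomial.smult c p) x = scale c (pop p x)"
  by (simp add: pop_altdef[of _ "degree p"] scale_sum_right)

lemma pop_diff: "pop (p - q) x = pop p x - pop q x"
  using pop_add[of p "Polynomial.smult (-1) q" x] pop_smult[of "-1" q x] by simp

lemma pop_sum: "pop (\<Sum>i\<in>A. f i) x = (\<Sum>i\<in>A. pop (f i) x)"
  by (induction A rule: infinite_finite_induct) (simp_all add: pop_add)

lemma pop_arg_add: "pop p (x + y) = pop p x + pop p y"
  by (simp add: pop_def pow_add scale_right_distrib sum.distrib)

lemma pop_arg_scale: "pop p (scale c x) = scale c (pop p x)"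
  by (simp add: pop_def pow_scale scale_sum_right mult.commute)

lemma pop_arg_0 [simp]: "pop p 0 = 0"
  using pop_arg_scale[of p 0 0] by simp

lemma pop_mult: "pop (p * q) x = pop p (pop q x)"
  by (induction p) (simp_all add: mult_pCons_left pop_add pop_smult pop_pCons)

lemma pop_const: "pop [:c:] x = scale c x"
  by (simp add: pop_pCons T_0)

lemma pop_linear: "pop [:- c, 1:] x = T x - scale c x"
  by (simp add: pop_pCons T_0 T_add)

lemma pop_eigen: "T x = scale c x \<Longrightarrow> pop p x = scale (poly p c) x"
  by (induction p) (simp_all add: pop_pCons T_scale scale_left_distrib mult.commute)

lemma pop_mem:
  assumes "module.subspace scale W" "T ` W \<subseteq> W" "x \<in> W"
  shows "pop p x \<in> W"
proof -
  have "(T ^^ i) x \<in> W" for i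
    by (induction i) (use assms in auto)
  then show ?thesis unfolding pop_def
    by (intro subspace_sum[OF assms(1)] subspace_scale[OF assms(1)])
qed

lemma pop_dvd: "p dvd q \<Longrightarrow> pop p x = 0 \<Longrightarrow> pop q x = 0"
  by (auto simp: dvd_def pop_mult mult.commute[of p])

lemma pop_linear_power: "pop ([:- c, 1:] ^ n) x = ((\<lambda>x. T x - scale c x) ^^ n) x"
proof (induction n)
  case (Suc n)
  then show ?case by (simp only: power_Suc pop_mult pop_linear funpow.simps o_apply)
qed simp

end

lemma coprime_linear_powers:
  fixes a b :: complex
  assumes "a \<noteq> b"
  shows "coprime ([:- a, 1:] ^ m) ([:- b, 1:] ^ n)"
proof -
  have "coprime [:- a, 1:] [:- b, 1:]"
  proof (rule coprimeI)
    fix c assume "c dvd [:- a, 1:]" "c dvd [:- b, 1:]"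
    then have "c dvd [:- a, 1:] - [:- b, 1:]" by (rule dvd_diff)
    also have "[:- a, 1:] - [:- b, 1:] = [:b - a:]" by simp
    finally show "is_unit c" using assms dvd_trans by (metis dvd_field_iff is_unit_const_poly_iff right_minus_eq)
  qed
  then show ?thesis by simp
qed

lemma coprime_linear_power_prod:
  fixes z :: complex
  assumes "finite A" "z \<notin> A"
  shows "coprime ([:- z, 1:] ^ n) (\<Prod>a\<in>A. [:- a, 1:] ^ n)"
  proof (rule prod_coprime_right)
  fix a assume "a \<in> A"
  then have "z \<noteq> a" using assms by blast
  then show "coprime ([:- z, 1:] ^ n) ([:- a, 1:] ^ n)" by (rule coprime_linear_powers)
qed

text \<open>
  Interpolation to order \<open>n\<close> at each point of \<open>A\<close>. A new point is added by correcting with a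
  multiple of the product of the old moduli, which is invertible modulo the new one.
\<close>

lemma chinese_remainder_linear_powers:
  fixes A :: "complex set" and c :: "complex \<Rightarrow> complex"
  assumes "finite A"
  shows "\<exists>p. \<forall>a\<in>A. [:- a, 1:] ^ n dvd p - [:c a:]"
  using assms
proof (induction A rule: finite_induct)
  case (insert z A)
  then obtain p where p: "\<forall>a\<in>A. [:- a, 1:] ^ n dvd p - [:c a:]" by blast
  let ?Q = "\<Prod>a\<in>A. [:- a, 1:] ^ n" and ?R = "[:- z, 1:] ^ n"
  have "gcd ?R ?Q = 1" using coprime_linear_power_prod[OF insert.hyps] by simp
  then obtain u v where uv: "u * ?R + v * ?Q = 1"
    using bezout_coefficients_fst_snd[of ?R ?Q] by metis
  define h where "h = p + ?Q * v * ([:c z:] - p)"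
  have "h - [:c z:] = ?R * (u * (p - [:c z:]))"
  proof -
    have "h - [:c z:] = (p - [:c z:]) * (1 - v * ?Q)" by (simp add: h_def algebra_simps)
    also have "1 - v * ?Q = u * ?R" using uv by (simp add: algebra_simps)
    finally show ?thesis by (simp add: ac_simps)
  qed
  then have "?R dvd h - [:c z:]" by simp
  moreover have "[:- a, 1:] ^ n dvd h - [:c a:]" if "a \<in> A" for a
  proof -
    have "[:- a, 1:] ^ n dvd ?Q" using insert.hyps that by (intro dvd_prodI) auto
    then have "[:- a, 1:] ^ n dvd (p - [:c a:]) + ?Q * (v * ([:c z:] - p))"
      using p that by (intro dvd_add) auto
    then show ?thesis by (simp add: h_def algebra_simps)
  qed
  ultimately show ?case by blast
qed simp

lemma prod_linear_powers_dvd: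
  fixes A :: "complex set"
  assumes "finite A" "\<And>a. a \<in> A \<Longrightarrow> [:- a, 1:] ^ n dvd q"
  shows "(\<Prod>a\<in>A. [:- a, 1:] ^ n) dvd q"
  using assms
proof (induction A rule: finite_induct)
  case (insert z A)
  then show ?case
    using coprime_linear_power_prod[OF insert.hyps, of n] by (simp add: divides_mult)
qed simp

lemma dvd_prod_linear_powers_roots:
  fixes m :: "complex poly"
  assumes "m \<noteq> 0"
  shows "m dvd (\<Prod>a | poly m a = 0. [:- a, 1:] ^ degree m)"
proof -
  have "(\<Prod>z | poly m z = 0. [:- z, 1:] ^ Polynomial.order z m) dvd (\<Prod>a | poly m a = 0. [:- a, 1:] ^ degree m)"
    by (intro prod_dvd_prod le_imp_power_dvd order_degree assms)
  moreover have "m dvd (\<Prod>z | poly m z = 0. [:- z, 1:] ^ Polynomial.order z m)"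
    by (subst (1) complex_poly_decompose[of m, symmetric]) (use assms in \<open>simp add: smult_dvd\<close>)
  ultimately show ?thesis by (rule dvd_trans[rotated])
qed

text \<open>
  The polynomials \<open>E a\<close> are \<open>1\<close> modulo \<open>(X - a)\<^sup>n\<close> and \<open>0\<close> modulo the other moduli, so that \<open>E
  a\<close> applied to the operator is the projection to the generalised eigenspace of \<open>a\<close>.
\<close>

lemma primary_decomposition:
  fixes scale :: "complex \<Rightarrow> 'b::ab_group_add \<Rightarrow> 'b"
  assumes "operator_polynomial scale T" "m \<noteq> 0" "\<And>x. operator_polynomial.pop scale T m x = 0"
  defines "A \<equiv> {a. poly m a = 0}" and "n \<equiv> degree m"
  obtains E where
    "\<And>x. x = (\<Sum>a\<in>A. operator_polynomial.pop scale T (E a) x)"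
    "\<And>a x. a \<in> A \<Longrightarrow> operator_polynomial.pop scale T ([:- a, 1:] ^ n)
        (operator_polynomial.pop scale T (E a) x) = 0"
proof -
  interpret operator_polynomial scale T by fact
  have fin: "finite A" using assms(2) unfolding A_def by (rule poly_roots_finite)
  have "\<forall>a. \<exists>p. \<forall>b\<in>A. [:- b, 1:] ^ n dvd p - [:if b = a then 1 else 0:]"
    by (intro allI chinese_remainder_linear_powers[OF fin])
  then obtain E where E: "\<And>a b. b \<in> A \<Longrightarrow> [:- b, 1:] ^ n dvd E a - [:if b = a then 1 else 0:]"
    by metis
  have mdvd: "m dvd q" if "\<And>b. b \<in> A \<Longrightarrow> [:- b, 1:] ^ n dvd q" for q
    using dvd_trans[OF dvd_prod_linear_powers_roots[OF assms(2)]
        prod_linear_powers_dvd[OF fin[unfolded A_def]], of q] that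
    unfolding A_def n_def by blast
  have "m dvd 1 - (\<Sum>a\<in>A. E a)"
  proof (rule mdvd)
    fix b assume b: "b \<in> A"
    have "1 - (\<Sum>a\<in>A. E a) = (\<Sum>a\<in>A. [:if b = a then 1 else 0:] - E a)"
      using fin b by (simp add: sum_subtractf sum.If_cases pCons_one if_distrib[of "\<lambda>x. [:x:]"] cong: if_cong)
    also have "[:- b, 1:] ^ n dvd \<dots>"
      using E[OF b] by (intro dvd_sum) (metis dvd_diff_commute)
    finally show "[:- b, 1:] ^ n dvd 1 - (\<Sum>a\<in>A. E a)" .
  qed
  then have "pop (1 - (\<Sum>a\<in>A. E a)) x = 0" for x using assms(3) pop_dvd by blast
  then have 1: "x = (\<Sum>a\<in>A. pop (E a) x)" for x by (simp add: pop_diff pop_sum)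
  have "m dvd [:- a, 1:] ^ n * E a" if "a \<in> A" for a
  proof (rule mdvd)
    fix b assume b: "b \<in> A"
    show "[:- b, 1:] ^ n dvd [:- a, 1:] ^ n * E a"
      using E[OF b, of a] by (cases "b = a") auto
  qed
  then have "pop ([:- a, 1:] ^ n) (pop (E a) x) = 0" if "a \<in> A" for a x
    using assms(3) pop_dvd that pop_mult by metis
  with 1 show ?thesis using that by blast
qed

lemma (in operator_polynomial) pop_eq_scale:
  assumes "q dvd p - [:c:]" "pop q x = 0"
  shows "pop p x = scale c x"
  using pop_dvd[OF assms] by (simp add: pop_diff pop_const)

lemma real_operator_polynomial: "linear D \<Longrightarrow> operator_polynomial scaleR D"
  by unfold_locales (simp_all add: linear_add linear_scale scaleR_add_right scaleR_add_left)

abbreviation rpop :: "('a::real_vector \<Rightarrow> 'a) \<Rightarrow> real poly \<Rightarrow> 'a \<Rightarrow> 'a" where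
  "rpop D \<equiv> operator_polynomial.pop scaleR D"

text \<open>
  The iterates of \<open>b\<close> under \<open>D\<close> of order up to the dimension are linearly dependent, or two of
  them coincide.
\<close>

lemma exists_polynomial_annihilating_vector:
  fixes D :: "'a::real_vector \<Rightarrow> 'a"
  assumes fd: "finite_dimensional TYPE('a)" and D: "linear D"
  shows "\<exists>p. p \<noteq> 0 \<and> rpop D p b = 0"
proof -
  interpret operator_polynomial scaleR D by (rule real_operator_polynomial[OF D])
  obtain B :: "'a set" where B: "finite B" "span B = UNIV"
    using fd unfolding finite_dimensional_def by blast
  let ?N = "card B" and ?f = "\<lambda>i. (D ^^ i) b"
  have "\<exists>a i. i \<le> ?N \<and> a i \<noteq> 0 \<and> (\<Sum>i\<le>?N. a i *\<^sub>R ?f i) = 0"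
  proof (cases "inj_on ?f {..?N}")
    case True
    then have c: "card (?f ` {..?N}) = Suc ?N" by (simp add: card_image)
    have "dependent (?f ` {..?N})"
    proof (rule ccontr)
      assume "\<not> dependent (?f ` {..?N})"
      then have "card (?f ` {..?N}) \<le> card B"
        using real_vector.independent_span_bound[OF B(1)] B(2) by auto
      with c show False by simp
    qed
    then obtain u v where "v \<in> ?f ` {..?N}" "u v \<noteq> 0" "(\<Sum>v\<in>?f ` {..?N}. u v *\<^sub>R v) = 0"
      by (subst (asm) real_vector.dependent_finite) auto
    then show ?thesis
      using True by (intro exI[of _ "\<lambda>i. u (?f i)"]) (auto simp: sum.reindex)
  next
    case False
    then obtain i j where ij: "i \<le> ?N" "j \<le> ?N" "i \<noteq> j" "?f i = ?f j" by (auto simp: inj_on_def)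
    define a :: "nat \<Rightarrow> real" where "a = (\<lambda>k. (if k = i then 1 else 0) - (if k = j then 1 else 0))"
    have "(\<Sum>k\<le>?N. a k *\<^sub>R ?f k) = ?f i - ?f j"
      using ij(1,2) by (simp add: a_def scaleR_diff_left sum_subtractf if_distrib[of "\<lambda>x. x *\<^sub>R _"] cong: if_cong)
    then show ?thesis using ij by (intro exI[of _ a] exI[of _ i]) (auto simp: a_def)
  qed
  then obtain a i where a: "i \<le> ?N" "a i \<noteq> 0" "(\<Sum>i\<le>?N. a i *\<^sub>R ?f i) = 0" by blast
  define p where "p = (\<Sum>i\<le>?N. monom (a i) i)"
  have cp: "coeff p j = (if j \<le> ?N then a j else 0)" for j
    by (simp add: p_def coeff_sum)
  have "degree p \<le> ?N" by (rule degree_le) (simp add: cp)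
  then have "pop p b = 0" using a(3) by (simp add: pop_altdef[of _ ?N] cp)
  moreover have "p \<noteq> 0" using cp[of i] a by auto
  ultimately show ?thesis by blast
qed

lemma exists_annihilating_polynomial:
  fixes D :: "'a::real_vector \<Rightarrow> 'a"
  assumes fd: "finite_dimensional TYPE('a)" and D: "linear D"
  shows "\<exists>p. p \<noteq> 0 \<and> (\<forall>x. rpop D p x = 0)"
proof -
  interpret operator_polynomial scaleR D by (rule real_operator_polynomial[OF D])
  obtain B :: "'a set" where B: "finite B" "span B = UNIV"
    using fd unfolding finite_dimensional_def by blast
  obtain q where q: "\<And>b. q b \<noteq> 0" "\<And>b. pop (q b) b = 0"
    using exists_polynomial_annihilating_vector[OF fd D] by metis
  let ?p = "\<Prod>b\<in>B. q b"
  have pB: "pop ?p b = 0" if "b \<in> B" for b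
    by (rule pop_dvd[OF _ q(2)]) (use B(1) that in \<open>auto intro: dvd_prodI\<close>)
  have "pop ?p x = 0" if "x \<in> span B" for x
    using that by (induction x rule: span_induct_alt) (simp_all add: pop_arg_add pop_arg_scale pB)
  then show ?thesis using q(1) B by (intro exI[of _ ?p]) auto
qed

section \<open>The real part of an operator\<close>

text \<open>
  The pair \<open>(u, v)\<close> stands for \<open>u + \<i> v\<close> in the complexification of \<open>'a\<close>.
\<close>

definition cscale :: "complex \<Rightarrow> 'a::real_vector \<times> 'a \<Rightarrow> 'a \<times> 'a" where
  "cscale z w = (Re z *\<^sub>R fst w - Im z *\<^sub>R snd w, Re z *\<^sub>R snd w + Im z *\<^sub>R fst w)"

lemma complex_operator_polynomial:
  assumes "linear D"
  shows "operator_polynomial cscale (map_prod D D)"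
proof -
  interpret linear D by fact
  show ?thesis
    by unfold_locales
      (auto simp: cscale_def algebra_simps prod_eq_iff add diff scale)
qed

abbreviation cpop :: "('a::real_vector \<Rightarrow> 'a) \<Rightarrow> complex poly \<Rightarrow> 'a \<times> 'a \<Rightarrow> 'a \<times> 'a" where
  "cpop D \<equiv> operator_polynomial.pop cscale (map_prod D D)"

lemma map_prod_pow:
  fixes D :: "'a \<Rightarrow> 'a"
  shows "(map_prod D D ^^ i) (u, v) = ((D ^^ i) u, (D ^^ i) v)"
  by (induction i) auto

lemma cpop_real:
  assumes "linear D"
  shows "cpop D (map_poly of_real p) (u, v) = (rpop D p u, rpop D p v)"
proof -
  interpret r: operator_polynomial scaleR D by (rule real_operator_polynomial[OF assms])
  interpret c: operator_polynomial cscale "map_prod D D"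
    by (rule complex_operator_polynomial[OF assms])
  have "degree (map_poly complex_of_real p) = degree p" by (simp add: degree_map_poly)
  then show ?thesis
    by (simp add: r.pop_def c.pop_def coeff_map_poly map_prod_pow cscale_def sum_prod)
qed

text \<open>
  Complex conjugation on the complexification.
\<close>

definition cconj :: "'a::real_vector \<times> 'a \<Rightarrow> 'a \<times> 'a" where
  "cconj w = (fst w, - snd w)"

lemma cconj_cpop:
  assumes "linear D"
  shows "cconj (cpop D p w) = cpop D (map_poly cnj p) (cconj w)"
proof -
  interpret c: operator_polynomial cscale "map_prod D D"
    by (rule complex_operator_polynomial[OF assms])
  interpret D: linear D by fact
  have deg: "degree (map_poly cnj p) = degree p" by (simp add: degree_map_poly)
  have pow: "(D ^^ i) (- x) = - (D ^^ i) x" for i x by (induction i) (simp_all add: D.neg)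
  have pw: "(map_prod D D ^^ i) (cconj w) = cconj ((map_prod D D ^^ i) w)" for i
    by (cases w) (simp add: cconj_def map_prod_pow pow)
  have add: "cconj (x + y) = cconj x + cconj y" for x y :: "'a \<times> 'a" by (simp add: cconj_def)
  have sum: "cconj (\<Sum>i\<in>A. f i) = (\<Sum>i\<in>A. cconj (f i))" for f :: "nat \<Rightarrow> 'a \<times> 'a" and A
    by (induction A rule: infinite_finite_induct) (simp_all add: add, simp_all add: cconj_def zero_prod_def)
  have sc: "cconj (cscale z x) = cscale (cnj z) (cconj x)" for z and x :: "'a \<times> 'a"
    by (simp add: cconj_def cscale_def)
  show ?thesis unfolding c.pop_def deg pw sum by (simp add: coeff_map_poly sc)
qed

definition derivation :: "('a::real_vector \<Rightarrow> 'a \<Rightarrow> 'a) \<Rightarrow> ('a \<Rightarrow> 'a) \<Rightarrow> bool" where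
  "derivation br D \<longleftrightarrow> linear D \<and> (\<forall>x y. D (br x y) = br (D x) y + br x (D y))"

text \<open>
  The complex bilinear extension of the bracket.
\<close>

definition cbr :: "('a::real_vector \<Rightarrow> 'a \<Rightarrow> 'a) \<Rightarrow> 'a \<times> 'a \<Rightarrow> 'a \<times> 'a \<Rightarrow> 'a \<times> 'a" where
  "cbr br u v = (br (fst u) (fst v) - br (snd u) (snd v), br (fst u) (snd v) + br (snd u) (fst v))"

text \<open>
  By the Leibniz rule, \<open>D - (a + b)\<close> applied to a bracket is the sum of the brackets with \<open>D -
  a\<close> applied to the first or \<open>D - b\<close> to the second entry, so after \<open>m + n\<close> steps one of the two
  entries is zero.
\<close>

lemma generalized_eigenvectors_bracket:
  assumes br: "bilinear br" and D: "derivation br D"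
    and u: "((\<lambda>x. map_prod D D x - cscale a x) ^^ m) u = 0"
    and v: "((\<lambda>x. map_prod D D x - cscale b x) ^^ n) v = 0"
  shows "((\<lambda>x. map_prod D D x - cscale (a + b) x) ^^ (m + n)) (cbr br u v) = 0"
proof -
  let ?S = "\<lambda>c x. map_prod D D x - cscale c x"
  have l: "linear D" and der: "\<And>x y. D (br x y) = br (D x) y + br x (D y)"
    using D by (auto simp: derivation_def)
  interpret D: linear D by fact
  note bil = bilinear_ladd[OF br] bilinear_radd[OF br] bilinear_lsub[OF br] bilinear_rsub[OF br]
    bilinear_lmul[OF br] bilinear_rmul[OF br]
  have leib: "?S (a + b) (cbr br u v) = cbr br (?S a u) v + cbr br u (?S b v)" for u v
    by (simp add: cbr_def cscale_def prod_eq_iff der D.add D.diff bil algebra_simps)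
  have c0: "cbr br 0 v = 0" "cbr br u 0 = 0" for u v
    using bilinear_lzero[OF br] bilinear_rzero[OF br] by (simp_all add: cbr_def zero_prod_def)
  have S0: "?S c 0 = 0" for c by (simp add: cscale_def zero_prod_def prod_eq_iff D.zero)
  have Sadd: "?S c (x + y) = ?S c x + ?S c y" for c x y
    by (simp add: cscale_def prod_eq_iff D.add algebra_simps)
  have Spow0: "(?S c ^^ k) 0 = 0" for c k
    by (induction k) (simp_all only: funpow.simps id_apply o_apply S0)
  have Spowadd: "(?S c ^^ k) (x + y) = (?S c ^^ k) x + (?S c ^^ k) y" for c k x y
    by (induction k) (simp_all only: funpow.simps id_apply o_apply Sadd)
  show ?thesis using u v
  proof (induction "m + n" arbitrary: m n u v)
    case 0
    then show ?case by (simp add: c0)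
  next
    case (Suc k)
    show ?case
    proof (cases "m = 0 \<or> n = 0")
      case True
      then have "cbr br u v = 0"
        using Suc.prems by (elim disjE) (simp_all only: funpow.simps id_apply c0)
      then show ?thesis using Spow0 by simp
    next
      case False
      then obtain m' n' where mn: "m = Suc m'" "n = Suc n'" by (meson not0_implies_Suc)
      have k: "k = m' + n" "k = m + n'" using Suc.hyps(2) mn by simp_all
      have u': "(?S a ^^ m') (?S a u) = 0" and v': "(?S b ^^ n') (?S b v) = 0"
        using Suc.prems unfolding mn by (simp_all only: funpow_Suc_right o_apply)
      have 1: "(?S (a + b) ^^ (m' + n)) (cbr br (?S a u) v) = 0"
        using k(1) u' Suc.prems(2) by (rule Suc.hyps(1))
      have 2: "(?S (a + b) ^^ (m + n')) (cbr br u (?S b v)) = 0"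
        using k(2) Suc.prems(1) v' by (rule Suc.hyps(1))
      have "(?S (a + b) ^^ (m + n)) (cbr br u v) = (?S (a + b) ^^ k) (?S (a + b) (cbr br u v))"
        unfolding Suc.hyps(2)[symmetric] by (simp only: funpow_Suc_right o_apply)
      also have "\<dots> = 0"
        unfolding leib Spowadd using 1 2 k by simp
      finally show ?thesis .
    qed
  qed
qed

text \<open>
  The first two clauses fix the behaviour on eigenvectors \<open>u + \<i> v\<close> for \<open>a + \<i> b\<close>; the third one
  says that \<open>p(D)\<close> is diagonalizable on every invariant subspace. That \<open>p(D)\<close> is a polynomial in
  \<open>D\<close> matters for traces of products \<open>D \<circ> p(D)\<close>.
\<close>

definition real_part_polynomial :: "('a::real_vector \<Rightarrow> 'a) \<Rightarrow> real poly \<Rightarrow> bool" where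
  "real_part_polynomial D p \<longleftrightarrow>
    (\<forall>u v a b. D u = a *\<^sub>R u - b *\<^sub>R v \<longrightarrow> D v = b *\<^sub>R u + a *\<^sub>R v
       \<longrightarrow> rpop D p u = a *\<^sub>R u \<and> rpop D p v = a *\<^sub>R v) \<and>
    (\<forall>u v a b. D u = a *\<^sub>R u - b *\<^sub>R v \<longrightarrow> D v = b *\<^sub>R u + a *\<^sub>R v
       \<longrightarrow> u \<noteq> 0 \<or> v \<noteq> 0 \<longrightarrow> poly (map_poly of_real p) (Complex a b) = of_real a) \<and>
    (\<forall>W x. subspace W \<longrightarrow> D ` W \<subseteq> W \<longrightarrow> x \<in> W
       \<longrightarrow> x \<in> span {w \<in> W. \<exists>a. rpop D p w = a *\<^sub>R w}) \<and>
    (\<forall>br. bilinear br \<longrightarrow> derivation br D \<longrightarrow> derivation br (rpop D p))"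

text \<open>
  The operator that acts by \<open>Re \<lambda>\<close> on the generalised eigenspace of \<open>\<lambda>\<close> is a real polynomial in
  \<open>D\<close>, so that it preserves every subspace that \<open>D\<close> preserves. Since \<open>Re\<close> is additive and
  brackets add eigenvalues, it is a derivation whenever \<open>D\<close> is.
\<close>

lemma real_part_operator:
  fixes D :: "'a::real_vector \<Rightarrow> 'a"
  assumes fd: "finite_dimensional TYPE('a)" and l: "linear D"
  shows "\<exists>p. real_part_polynomial D p"
proof -
  let ?T = "map_prod D D"
  interpret r: operator_polynomial scaleR D by (rule real_operator_polynomial[OF l])
  interpret c: operator_polynomial cscale ?T by (rule complex_operator_polynomial[OF l])
  obtain m where m: "m \<noteq> 0" "\<And>x. rpop D m x = 0"
    using exists_annihilating_polynomial[OF fd l] by blast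
  define mc where "mc = map_poly complex_of_real m"
  have mc0: "mc \<noteq> 0" using m(1) unfolding mc_def by (simp add: map_poly_eq_0_iff)
  have mc: "c.pop mc w = 0" for w
    using cpop_real[OF l, of m "fst w" "snd w"] m(2) by (simp add: mc_def zero_prod_def)
  define A where "A = {a. poly mc a = 0}"
  define n where "n = degree mc"
  have finA: "finite A" unfolding A_def using mc0 by (rule poly_roots_finite)
  obtain E where E: "\<And>w. w = (\<Sum>a\<in>A. c.pop (E a) w)"
      "\<And>a w. a \<in> A \<Longrightarrow> c.pop ([:- a, 1:] ^ n) (c.pop (E a) w) = 0"
    using primary_decomposition[OF complex_operator_polynomial[OF l] mc0 mc] unfolding A_def n_def
    by blast
  \<comment> \<open>The sums are included because brackets of eigenvectors have them as eigenvalues; the order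
    \<open>N = n + n\<close> is the one with which the brackets occur. Conjugates make it possible to
    average \<open>p0\<close> with its conjugate polynomial \<open>q\<close>, which gives a real polynomial.\<close>
  define S where "S = A \<union> (\<lambda>(a, b). a + b) ` (A \<times> A)"
  have finS: "finite (S \<union> cnj ` S)" using finA by (simp add: S_def)
  define N where "N = n + n"
  obtain p0 where p0: "\<And>a. a \<in> S \<union> cnj ` S \<Longrightarrow> [:- a, 1:] ^ N dvd p0 - [:of_real (Re a):]"
    using chinese_remainder_linear_powers[OF finS, of N "\<lambda>a. of_real (Re a)"] by blast
  have p0_eig: "c.pop p0 w = cscale (of_real (Re a)) w"
    if "a \<in> S \<union> cnj ` S" "c.pop ([:- a, 1:] ^ N) w = 0" for a w
    using c.pop_eq_scale[OF p0] that by blast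
  define q where "q = map_poly cnj p0"
  have conj_eig: "c.pop ([:- cnj a, 1:] ^ N) (cconj w) = 0"
    if "c.pop ([:- a, 1:] ^ N) w = 0" for a w
  proof -
    have step: "cconj (?T x - cscale a x) = ?T (cconj x) - cscale (cnj a) (cconj x)" for x
      by (simp add: cconj_def cscale_def prod_eq_iff linear_diff[OF l] linear_neg[OF l] algebra_simps)
    have "cconj (((\<lambda>x. ?T x - cscale a x) ^^ k) w) = ((\<lambda>x. ?T x - cscale (cnj a) x) ^^ k) (cconj w)"
      for k
      by (induction k) (simp_all only: funpow.simps id_apply o_apply step)
    from this[of N] that show ?thesis by (simp add: c.pop_linear_power cconj_def zero_prod_def)
  qed
  have q_eig: "c.pop q w = cscale (of_real (Re a)) w"
    if a: "a \<in> S" and w: "c.pop ([:- a, 1:] ^ N) w = 0" for a w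
  proof -
    have cc: "cconj (cconj w) = w" by (simp add: cconj_def)
    have "c.pop p0 (cconj w) = cscale (of_real (Re (cnj a))) (cconj w)"
      using a conj_eig[OF w] by (intro p0_eig) auto
    then have "cconj (c.pop p0 (cconj w)) = cconj (cscale (of_real (Re a)) (cconj w))" by simp
    then show ?thesis
      unfolding cconj_cpop[OF l] cc q_def by (simp add: cconj_def cscale_def)
  qed
  define p where "p = map_poly Re p0"
  have pq: "map_poly complex_of_real p = Polynomial.smult (1/2) (p0 + q)"
    by (rule poly_eqI) (simp add: p_def q_def coeff_map_poly complex_eq_iff)
  define Rc where "Rc = c.pop (map_poly complex_of_real p)"
  have Rc: "Rc (u, v) = (rpop D p u, rpop D p v)" for u v
    unfolding Rc_def by (rule cpop_real[OF l])
  have Rc_eig: "Rc w = cscale (of_real (Re a)) w"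
    if a: "a \<in> S" and w: "c.pop ([:- a, 1:] ^ N) w = 0" for a w
  proof -
    have "Rc w = cscale (1/2) (cscale (of_real (Re a)) w + cscale (of_real (Re a)) w)"
      using p0_eig[OF _ w] q_eig[OF a w] a by (simp add: Rc_def pq c.pop_smult c.pop_add)
    then show ?thesis by (simp add: c.scale_right_distrib flip: c.scale_left_distrib)
  qed
  have nN: "c.pop ([:- a, 1:] ^ N) w = 0" if "c.pop ([:- a, 1:] ^ n) w = 0" for a w
    using that by (rule c.pop_dvd[rotated]) (simp add: N_def le_imp_power_dvd)
  have E_eig: "Rc (c.pop (E a) w) = cscale (of_real (Re a)) (c.pop (E a) w)" if "a \<in> A" for a w
    using that E(2) nN by (intro Rc_eig) (auto simp: S_def)

  have eig: "Complex a b \<in> A \<and> Rc (u, v) = cscale (of_real a) (u, v)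
      \<and> poly (map_poly of_real p) (Complex a b) = of_real a"
    if uv: "D u = a *\<^sub>R u - b *\<^sub>R v" "D v = b *\<^sub>R u + a *\<^sub>R v" and ne: "u \<noteq> 0 \<or> v \<noteq> 0" for u v a b
  proof -
    have T: "?T (u, v) = cscale (Complex a b) (u, v)" using uv by (simp add: cscale_def)
    have ne': "(u, v) \<noteq> 0" using ne by (simp add: zero_prod_def)
    have "cscale (poly mc (Complex a b)) (u, v) = 0" using c.pop_eigen[OF T, of mc] mc by simp
    then have root: "poly mc (Complex a b) = 0" using ne' by (simp only: c.scale_eq_0_iff) blast
    have "n \<noteq> 0"
    proof
      assume "n = 0"
      then obtain z where "mc = [:z:]" unfolding n_def by (rule degree_eq_zeroE)
      with root mc0 show False by simp
    qed
    then have "c.pop ([:- Complex a b, 1:] ^ N) (u, v) = 0"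
      unfolding c.pop_eigen[OF T] by (simp add: N_def power_0_left)
    moreover have inA: "Complex a b \<in> A" using root by (simp add: A_def)
    ultimately have R: "Rc (u, v) = cscale (of_real a) (u, v)"
      using Rc_eig[of "Complex a b" "(u, v)"] by (simp add: S_def)
    then have "cscale (poly (map_poly of_real p) (Complex a b)) (u, v) = cscale (of_real a) (u, v)"
      unfolding Rc_def c.pop_eigen[OF T] .
    then have "poly (map_poly of_real p) (Complex a b) = of_real a"
      using ne' by (simp only: c.scale_cancel_right) blast
    with inA R show ?thesis by blast
  qed

  have Rc_add: "Rc (x + y) = Rc x + Rc y" for x y by (simp add: Rc_def c.pop_arg_add)

  show ?thesis
    unfolding real_part_polynomial_def
  proof (rule exI[of _ p], intro conjI[OF _ conjI[OF _ conjI]] allI impI)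
    fix u v :: 'a and a b
    assume uv: "D u = a *\<^sub>R u - b *\<^sub>R v" "D v = b *\<^sub>R u + a *\<^sub>R v"
    show "rpop D p u = a *\<^sub>R u \<and> rpop D p v = a *\<^sub>R v"
    proof (cases "u \<noteq> 0 \<or> v \<noteq> 0")
      case True
      then show ?thesis using eig[OF uv] by (simp add: Rc cscale_def)
    qed simp
  next
    fix u v :: 'a and a b
    assume "D u = a *\<^sub>R u - b *\<^sub>R v" "D v = b *\<^sub>R u + a *\<^sub>R v" "u \<noteq> 0 \<or> v \<noteq> 0"
    then show "poly (map_poly of_real p) (Complex a b) = of_real a" using eig by blast
  next
    fix W :: "'a set" and x
    assume W: "subspace W" "D ` W \<subseteq> W" "x \<in> W"
    have sub: "c.subspace (W \<times> W)"
      using W(1) by (auto simp: c.subspace_def cscale_def zero_prod_def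
          intro!: subspace_add subspace_diff subspace_scale subspace_0)
    have mem: "fst (c.pop (E a) (x, 0)) \<in> {w \<in> W. \<exists>a. rpop D p w = a *\<^sub>R w}" if "a \<in> A" for a
    proof -
      have "c.pop (E a) (x, 0) \<in> W \<times> W"
        using W by (intro c.pop_mem[OF sub]) (auto simp: subspace_0)
      moreover obtain w1 w2 where w: "c.pop (E a) (x, 0) = (w1, w2)" by (meson surj_pair)
      moreover have "rpop D p w1 = Re a *\<^sub>R w1"
        using E_eig[OF that, of "(x, 0)"] unfolding w Rc by (simp add: cscale_def)
      ultimately show ?thesis by auto
    qed
    have "x = fst (\<Sum>a\<in>A. c.pop (E a) (x, 0))" using E(1)[of "(x, 0)"] by simp
    also have "\<dots> = (\<Sum>a\<in>A. fst (c.pop (E a) (x, 0)))" by (simp add: fst_sum)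
    also have "\<dots> \<in> span {w \<in> W. \<exists>a. rpop D p w = a *\<^sub>R w}"
      using mem by (intro span_sum span_base)
    finally show "x \<in> span {w \<in> W. \<exists>a. rpop D p w = a *\<^sub>R w}" .
  next
    fix br :: "'a \<Rightarrow> 'a \<Rightarrow> 'a"
    assume br: "bilinear br" and der: "derivation br D"
    note bil = bilinear_ladd[OF br] bilinear_radd[OF br] bilinear_lzero[OF br] bilinear_rzero[OF br]
      bilinear_lmul[OF br] bilinear_rmul[OF br]
    define F where "F = (\<lambda>u v. Rc (cbr br u v) = cbr br (Rc u) v + cbr br u (Rc v))"
    have cadd: "cbr br (u + u') v = cbr br u v + cbr br u' v"
      "cbr br u (v + v') = cbr br u v + cbr br u v'" for u u' v v'
      by (simp_all add: cbr_def bil)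
    have c0: "cbr br 0 v = 0" "cbr br u 0 = 0" for u v
      by (simp_all add: cbr_def bil zero_prod_def)
    have csc: "cbr br (cscale z u) v = cscale z (cbr br u v)"
      "cbr br u (cscale z v) = cscale z (cbr br u v)" for z u v
      by (simp_all add: cbr_def cscale_def bil bilinear_lsub[OF br] bilinear_rsub[OF br] algebra_simps)
    have Rc0: "Rc 0 = 0" by (simp add: Rc_def)
    have F_l: "F (\<Sum>a\<in>B. f a) v" if "\<And>a. a \<in> B \<Longrightarrow> F (f a) v"
      for B :: "complex set" and f v
      using that by (induction B rule: infinite_finite_induct) (simp_all add: F_def c0 Rc0 cadd Rc_add)
    have F_r: "F u (\<Sum>a\<in>B. f a)" if "\<And>a. a \<in> B \<Longrightarrow> F u (f a)"
      for B :: "complex set" and f u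
      using that by (induction B rule: infinite_finite_induct) (simp_all add: F_def c0 Rc0 cadd Rc_add)
    have F_E: "F (c.pop (E a) u) (c.pop (E b) v)" if ab: "a \<in> A" "b \<in> A" for a b u v
    proof -
      have "c.pop ([:- (a + b), 1:] ^ N) (cbr br (c.pop (E a) u) (c.pop (E b) v)) = 0"
        unfolding c.pop_linear_power N_def
        using E(2)[OF ab(1), of u] E(2)[OF ab(2), of v]
        by (intro generalized_eigenvectors_bracket[OF br der]) (simp_all add: c.pop_linear_power)
      then have "Rc (cbr br (c.pop (E a) u) (c.pop (E b) v))
          = cscale (of_real (Re (a + b))) (cbr br (c.pop (E a) u) (c.pop (E b) v))"
        using ab by (intro Rc_eig) (auto simp: S_def)
      then show ?thesis
        unfolding F_def E_eig[OF ab(1)] E_eig[OF ab(2)] csc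
        by (simp add: c.scale_left_distrib)
    qed
    have F: "F u v" for u v
    proof -
      have "F (\<Sum>a\<in>A. c.pop (E a) u) (\<Sum>b\<in>A. c.pop (E b) v)"
        by (intro F_l F_r F_E)
      then show ?thesis using E(1)[of u] E(1)[of v] by simp
    qed
    have "rpop D p (br x y) = br (rpop D p x) y + br x (rpop D p y)" for x y
      using F[of "(x, 0)" "(y, 0)"] by (simp add: F_def cbr_def Rc bil)
    then show "derivation br (rpop D p)"
      by (simp add: derivation_def linear_iff r.pop_arg_add r.pop_arg_scale)
  qed
qed

section \<open>Traces of powers as power sums of eigenvalues\<close>

lemma upper_triangular_pow_entries:
  fixes U :: "'a::comm_ring_1 mat"
  assumes U: "U \<in> carrier_mat n n" and ut: "upper_triangular U"
  shows "(\<forall>i<n. \<forall>j<i. (U ^\<^sub>m k) $$ (i, j) = 0) \<and> (\<forall>i<n. (U ^\<^sub>m k) $$ (i, i) = (U $$ (i, i)) ^ k)"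
proof (induction k)
  case 0
  then show ?case using U by auto
next
  case (Suc k)
  have Uk: "U ^\<^sub>m k \<in> carrier_mat n n" using U by simp
  have ent: "(U ^\<^sub>m Suc k) $$ (i, j) = (\<Sum>l<n. (U ^\<^sub>m k) $$ (i, l) * U $$ (l, j))"
    if "i < n" "j < n" for i j
    using that U Uk by (simp add: scalar_prod_def lessThan_atLeast0)
  have low: "U $$ (l, j) = 0" if "j < l" "l < n" for l j
    using ut that U by (auto simp: upper_triangular_def)
  have "(U ^\<^sub>m Suc k) $$ (i, j) = 0" if ij: "i < n" "j < i" for i j
  proof -
    have "(U ^\<^sub>m k) $$ (i, l) * U $$ (l, j) = 0" if "l < n" for l
      using Suc low[of j l] ij that by (cases "l < i") auto
    then show ?thesis using ent[of i j] ij by simp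
  qed
  moreover have "(U ^\<^sub>m Suc k) $$ (i, i) = (U $$ (i, i)) ^ Suc k" if i: "i < n" for i
  proof -
    have "(\<Sum>l<n. (U ^\<^sub>m k) $$ (i, l) * U $$ (l, i)) = (\<Sum>l\<in>{i}. (U ^\<^sub>m k) $$ (i, l) * U $$ (l, i))"
    proof (rule sum.mono_neutral_right)
      show "\<forall>l\<in>{..<n} - {i}. (U ^\<^sub>m k) $$ (i, l) * U $$ (l, i) = 0"
      proof
        fix l assume "l \<in> {..<n} - {i}"
        then show "(U ^\<^sub>m k) $$ (i, l) * U $$ (l, i) = 0"
          using Suc low[of i l] i by (cases "l < i") auto
      qed
    qed (use i in auto)
    then show ?thesis using ent[OF i i] Suc i by (simp add: mult.commute)
  qed
  ultimately show ?case by blast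
qed

lemma strictly_upper_triangular_pow:
  fixes U :: "'a::comm_ring_1 mat"
  assumes U: "U \<in> carrier_mat n n" and low: "\<And>i j. i < n \<Longrightarrow> j \<le> i \<Longrightarrow> U $$ (i, j) = 0"
  shows "\<forall>i<n. \<forall>j<n. j < i + k \<longrightarrow> (U ^\<^sub>m k) $$ (i, j) = 0"
proof (induction k)
  case 0
  then show ?case using U by auto
next
  case (Suc k)
  have Uk: "U ^\<^sub>m k \<in> carrier_mat n n" using U by simp
  have "(U ^\<^sub>m Suc k) $$ (i, j) = 0" if "i < n" "j < n" "j < i + Suc k" for i j
  proof -
    have "(U ^\<^sub>m k) $$ (i, l) * U $$ (l, j) = 0" if "l < n" for l
      using Suc low[of l j] \<open>i < n\<close> \<open>j < i + Suc k\<close> that by (cases "l < i + k") auto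
    then show ?thesis
      using that U Uk by (simp add: scalar_prod_def)
  qed
  then show ?case by blast
qed

lemma sum_diag_mult_commute:
  fixes X Y :: "'a::comm_ring_1 mat"
  assumes "X \<in> carrier_mat n n" "Y \<in> carrier_mat n n"
  shows "(\<Sum>i<n. (X * Y) $$ (i, i)) = (\<Sum>i<n. (Y * X) $$ (i, i))"
proof -
  have "(\<Sum>i<n. (X * Y) $$ (i, i)) = (\<Sum>i<n. \<Sum>l<n. X $$ (i, l) * Y $$ (l, i))"
    using assms by (intro sum.cong) (auto simp: scalar_prod_def lessThan_atLeast0)
  also have "\<dots> = (\<Sum>l<n. \<Sum>i<n. Y $$ (l, i) * X $$ (i, l))"
    by (subst sum.swap) (simp add: mult.commute)
  also have "\<dots> = (\<Sum>i<n. (Y * X) $$ (i, i))"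
    using assms by (intro sum.cong) (auto simp: scalar_prod_def lessThan_atLeast0)
  finally show ?thesis .
qed

lemma complex_mat_triangularization:
  fixes A :: "complex mat"
  assumes A: "A \<in> carrier_mat n n"
  obtains es where
    "\<And>k. (\<Sum>i<n. (A ^\<^sub>m k) $$ (i, i)) = (\<Sum>e\<leftarrow>es. e ^ k)"
    "\<And>e. e \<in> set es \<Longrightarrow> eigenvalue A e"
    "(\<forall>e\<in>set es. e = 0) \<Longrightarrow> A ^\<^sub>m n = 0\<^sub>m n n"
proof -
  obtain es where es: "char_poly A = (\<Prod>a\<leftarrow>es. [:- a, 1:])"
    using char_poly_factorized[OF A] by blast
  obtain U P Q where "schur_decomposition A es = (U, P, Q)" by (metis prod_cases3)
  from schur_decomposition[OF A es this]
  have sim: "similar_mat_wit A U P Q" and ut: "upper_triangular U" and diag: "diag_mat U = es" by auto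
  from similar_mat_witD2[OF A sim]
  have U: "U \<in> carrier_mat n n" and P: "P \<in> carrier_mat n n" and Q: "Q \<in> carrier_mat n n"
    and QP: "Q * P = 1\<^sub>m n" by auto
  have Apow: "A ^\<^sub>m k = P * U ^\<^sub>m k * Q" for k
    using similar_mat_wit_pow_id[OF sim] .
  have es_list: "es = map (\<lambda>i. U $$ (i, i)) [0..<n]" using diag U by (simp add: diag_mat_def)
  have 1: "(\<Sum>i<n. (A ^\<^sub>m k) $$ (i, i)) = (\<Sum>e\<leftarrow>es. e ^ k)" for k
  proof -
    have Uk: "U ^\<^sub>m k \<in> carrier_mat n n" using U by simp
    have "(\<Sum>i<n. (A ^\<^sub>m k) $$ (i, i)) = (\<Sum>i<n. (Q * (P * U ^\<^sub>m k)) $$ (i, i))"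
      unfolding Apow by (rule sum_diag_mult_commute) (use P Q Uk in auto)
    also have "Q * (P * U ^\<^sub>m k) = U ^\<^sub>m k"
      unfolding assoc_mult_mat[OF Q P Uk, symmetric] QP by (rule left_mult_one_mat[OF Uk])
    also have "(\<Sum>i<n. (U ^\<^sub>m k) $$ (i, i)) = (\<Sum>i<n. (U $$ (i, i)) ^ k)"
      using upper_triangular_pow_entries[OF U ut] by simp
    also have "\<dots> = (\<Sum>e\<leftarrow>es. e ^ k)"
      unfolding es_list by (simp add: interv_sum_list_conv_sum_set_nat lessThan_atLeast0 o_def)
    finally show ?thesis .
  qed
  have 2: "eigenvalue A e" if "e \<in> set es" for e
    unfolding eigenvalue_root_char_poly[OF A] es
    using that by (simp add: poly_prod_list prod_list_zero_iff image_iff)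
  have 3: "A ^\<^sub>m n = 0\<^sub>m n n" if "\<forall>e\<in>set es. e = 0"
  proof -
    have d0: "U $$ (i, i) = 0" if "i < n" for i using \<open>\<forall>e\<in>set es. e = 0\<close> that by (simp add: es_list)
    have low: "U $$ (i, j) = 0" if "i < n" "j \<le> i" for i j
      using d0 ut U that by (cases "j = i") (auto simp: upper_triangular_def)
    have "U ^\<^sub>m n = 0\<^sub>m n n"
      using strictly_upper_triangular_pow[OF U low, of n] U by (intro eq_matI) auto
    then show ?thesis using Apow[of n] P Q by simp
  qed
  show ?thesis using that[of es] 1 2 3 by blast
qed

text \<open>
  The eigenvalues of \<open>D\<close> on \<open>W\<close> with multiplicity, characterised by what the traces and the
  nilpotency criterion need; real subspaces carry complex eigenvectors as pairs \<open>(u, v)\<close>.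
\<close>

definition eigenvalue_list :: "'a::real_vector set \<Rightarrow> ('a \<Rightarrow> 'a) \<Rightarrow> complex list \<Rightarrow> bool" where
  "eigenvalue_list W D es \<longleftrightarrow>
    (\<forall>k. of_real (trace_on W (D ^^ k)) = (\<Sum>e\<leftarrow>es. e ^ k)) \<and>
    (\<forall>e\<in>set es. \<exists>u\<in>W. \<exists>v\<in>W. (u \<noteq> 0 \<or> v \<noteq> 0) \<and>
       D u = Re e *\<^sub>R u - Im e *\<^sub>R v \<and> D v = Im e *\<^sub>R u + Re e *\<^sub>R v) \<and>
    ((\<forall>e\<in>set es. e = 0) \<longrightarrow> (\<exists>n. \<forall>x\<in>W. (D ^^ n) x = 0))"

text \<open>
  The list \<open>es\<close> collects the diagonal entries of a complex triangular form of the matrix of \<open>D\<close>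
  on \<open>W\<close>. A complex eigenvector for \<open>e\<close> has real and imaginary parts \<open>u\<close> and \<open>v\<close> in \<open>W\<close>. If the
  diagonal vanishes, the triangular matrix is nilpotent.
\<close>

lemma trace_power_sums:
  fixes D :: "'a::real_vector \<Rightarrow> 'a"
  assumes fd: "finite_dimensional TYPE('a)" and l: "linear D" and W: "subspace W" and DW: "D ` W \<subseteq> W"
  shows "\<exists>es. eigenvalue_list W D es"
proof -
  obtain C where C: "finite C" "independent C" "span C = W"
    using finite_dimensional_subspace_basis[OF fd W] .
  obtain cs where cs: "set cs = C" "distinct cs" using finite_distinct_list[OF C(1)] by blast
  define n where "n = length cs"
  have bij: "bij_betw (nth cs) {..<n} C"
    using bij_betw_nth[OF cs(2)] cs(1) unfolding n_def by blast
  have csC: "cs ! i \<in> C" if "i < n" for i using that cs(1) by (auto simp: n_def)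
  have csW: "cs ! i \<in> W" if "i < n" for i using csC[OF that] C(3) span_base by blast
  let ?rep = "representation C"
  have expand: "x = (\<Sum>i<n. ?rep x (cs ! i) *\<^sub>R cs ! i)" if "x \<in> W" for x
  proof -
    have "x = (\<Sum>c\<in>C. ?rep x c *\<^sub>R c)"
      using real_vector.sum_representation_eq[OF C(2) _ C(1) order_refl] that C(3) by auto
    also have "\<dots> = (\<Sum>i<n. ?rep x (cs ! i) *\<^sub>R cs ! i)"
      using sum.reindex_bij_betw[OF bij, of "\<lambda>c. ?rep x c *\<^sub>R c"] by simp
    finally show ?thesis .
  qed
  have rep_lin: "?rep (\<Sum>i<n. a i *\<^sub>R f i) c = (\<Sum>i<n. a i * ?rep (f i) c)"
    if "\<And>i. i < n \<Longrightarrow> f i \<in> W" for a f c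
  proof -
    have "?rep (\<Sum>i<n. a i *\<^sub>R f i) c = (\<Sum>i<n. ?rep (a i *\<^sub>R f i) c)"
      using C that by (subst real_vector.representation_sum) (auto intro: span_scale)
    also have "\<dots> = (\<Sum>i<n. a i * ?rep (f i) c)"
      using C that by (intro sum.cong) (auto simp: real_vector.representation_scale)
    finally show ?thesis .
  qed
  have rep_cs: "?rep (cs ! i) (cs ! j) = (if i = j then 1 else 0)" if "i < n" "j < n" for i j
    using real_vector.representation_basis[OF C(2) csC[OF that(1)]] that cs(2)
    by (auto simp: n_def nth_eq_iff_index_eq)
  have rep_sum: "?rep (\<Sum>i<n. a i *\<^sub>R cs ! i) (cs ! j) = a j" if "j < n" for a j
  proof -
    have "?rep (\<Sum>i<n. a i *\<^sub>R cs ! i) (cs ! j) = (\<Sum>i<n. a i * ?rep (cs ! i) (cs ! j))"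
      by (rule rep_lin) (rule csW)
    also have "\<dots> = (\<Sum>i<n. if i = j then a i else 0)"
      using rep_cs that by (intro sum.cong) auto
    finally show ?thesis using that by simp
  qed
  have Dk: "linear (D ^^ k)" "(D ^^ k) ` W \<subseteq> W" for k
  proof -
    show "linear (D ^^ k)" by (induction k) (simp_all only: funpow.simps linear_id linear_compose[OF _ l])
    show "(D ^^ k) ` W \<subseteq> W" by (induction k) (use DW in auto)
  qed
  have app: "?rep ((D ^^ k) x) c = (\<Sum>i<n. ?rep x (cs ! i) * ?rep ((D ^^ k) (cs ! i)) c)"
    if x: "x \<in> W" for x k c
  proof -
    have "(D ^^ k) x = (D ^^ k) (\<Sum>i<n. ?rep x (cs ! i) *\<^sub>R cs ! i)" using expand[OF x] by simp
    also have "\<dots> = (\<Sum>i<n. ?rep x (cs ! i) *\<^sub>R (D ^^ k) (cs ! i))"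
      by (simp add: linear_sum[OF Dk(1)] linear_scale[OF Dk(1)])
    finally have *: "(D ^^ k) x = (\<Sum>i<n. ?rep x (cs ! i) *\<^sub>R (D ^^ k) (cs ! i))" .
    have "(D ^^ k) (cs ! i) \<in> W" if "i < n" for i using Dk(2) csW[OF that] by blast
    then show ?thesis unfolding * by (rule rep_lin)
  qed
  define A where "A = Matrix.mat n n (\<lambda>(i, j). complex_of_real (?rep (D (cs ! j)) (cs ! i)))"
  have A: "A \<in> carrier_mat n n" by (simp add: A_def)
  have Aent: "A $$ (i, j) = of_real (?rep (D (cs ! j)) (cs ! i))" if "i < n" "j < n" for i j
    using that by (simp add: A_def)
  have Apow: "(A ^\<^sub>m k) $$ (i, j) = of_real (?rep ((D ^^ k) (cs ! j)) (cs ! i))"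
    if "i < n" "j < n" for i j k
    using that
  proof (induction k arbitrary: i j)
    case 0
    then show ?case using A rep_cs by auto
  next
    case (Suc k)
    have Ak: "A ^\<^sub>m k \<in> carrier_mat n n" using A by simp
    have "(A ^\<^sub>m Suc k) $$ (i, j) = (\<Sum>l<n. (A ^\<^sub>m k) $$ (i, l) * A $$ (l, j))"
      using Suc.prems A Ak by (simp add: scalar_prod_def lessThan_atLeast0)
    also have "\<dots> = (\<Sum>l<n. of_real (?rep ((D ^^ k) (cs ! l)) (cs ! i)) * of_real (?rep (D (cs ! j)) (cs ! l)))"
      using Suc Aent by (intro sum.cong) auto
    also have "\<dots> = of_real (\<Sum>l<n. ?rep (D (cs ! j)) (cs ! l) * ?rep ((D ^^ k) (cs ! l)) (cs ! i))"
      by (simp add: mult.commute)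
    also have "\<dots> = of_real (?rep ((D ^^ k) (D (cs ! j))) (cs ! i))"
      using app[of "D (cs ! j)" k "cs ! i"] DW csW[OF Suc.prems(2)] by auto
    finally show ?case by (simp add: funpow_swap1)
  qed
  obtain es where es: "\<And>k. (\<Sum>i<n. (A ^\<^sub>m k) $$ (i, i)) = (\<Sum>e\<leftarrow>es. e ^ k)"
    "\<And>e. e \<in> set es \<Longrightarrow> eigenvalue A e"
    "(\<forall>e\<in>set es. e = 0) \<Longrightarrow> A ^\<^sub>m n = 0\<^sub>m n n"
    using complex_mat_triangularization[OF A] by blast
  have 1: "of_real (trace_on W (D ^^ k)) = (\<Sum>e\<leftarrow>es. e ^ k)" for k
  proof -
    have "trace_on W (D ^^ k) = (\<Sum>c\<in>C. ?rep ((D ^^ k) c) c)"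
      by (rule trace_on_eq[OF C Dk])
    also have "\<dots> = (\<Sum>i<n. ?rep ((D ^^ k) (cs ! i)) (cs ! i))"
      using sum.reindex_bij_betw[OF bij, of "\<lambda>c. ?rep ((D ^^ k) c) c"] by simp
    finally show ?thesis using es(1)[of k] Apow by simp
  qed
  have 2: "\<exists>u\<in>W. \<exists>v\<in>W. (u \<noteq> 0 \<or> v \<noteq> 0) \<and>
       D u = Re e *\<^sub>R u - Im e *\<^sub>R v \<and> D v = Im e *\<^sub>R u + Re e *\<^sub>R v" if e: "e \<in> set es" for e
  proof -
    obtain z where z: "z \<in> carrier_vec n" "z \<noteq> 0\<^sub>v n" "A *\<^sub>v z = e \<cdot>\<^sub>v z"
      using es(2)[OF e] A by (auto simp: eigenvalue_def eigenvector_def)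
    define zz where "zz = (\<lambda>i. vec_index z i)"
    define u where "u = (\<Sum>i<n. Re (zz i) *\<^sub>R cs ! i)"
    define v where "v = (\<Sum>i<n. Im (zz i) *\<^sub>R cs ! i)"
    have uW: "u \<in> W" "v \<in> W" unfolding u_def v_def
      using W csW by (auto intro!: subspace_sum subspace_scale)
    have Az: "(\<Sum>l<n. A $$ (i, l) * zz l) = e * zz i" if "i < n" for i
    proof -
      have "vec_index (A *\<^sub>v z) i = (\<Sum>l<n. A $$ (i, l) * zz l)"
        using that A z(1) by (simp add: scalar_prod_def zz_def lessThan_atLeast0)
      then show ?thesis using z that by (simp add: zz_def)
    qed
    have repD: "?rep (D u) (cs ! i) = Re (e * zz i)" "?rep (D v) (cs ! i) = Im (e * zz i)"
      if i: "i < n" for i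
    proof -
      have "?rep (D u) (cs ! i) = (\<Sum>l<n. Re (zz l) * ?rep (D (cs ! l)) (cs ! i))"
        using app[OF uW(1), of 1 "cs ! i"] rep_sum by (simp add: u_def)
      also have "\<dots> = Re (\<Sum>l<n. A $$ (i, l) * zz l)"
        using Aent i by (simp add: mult.commute)
      finally show "?rep (D u) (cs ! i) = Re (e * zz i)" using Az[OF i] by simp
      have "?rep (D v) (cs ! i) = (\<Sum>l<n. Im (zz l) * ?rep (D (cs ! l)) (cs ! i))"
        using app[OF uW(2), of 1 "cs ! i"] rep_sum by (simp add: v_def)
      also have "\<dots> = Im (\<Sum>l<n. A $$ (i, l) * zz l)"
        using Aent i by (simp add: mult.commute)
      finally show "?rep (D v) (cs ! i) = Im (e * zz i)" using Az[OF i] by simp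
    qed
    have DuW: "D u \<in> W" "D v \<in> W" using uW DW by auto
    have "D u = (\<Sum>i<n. Re (e * zz i) *\<^sub>R cs ! i)"
      using expand[OF DuW(1)] repD by simp
    then have Du: "D u = Re e *\<^sub>R u - Im e *\<^sub>R v"
      by (simp add: u_def v_def scaleR_sum_right sum_subtractf[symmetric] scaleR_diff_left)
    have "D v = (\<Sum>i<n. Im (e * zz i) *\<^sub>R cs ! i)"
      using expand[OF DuW(2)] repD by simp
    then have Dv: "D v = Im e *\<^sub>R u + Re e *\<^sub>R v"
      by (simp add: u_def v_def scaleR_sum_right sum.distrib[symmetric] scaleR_add_left add.commute)
    have "u \<noteq> 0 \<or> v \<noteq> 0"
    proof (rule ccontr)
      assume "\<not> (u \<noteq> 0 \<or> v \<noteq> 0)"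
      then have uv: "u = 0" "v = 0" by auto
      have "zz i = 0" if "i < n" for i
        using rep_sum[OF that, of "\<lambda>i. Re (zz i)"] rep_sum[OF that, of "\<lambda>i. Im (zz i)"] uv
        unfolding u_def v_def by (simp add: real_vector.representation_zero complex_eq_iff)
      then have "z = 0\<^sub>v n" using z(1) by (intro eq_vecI) (auto simp: zz_def)
      with z(2) show False by simp
    qed
    with Du Dv uW show ?thesis by blast
  qed
  have 3: "\<exists>n. \<forall>x\<in>W. (D ^^ n) x = 0" if "\<forall>e\<in>set es. e = 0"
  proof (intro exI ballI)
    fix x assume x: "x \<in> W"
    have An: "A ^\<^sub>m n = 0\<^sub>m n n" by (rule es(3)[OF that])
    have z: "?rep ((D ^^ n) (cs ! j)) (cs ! i) = 0" if "i < n" "j < n" for i j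
      using Apow[OF that, of n] that unfolding An by simp
    have "?rep ((D ^^ n) x) (cs ! i) = 0" if "i < n" for i
      using app[OF x, of n "cs ! i"] z that by simp
    then show "(D ^^ n) x = 0" using expand[of "(D ^^ n) x"] Dk(2) x by auto
  qed
  have a: "\<forall>k. of_real (trace_on W (D ^^ k)) = (\<Sum>e\<leftarrow>es. e ^ k)"
    by (rule allI) (rule 1)
  have b: "\<forall>e\<in>set es. \<exists>u\<in>W. \<exists>v\<in>W. (u \<noteq> 0 \<or> v \<noteq> 0) \<and>
       D u = Re e *\<^sub>R u - Im e *\<^sub>R v \<and> D v = Im e *\<^sub>R u + Re e *\<^sub>R v"
    by (rule ballI) (rule 2)
  have c: "(\<forall>e\<in>set es. e = 0) \<longrightarrow> (\<exists>n. \<forall>x\<in>W. (D ^^ n) x = 0)"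
    by (rule impI) (rule 3)
  show ?thesis unfolding eigenvalue_list_def by (rule exI[of _ es], intro conjI a b c)
qed

lemma Re_sum_list: "Re (\<Sum>e\<leftarrow>es. f e) = (\<Sum>e\<leftarrow>es. Re (f e))"
  by (induction es) simp_all

lemma sum_list_sum_swap: "(\<Sum>e\<leftarrow>es. \<Sum>i\<in>A. f e i) = (\<Sum>i\<in>A. \<Sum>e\<leftarrow>es. f e i :: 'b::comm_monoid_add)"
  by (induction es) (simp_all add: sum.distrib)

lemma trace_compose_rpop:
  fixes D :: "'a::real_vector \<Rightarrow> 'a"
  assumes fd: "finite_dimensional TYPE('a)" and l: "linear D" and W: "subspace W" and DW: "D ` W \<subseteq> W"
    and es: "\<And>k. of_real (trace_on W (D ^^ k)) = (\<Sum>e\<leftarrow>es. e ^ k :: complex)"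
  shows "of_real (trace_on W (D \<circ> rpop D p)) = (\<Sum>e\<leftarrow>es. e * poly (map_poly of_real p) e)"
proof -
  interpret r: operator_polynomial scaleR D by (rule real_operator_polynomial[OF l])
  have lk: "linear (D ^^ k)" for k
    by (induction k) (simp_all only: funpow.simps linear_id linear_compose[OF _ l])
  have Wk: "(D ^^ k) ` W \<subseteq> W" for k by (induction k) (use DW in auto)
  have "D \<circ> rpop D p = (\<lambda>x. \<Sum>i\<le>degree p. coeff p i *\<^sub>R (D ^^ Suc i) x)"
    by (simp add: fun_eq_iff r.pop_def linear_sum[OF l] linear_scale[OF l])
  then have "trace_on W (D \<circ> rpop D p)
      = trace_on W (\<lambda>x. \<Sum>i\<le>degree p. coeff p i *\<^sub>R (D ^^ Suc i) x)"
    by simp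
  also have "\<dots> = (\<Sum>i\<le>degree p. trace_on W (\<lambda>x. coeff p i *\<^sub>R (D ^^ Suc i) x))"
    using lk Wk W
    by (intro trace_on_sum[OF fd W] linear_compose_scale_right)
      (auto simp only: image_subset_iff intro: subspace_scale)
  also have "\<dots> = (\<Sum>i\<le>degree p. coeff p i * trace_on W (D ^^ Suc i))"
    using lk Wk by (intro sum.cong trace_on_scale[OF fd W] refl)
  finally have "of_real (trace_on W (D \<circ> rpop D p))
      = (\<Sum>i\<le>degree p. of_real (coeff p i) * (\<Sum>e\<leftarrow>es. e ^ Suc i))"
    by (simp only: of_real_sum of_real_mult es)
  also have "\<dots> = (\<Sum>e\<leftarrow>es. \<Sum>i\<le>degree p. of_real (coeff p i) * e ^ Suc i)"
    unfolding sum_list_sum_swap by (simp only: sum_list_const_mult)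
  also have "\<dots> = (\<Sum>e\<leftarrow>es. e * poly (map_poly of_real p) e)"
    by (simp add: poly_altdef coeff_map_poly degree_map_poly sum_distrib_left ac_simps)
  finally show ?thesis .
qed

section \<open>Lie algebras and their ideals\<close>

locale fd_lie_algebra =
  fixes br :: "'a::real_vector \<Rightarrow> 'a \<Rightarrow> 'a"
  assumes fd: "finite_dimensional TYPE('a)"
    and lie: "lie_algebra br"
begin

lemma bilinear_br: "bilinear br"
  using lie by (simp add: lie_algebra_def)

lemma br_self [simp]: "br x x = 0"
  using lie by (simp add: lie_algebra_def)

lemma linear_br: "linear (br x)"
  using bilinear_br by (simp add: bilinear_def)

lemmas br_simps = bilinear_ladd[OF bilinear_br] bilinear_radd[OF bilinear_br]
  bilinear_lmul[OF bilinear_br] bilinear_rmul[OF bilinear_br]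
  bilinear_lneg[OF bilinear_br] bilinear_rneg[OF bilinear_br]
  bilinear_lsub[OF bilinear_br] bilinear_rsub[OF bilinear_br]

lemma br_zero [simp]: "br 0 x = 0" "br x 0 = 0"
  using bilinear_lzero[OF bilinear_br] bilinear_rzero[OF bilinear_br] by auto

lemma br_antisym: "br x y = - br y x"
proof -
  have "br (x + y) (x + y) = br x y + br y x"
    by (simp only: br_simps) (simp add: add.commute)
  then show ?thesis by (simp only: br_self eq_neg_iff_add_eq_0)
qed

lemma jacobi: "br x (br y z) = br (br x y) z + br y (br x z)"
proof -
  have "br x (br y z) + br y (br z x) + br z (br x y) = 0"
    using lie unfolding lie_algebra_def by blast
  moreover have "br y (br z x) = - br y (br x z)"
    using br_antisym[of z x] by (simp add: br_simps)
  moreover have "br z (br x y) = - br (br x y) z" by (rule br_antisym)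
  ultimately show ?thesis by (simp add: algebra_simps)
qed

lemma derivation_br: "derivation br (br x)"
  unfolding derivation_def using jacobi linear_br by blast

lemma lie_idealD:
  assumes "lie_ideal br I h"
  shows "subspace I" "I \<subseteq> h" "\<And>x y. x \<in> h \<Longrightarrow> y \<in> I \<Longrightarrow> br x y \<in> I" "\<And>x y. x \<in> h \<Longrightarrow> y \<in> I \<Longrightarrow> br y x \<in> I"
proof -
  show "subspace I" "I \<subseteq> h" and *: "\<And>x y. x \<in> h \<Longrightarrow> y \<in> I \<Longrightarrow> br x y \<in> I"
    using assms by (auto simp: lie_ideal_def)
  show "br y x \<in> I" if "x \<in> h" "y \<in> I" for x y
    using *[OF that] br_antisym[of y x] subspace_neg[OF \<open>subspace I\<close>] by simp
qed

lemma lie_ideal_subalgebra: "lie_ideal br I h \<Longrightarrow> lie_subalgebra br I"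
  using lie_idealD unfolding lie_subalgebra_def by blast

lemma derived_subset: "lie_subalgebra br h \<Longrightarrow> derived br h \<subseteq> h"
  unfolding derived_def by (rule span_minimal) (auto simp: lie_subalgebra_def)

lemma derived_mem: "x \<in> h \<Longrightarrow> y \<in> h \<Longrightarrow> br x y \<in> derived br h"
  unfolding derived_def by (rule span_base) blast

lemma span_br_closed:
  assumes "\<And>y. y \<in> S \<Longrightarrow> br x y \<in> span S" "y \<in> span S"
  shows "br x y \<in> span S"
  using assms(2)
proof (induction y rule: span_induct_alt)
  case (step c u v)
  then show ?case using assms(1) by (simp add: br_simps span_add span_scale)
qed (simp add: span_zero)

lemma derived_ideal:
  assumes I: "lie_ideal br I h"
  shows "lie_ideal br (derived br I) h"
proof -
  have "br x y \<in> derived br I" if x: "x \<in> h" and y: "y \<in> derived br I" for x y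
    using y unfolding derived_def
  proof (rule span_br_closed[rotated])
    fix w assume "w \<in> {br x y |x y. x \<in> I \<and> y \<in> I}"
    then obtain u v where uv: "u \<in> I" "v \<in> I" "w = br u v" by blast
    have "br x w = br (br x u) v + br u (br x v)" unfolding uv(3) by (rule jacobi)
    also have "\<dots> \<in> derived br I"
      using derived_mem[of "br x u" I v] derived_mem[of u I "br x v"] uv lie_idealD(3)[OF I x]
      unfolding derived_def by (intro span_add) auto
    finally show "br x w \<in> span {br x y |x y. x \<in> I \<and> y \<in> I}" by (simp add: derived_def)
  qed
  moreover have "derived br I \<subseteq> h"
    using derived_subset[OF lie_ideal_subalgebra[OF I]] lie_idealD(2)[OF I] by blast
  ultimately show ?thesis by (simp add: lie_ideal_def derived_def)
qed

section \<open>Engel's theorem\<close>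

text \<open>
  A vector normalising a proper subalgebra of largest dimension spans a subalgebra together with
  it, which must be all of \<open>A\<close>.
\<close>

lemma maximal_subalgebra_codim_one:
  assumes A: "lie_subalgebra br A" "A \<noteq> {0}"
    and E: "\<And>B. lie_subalgebra br B \<Longrightarrow> B \<subset> A \<Longrightarrow> \<exists>x\<in>A - B. \<forall>b\<in>B. br b x \<in> B"
  obtains B x where "lie_subalgebra br B" "B \<subset> A" "x \<in> A - B" "\<And>b. b \<in> B \<Longrightarrow> br b x \<in> B"
    "\<And>y. y \<in> A \<Longrightarrow> \<exists>b\<in>B. \<exists>t. y = b + t *\<^sub>R x"
proof -
  let ?P = "\<lambda>B. lie_subalgebra br B \<and> B \<subset> A"
  have sA: "subspace A" using A by (simp add: lie_subalgebra_def)
  have "lie_subalgebra br {0}" by (simp add: lie_subalgebra_def)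
  then have ex: "?P {0}" using A sA subspace_0 by blast
  have bd: "dim B < Suc (dim A)" if "?P B" for B
    using dim_strict_mono[OF fd _ sA, of B] that by (simp add: lie_subalgebra_def)
  have all: "\<forall>B. ?P B \<longrightarrow> dim B < Suc (dim A)"
    by (intro allI impI) (rule bd)
  have "\<exists>B. ?P B \<and> (\<forall>B'. ?P B' \<longrightarrow> dim B' \<le> dim B)"
    by (rule Lattices_Big.ex_has_greatest_nat[of ?P, OF ex all])
  then obtain B where BB: "?P B \<and> (\<forall>B'. ?P B' \<longrightarrow> dim B' \<le> dim B)" ..
  have max: "dim B' \<le> dim B" if "?P B'" for B' using BB that by simp
  have subB: "lie_subalgebra br B" and BA: "B \<subset> A" using BB by simp_all
  from E[OF subB BA] obtain x where x1: "x \<in> A - B" and x2: "\<forall>b\<in>B. br b x \<in> B" ..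
  note x = x1 x2[rule_format]
  have sB: "subspace B" and cB: "\<And>b b'. b \<in> B \<Longrightarrow> b' \<in> B \<Longrightarrow> br b b' \<in> B"
    using subB by (simp_all add: lie_subalgebra_def)
  define C where "C = {b + t *\<^sub>R x |b t. b \<in> B}"
  have sC: "subspace C"
    unfolding C_def real_vector.subspace_def
  proof (safe)
    show "\<exists>b t. 0 = b + t *\<^sub>R x \<and> b \<in> B" using subspace_0[OF sB] by (intro exI[of _ 0]) simp
    fix b t b' t' assume b: "b \<in> B" "b' \<in> B"
    have "b + t *\<^sub>R x + (b' + t' *\<^sub>R x) = (b + b') + (t + t') *\<^sub>R x" by (simp add: algebra_simps)
    then show "\<exists>c s. b + t *\<^sub>R x + (b' + t' *\<^sub>R x) = c + s *\<^sub>R x \<and> c \<in> B"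
      using subspace_add[OF sB b] by blast
  next
    fix c b t assume b: "b \<in> B"
    have "c *\<^sub>R (b + t *\<^sub>R x) = c *\<^sub>R b + (c * t) *\<^sub>R x" by (simp add: algebra_simps)
    then show "\<exists>b' t'. c *\<^sub>R (b + t *\<^sub>R x) = b' + t' *\<^sub>R x \<and> b' \<in> B"
      using subspace_scale[OF sB b] by blast
  qed
  have BC: "B \<subseteq> C"
  proof
    fix b assume "b \<in> B"
    moreover have "b = b + 0 *\<^sub>R x" by simp
    ultimately show "b \<in> C" unfolding C_def by blast
  qed
  have "x = 0 + 1 *\<^sub>R x" by simp
  then have xC: "x \<in> C" unfolding C_def using subspace_0[OF sB] by blast
  have "br y z \<in> C" if y: "y \<in> C" and z: "z \<in> C" for y z
  proof -
    obtain b t b' t' where yz: "b \<in> B" "y = b + t *\<^sub>R x" "b' \<in> B" "z = b' + t' *\<^sub>R x"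
      using y z unfolding C_def by blast
    have "br y z = br b b' + t' *\<^sub>R br b x - t *\<^sub>R br b' x"
      unfolding yz by (simp add: br_simps br_antisym[of x b'])
    also have "\<dots> \<in> B" using yz x(2) cB sB
      by (intro subspace_diff subspace_add subspace_scale) auto
    finally show ?thesis using BC by blast
  qed
  then have "lie_subalgebra br C" using sC by (simp add: lie_subalgebra_def)
  moreover have "C \<subseteq> A" unfolding C_def using BA x(1) sA by (auto intro!: subspace_add subspace_scale)
  moreover have "dim B < dim C" using dim_strict_mono[OF fd sB sC] BC xC x(1) by blast
  ultimately have "C = A" using max[of C] by (metis leD psubsetI)
  then show ?thesis using that[OF subB BA x] unfolding C_def by blast
qed

text \<open>
  Engel's theorem in relative form: \<open>A\<close> acts nilpotently on \<open>V / U\<close> and so kills a nonzero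
  vector there. Having \<open>U\<close> as a parameter avoids quotient spaces and lets the same statement
  serve for the action of a subalgebra \<open>B\<close> on \<open>A / B\<close> within the induction. That instance gives
  an ideal \<open>B\<close> of codimension one in \<open>A\<close>; the vectors killed by \<open>B\<close> modulo \<open>U\<close> are stable under
  a complementary \<open>x\<close>, and the last nonzero iterate of \<open>x\<close> on such a vector is killed by all of
  \<open>A\<close>.
\<close>

lemma nilpotent_action_invariant_vector:
  assumes nil: "\<And>x. x \<in> P \<Longrightarrow> \<exists>n. \<forall>v\<in>P. (br x ^^ n) v = 0"
    and "lie_subalgebra br A" "A \<subseteq> P" "subspace U" "subspace V" "U \<subset> V" "V \<subseteq> P"
    and "\<And>x v. x \<in> A \<Longrightarrow> v \<in> V \<Longrightarrow> br x v \<in> V" "\<And>x v. x \<in> A \<Longrightarrow> v \<in> U \<Longrightarrow> br x v \<in> U"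
  shows "\<exists>v\<in>V - U. \<forall>x\<in>A. br x v \<in> U"
  using assms(2-)
proof (induction "dim A" arbitrary: A U V rule: less_induct)
  case less
  show ?case
  proof (cases "A = {0}")
    case True
    obtain v where "v \<in> V - U" using \<open>U \<subset> V\<close> by blast
    then show ?thesis using True subspace_0[OF \<open>subspace U\<close>] by (intro bexI[of _ v]) auto
  next
    case False
    have sA: "subspace A" and cA: "\<And>x y. x \<in> A \<Longrightarrow> y \<in> A \<Longrightarrow> br x y \<in> A"
      using \<open>lie_subalgebra br A\<close> by (auto simp: lie_subalgebra_def)
    have small: "dim B < dim A" if "lie_subalgebra br B" "B \<subset> A" for B
      using dim_strict_mono[OF fd _ sA] that by (auto simp: lie_subalgebra_def)
    have E: "\<exists>x\<in>A - B. \<forall>b\<in>B. br b x \<in> B" if B: "lie_subalgebra br B" "B \<subset> A" for B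
      by (rule less.hyps[OF small[OF B] B(1)])
        (use B less.prems sA cA in \<open>auto simp: lie_subalgebra_def\<close>)
    obtain B x where B: "lie_subalgebra br B" "B \<subset> A" and x: "x \<in> A - B"
      and Bx: "\<And>b. b \<in> B \<Longrightarrow> br b x \<in> B" and AB: "\<And>y. y \<in> A \<Longrightarrow> \<exists>b\<in>B. \<exists>t. y = b + t *\<^sub>R x"
      using maximal_subalgebra_codim_one[OF less.prems(1) False E] by metis
    have "\<exists>v\<in>V - U. \<forall>b\<in>B. br b v \<in> U"
      by (rule less.hyps[OF small[OF B] B(1)]) (use B less.prems in blast)+
    then obtain v where v: "v \<in> V" "v \<notin> U" "\<And>b. b \<in> B \<Longrightarrow> br b v \<in> U" by blast
    have xA: "x \<in> A" using x by blast
    have stab: "(br x ^^ k) v \<in> V \<and> (\<forall>b\<in>B. br b ((br x ^^ k) v) \<in> U)" for k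
    proof (induction k)
      case (Suc k)
      let ?w = "(br x ^^ k) v"
      have "br b (br x ?w) \<in> U" if b: "b \<in> B" for b
      proof -
        have "br b (br x ?w) = br (br b x) ?w + br x (br b ?w)" by (rule jacobi)
        also have "\<dots> \<in> U"
          using Suc Bx[OF b] b less.prems(8)[OF xA] by (intro subspace_add[OF less.prems(3)]) auto
        finally show ?thesis .
      qed
      then show ?case using Suc less.prems(7)[OF xA] by auto
    qed (use v in auto)
    obtain n where "(br x ^^ n) v = 0" using nil[of x] xA less.prems(2,6) v(1) by blast
    then have ex: "(br x ^^ n) v \<in> U" using subspace_0[OF less.prems(3)] by simp
    define k where "k = (LEAST k. (br x ^^ k) v \<in> U)"
    have k: "(br x ^^ k) v \<in> U" unfolding k_def by (rule LeastI[of "\<lambda>k. (br x ^^ k) v \<in> U", OF ex])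
    have "k \<noteq> 0" using k v(2) by (intro notI) simp
    then obtain j where j: "k = Suc j" using not0_implies_Suc by blast
    let ?w = "(br x ^^ j) v"
    have w: "?w \<notin> U" using not_less_Least[of j "\<lambda>k. (br x ^^ k) v \<in> U"] j by (simp add: k_def)
    have "br y ?w \<in> U" if y: "y \<in> A" for y
    proof -
      obtain b t where bt: "b \<in> B" "y = b + t *\<^sub>R x" using AB[OF y] by blast
      have "br y ?w = br b ?w + t *\<^sub>R br x ?w" unfolding bt by (simp add: br_simps)
      also have "\<dots> \<in> U" using stab[of j] bt k j
        by (intro subspace_add[OF less.prems(3)] subspace_scale[OF less.prems(3)]) auto
      finally show ?thesis .
    qed
    then show ?thesis using w stab[of j] by (intro bexI[of _ ?w]) auto
  qed
qed

text \<open>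
  By the relative form with \<open>V = P\<close>, a maximal proper subalgebra is an ideal of codimension one,
  so it contains all brackets.
\<close>

lemma nilpotent_imp_not_perfect:
  assumes P: "lie_subalgebra br P" "P \<noteq> {0}"
    and nil: "\<And>x. x \<in> P \<Longrightarrow> \<exists>n. \<forall>v\<in>P. (br x ^^ n) v = 0"
  shows "derived br P \<noteq> P"
proof -
  have sP: "subspace P" and cP: "\<And>x y. x \<in> P \<Longrightarrow> y \<in> P \<Longrightarrow> br x y \<in> P"
    using P by (auto simp: lie_subalgebra_def)
  have E: "\<exists>x\<in>P - B. \<forall>b\<in>B. br b x \<in> B" if B: "lie_subalgebra br B" "B \<subset> P" for B
    by (rule nilpotent_action_invariant_vector[OF nil B(1)])
      (use B sP cP in \<open>auto simp: lie_subalgebra_def\<close>)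
  obtain B x where B: "lie_subalgebra br B" "B \<subset> P" and x: "x \<in> P - B"
    and Bx: "\<And>b. b \<in> B \<Longrightarrow> br b x \<in> B" and PB: "\<And>y. y \<in> P \<Longrightarrow> \<exists>b\<in>B. \<exists>t. y = b + t *\<^sub>R x"
    using maximal_subalgebra_codim_one[OF P E] by metis
  have sB: "subspace B" and cB: "\<And>b b'. b \<in> B \<Longrightarrow> b' \<in> B \<Longrightarrow> br b b' \<in> B"
    using B by (simp_all add: lie_subalgebra_def)
  have "br y z \<in> B" if y: "y \<in> P" and z: "z \<in> P" for y z
  proof -
    obtain b t b' t' where yz: "b \<in> B" "y = b + t *\<^sub>R x" "b' \<in> B" "z = b' + t' *\<^sub>R x"
      using PB[OF y] PB[OF z] by blast
    have "br y z = br b b' + t' *\<^sub>R br b x - t *\<^sub>R br b' x"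
      unfolding yz by (simp add: br_simps br_antisym[of x b'])
    also have "\<dots> \<in> B" using yz Bx cB sB
      by (intro subspace_diff subspace_add subspace_scale) auto
    finally show ?thesis .
  qed
  then have "derived br P \<subseteq> B" unfolding derived_def using sB by (intro span_minimal) auto
  with B(2) show ?thesis by blast
qed

end

section \<open>The Killing form and Cartan's criterion\<close>

context fd_lie_algebra
begin

lemma br_image: "lie_subalgebra br h \<Longrightarrow> x \<in> h \<Longrightarrow> br x ` h \<subseteq> h"
  by (auto simp: lie_subalgebra_def)

lemma subalgebra_subspace: "lie_subalgebra br h \<Longrightarrow> subspace h"
  by (simp add: lie_subalgebra_def)

lemma subalgebra_br: "lie_subalgebra br h \<Longrightarrow> x \<in> h \<Longrightarrow> y \<in> h \<Longrightarrow> br x y \<in> h"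
  by (simp add: lie_subalgebra_def)

lemma linear_br_comp: "linear (br x \<circ> br y)"
  by (intro linear_compose linear_br)

lemma br_comp_image:
  "lie_subalgebra br h \<Longrightarrow> x \<in> h \<Longrightarrow> y \<in> h \<Longrightarrow> (br x \<circ> br y) ` h \<subseteq> h"
  using subalgebra_br by auto

context
  fixes h assumes h: "lie_subalgebra br h"
begin

lemma killing_sym: "x \<in> h \<Longrightarrow> y \<in> h \<Longrightarrow> killing_form br h x y = killing_form br h y x"
  unfolding killing_form_def
  by (intro trace_on_commute[OF fd subalgebra_subspace[OF h]] linear_br br_image[OF h])

lemma killing_add:
  assumes "x \<in> h" "x' \<in> h" "y \<in> h"
  shows "killing_form br h (x + x') y = killing_form br h x y + killing_form br h x' y"
proof -
  have "br (x + x') \<circ> br y = (\<lambda>v. (br x \<circ> br y) v + (br x' \<circ> br y) v)"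
    by (simp add: fun_eq_iff br_simps)
  then show ?thesis unfolding killing_form_def
    using trace_on_add[OF fd subalgebra_subspace[OF h] linear_br_comp br_comp_image[OF h]
        linear_br_comp br_comp_image[OF h]] assms by simp
qed

lemma killing_scale:
  assumes "x \<in> h" "y \<in> h"
  shows "killing_form br h (c *\<^sub>R x) y = c * killing_form br h x y"
proof -
  have "br (c *\<^sub>R x) \<circ> br y = (\<lambda>v. c *\<^sub>R (br x \<circ> br y) v)"
    by (simp add: fun_eq_iff br_simps)
  then show ?thesis unfolding killing_form_def
    using trace_on_scale[OF fd subalgebra_subspace[OF h] linear_br_comp br_comp_image[OF h]]
      assms by simp
qed

lemma killing_invariant:
  assumes x: "x \<in> h" and y: "y \<in> h" and z: "z \<in> h"
  shows "killing_form br h (br x y) z = - killing_form br h y (br x z)"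
proof -
  note sub = subalgebra_subspace[OF h]
  have im: "(br a \<circ> br b \<circ> br c) ` h \<subseteq> h" if "a \<in> h" "b \<in> h" "c \<in> h" for a b c
    using that subalgebra_br[OF h] by auto
  have im2: "(br a \<circ> br b) ` h \<subseteq> h" if "a \<in> h" "b \<in> h" for a b
    using that subalgebra_br[OF h] by auto
  have lin: "linear (br a \<circ> br b \<circ> br c)" for a b c by (intro linear_compose linear_br)
  have "br (br x y) \<circ> br z = (\<lambda>v. (br x \<circ> br y \<circ> br z) v - (br y \<circ> br x \<circ> br z) v)"
    by (simp add: fun_eq_iff jacobi[of x y])
  then have 1: "killing_form br h (br x y) z
      = trace_on h (br x \<circ> br y \<circ> br z) - trace_on h (br y \<circ> br x \<circ> br z)"
    unfolding killing_form_def using trace_on_diff[OF fd sub lin im lin im] x y z by simp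
  have "br y \<circ> br (br x z) = (\<lambda>v. (br y \<circ> br x \<circ> br z) v - (br y \<circ> br z \<circ> br x) v)"
    by (simp add: fun_eq_iff jacobi[of x z] linear_add[OF linear_br])
  then have 2: "killing_form br h y (br x z)
      = trace_on h (br y \<circ> br x \<circ> br z) - trace_on h (br y \<circ> br z \<circ> br x)"
    unfolding killing_form_def using trace_on_diff[OF fd sub lin im lin im] x y z by simp
  have "trace_on h (br x \<circ> (br y \<circ> br z)) = trace_on h ((br y \<circ> br z) \<circ> br x)"
    by (intro trace_on_commute[OF fd sub] linear_br linear_br_comp br_image[OF h] im2 x y z)
  then show ?thesis using 1 2 by (simp add: comp_assoc)
qed

lemma killing_ideal:
  assumes I: "lie_ideal br I h" and "x \<in> I" "y \<in> I"
  shows "killing_form br h x y = killing_form br I x y"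
proof -
  have "(br x \<circ> br y) ` h \<subseteq> I" using lie_idealD[OF I] assms by auto
  then show ?thesis unfolding killing_form_def
    using lie_idealD[OF I] by (intro trace_on_range_subset[OF fd subalgebra_subspace[OF h]] linear_br_comp)
qed

text \<open>
  The Killing form of \<open>h\<close> is meaningful on \<open>h\<close> only, while the results on pairings are about
  forms on the whole space.
\<close>

lemma killing_bilinear_extension:
  "\<exists>K. bilinear K \<and> (\<forall>x\<in>h. \<forall>y\<in>h. K x y = killing_form br h x y)"
proof -
  obtain \<pi> where "linear \<pi> \<and> (\<forall>x\<in>h. \<pi> x = x) \<and> range \<pi> \<subseteq> h"
    using subspace_projection[OF subalgebra_subspace[OF h]] ..
  then have pi: "linear \<pi>" "\<And>x. x \<in> h \<Longrightarrow> \<pi> x = x" "\<And>x. \<pi> x \<in> h" by auto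
  let ?K = "\<lambda>x y. killing_form br h (\<pi> x) (\<pi> y)"
  have "linear (\<lambda>x. ?K x y)" for y
    using pi(3) by (simp add: linear_iff linear_add[OF pi(1)] linear_scale[OF pi(1)] killing_add killing_scale)
  moreover have "?K x y = ?K y x" for x y using pi(3) by (intro killing_sym)
  ultimately have "bilinear ?K" unfolding bilinear_def by simp
  then show ?thesis using pi(2) by (intro exI[of _ ?K]) simp
qed

end

text \<open>
  Let \<open>M\<close> be the real part of \<open>ad x\<close>. For a bracket \<open>x = [y, z]\<close>, cyclicity of the trace and the
  derivation property give \<open>tr (ad x \<circ> M) = - tr (ad y \<circ> ad (M z))\<close>, a value of the Killing
  form; so this trace vanishes on \<open>P = [P, P]\<close>. It equals \<open>\<Sum> (Re \<lambda>)\<^sup>2\<close> (after taking real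
  parts), and then \<open>tr ((ad x)\<^sup>2) = 0\<close> forces \<open>Im \<lambda> = 0\<close> too. Hence all \<open>ad x\<close> are nilpotent on
  \<open>P\<close>, which is impossible for a perfect algebra.
\<close>

lemma cartan_perfect:
  assumes P: "lie_subalgebra br P" and perf: "derived br P = P"
    and K0: "\<And>x y. x \<in> P \<Longrightarrow> y \<in> P \<Longrightarrow> killing_form br P x y = 0"
  shows "P = {0}"
proof (rule ccontr)
  assume "P \<noteq> {0}"
  note sP = subalgebra_subspace[OF P]
  have "\<exists>n. \<forall>v\<in>P. (br x ^^ n) v = 0" if x: "x \<in> P" for x
  proof -
    obtain es where "eigenvalue_list P (br x) es"
      using trace_power_sums[OF fd linear_br sP br_image[OF P x]] ..
    then have es: "\<And>k. of_real (trace_on P (br x ^^ k)) = (\<Sum>e\<leftarrow>es. e ^ k)"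
      "\<And>e. e \<in> set es \<Longrightarrow> \<exists>u\<in>P. \<exists>v\<in>P. (u \<noteq> 0 \<or> v \<noteq> 0) \<and>
         br x u = Re e *\<^sub>R u - Im e *\<^sub>R v \<and> br x v = Im e *\<^sub>R u + Re e *\<^sub>R v"
      "(\<forall>e\<in>set es. e = 0) \<Longrightarrow> \<exists>n. \<forall>v\<in>P. (br x ^^ n) v = 0"
      by (simp_all add: eigenvalue_list_def)
    obtain p where "real_part_polynomial (br x) p"
      using real_part_operator[OF fd linear_br[of x]] ..
    note pp = this[unfolded real_part_polynomial_def]
    have p: "derivation br (rpop (br x) p)"
      using pp bilinear_br derivation_br[of x] by blast
    interpret r: operator_polynomial scaleR "br x" by (rule real_operator_polynomial[OF linear_br])
    define M where "M = rpop (br x) p"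
    have MP: "M y \<in> P" if "y \<in> P" for y
      unfolding M_def by (rule r.pop_mem) (use sP br_image[OF P x] that in \<open>auto simp: subspace_raw_def[symmetric]\<close>)
    have lM: "linear M" and dM: "M (br y z) = br (M y) z + br y (M z)" for y z
      using p by (simp_all add: derivation_def M_def)
    have im: "(br y \<circ> M) ` P \<subseteq> P" if "y \<in> P" for y
      using that MP subalgebra_br[OF P] by auto
    have lin: "linear (br y \<circ> M)" for y by (intro linear_compose lM linear_br)
    have gen: "trace_on P (br (br y z) \<circ> M) = 0" if yz: "y \<in> P" "z \<in> P" for y z
    proof -
      have im3: "(br y \<circ> (br z \<circ> M)) ` P \<subseteq> P" "(br y \<circ> (M \<circ> br z)) ` P \<subseteq> P"
        "(br z \<circ> (br y \<circ> M)) ` P \<subseteq> P" "(br y \<circ> M) ` P \<subseteq> P"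
        using yz MP subalgebra_br[OF P] by auto
      have lin3: "linear (br y \<circ> (br z \<circ> M))" "linear (br y \<circ> (M \<circ> br z))"
        "linear (br z \<circ> (br y \<circ> M))" "linear (br y \<circ> M)"
        by (intro linear_compose lM linear_br)+
      have "br (br y z) \<circ> M = (\<lambda>v. (br y \<circ> (br z \<circ> M)) v - (br z \<circ> (br y \<circ> M)) v)"
        by (simp add: fun_eq_iff jacobi[of y z])
      then have "trace_on P (br (br y z) \<circ> M)
          = trace_on P (br y \<circ> (br z \<circ> M)) - trace_on P (br z \<circ> (br y \<circ> M))"
        using trace_on_diff[OF fd sP lin3(1) im3(1) lin3(3) im3(3)] by simp
      also have "trace_on P (br z \<circ> (br y \<circ> M)) = trace_on P ((br y \<circ> M) \<circ> br z)"
        by (intro trace_on_commute[OF fd sP] linear_br lin3 im3 br_image[OF P] yz)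
      also have "\<dots> = trace_on P (br y \<circ> (M \<circ> br z))" by (simp add: comp_assoc)
      also have "trace_on P (br y \<circ> (br z \<circ> M)) - trace_on P (br y \<circ> (M \<circ> br z))
          = trace_on P (\<lambda>v. (br y \<circ> (br z \<circ> M)) v - (br y \<circ> (M \<circ> br z)) v)"
        using trace_on_diff[OF fd sP lin3(1) im3(1) lin3(2) im3(2)] by simp
      also have "(\<lambda>v. (br y \<circ> (br z \<circ> M)) v - (br y \<circ> (M \<circ> br z)) v) = br y \<circ> br (- M z)"
        by (simp add: fun_eq_iff dM br_simps)
      also have "trace_on P \<dots> = 0"
        using K0[of y "- M z"] yz MP subspace_neg[OF sP] by (simp add: killing_form_def)
      finally show ?thesis .
    qed
    have "trace_on P (br y \<circ> M) = 0 \<and> y \<in> P" if "y \<in> span {br y z |y z. y \<in> P \<and> z \<in> P}" for y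
      using that
    proof (induction y rule: span_induct_alt)
      case base
      have "br 0 \<circ> M = (\<lambda>v. 0 *\<^sub>R (br 0 \<circ> M) v)" by (simp add: fun_eq_iff)
      then have "trace_on P (br 0 \<circ> M) = trace_on P (\<lambda>v. 0 *\<^sub>R (br 0 \<circ> M) v)" by simp
      also have "\<dots> = 0 * trace_on P (br 0 \<circ> M)"
        by (rule trace_on_scale[OF fd sP lin im]) (rule subspace_0[OF sP])
      finally have "trace_on P (br 0 \<circ> M) = 0" by (simp only: mult_zero_left)
      then show ?case using subspace_0[OF sP] by (rule conjI)
    next
      case (step c u w)
      then have u: "u \<in> P" "trace_on P (br u \<circ> M) = 0" using gen subalgebra_br[OF P] by auto
      have lc: "linear (\<lambda>v. c *\<^sub>R (br u \<circ> M) v)" by (rule linear_compose_scale_right[OF lin])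
      have lci: "(\<lambda>v. c *\<^sub>R (br u \<circ> M) v) ` P \<subseteq> P"
        using im[OF u(1)] subspace_scale[OF sP] by (auto simp: image_subset_iff)
      have "br (c *\<^sub>R u + w) \<circ> M = (\<lambda>v. c *\<^sub>R (br u \<circ> M) v + (br w \<circ> M) v)"
        by (simp add: fun_eq_iff br_simps)
      then have "trace_on P (br (c *\<^sub>R u + w) \<circ> M) = 0"
        using trace_on_add[OF fd sP lc lci lin im[of w]] trace_on_scale[OF fd sP lin im[OF u(1)]] step u by simp
      moreover have "c *\<^sub>R u + w \<in> P" using step u sP by (simp add: subspace_add subspace_scale)
      ultimately show ?case by (rule conjI)
    qed
    note tr_span = this
    have "x \<in> span {br y z |y z. y \<in> P \<and> z \<in> P}"
      using x unfolding derived_def[symmetric] perf .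
    from conjunct1[OF tr_span[OF this]] have tr0: "trace_on P (br x \<circ> M) = 0" .
    have ev: "poly (map_poly of_real p) e = of_real (Re e)" if e: "e \<in> set es" for e
      proof -
      obtain u v where uv: "u \<noteq> 0 \<or> v \<noteq> 0" "br x u = Re e *\<^sub>R u - Im e *\<^sub>R v"
        "br x v = Im e *\<^sub>R u + Re e *\<^sub>R v" using es(2)[OF e] by blast
      have "poly (map_poly of_real p) (Complex (Re e) (Im e)) = of_real (Re e)"
        using conjunct1[OF conjunct2[OF pp]] uv by blast
      then show ?thesis by simp
    qed
    have "(\<Sum>e\<leftarrow>es. e * of_real (Re e)) = (\<Sum>e\<leftarrow>es. e * poly (map_poly of_real p) e)"
      using ev by (intro arg_cong[of _ _ sum_list] map_cong) auto
    also have "\<dots> = 0"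
      using trace_compose_rpop[OF fd linear_br sP br_image[OF P x] es(1), of p] tr0 by (simp add: M_def)
    finally have "Re (\<Sum>e\<leftarrow>es. e * of_real (Re e)) = 0" by simp
    then have "(\<Sum>e\<leftarrow>es. (Re e)\<^sup>2) = 0" by (simp add: Re_sum_list o_def power2_eq_square)
    then have re: "Re e = 0" if "e \<in> set es" for e
      using that by (subst (asm) sum_list_nonneg_eq_0_iff) auto
    have "of_real (trace_on P (br x ^^ 2)) = (0::complex)"
      using K0[OF x x] by (simp add: killing_form_def numeral_2_eq_2)
    then have "Re (\<Sum>e\<leftarrow>es. e ^ 2) = 0" using es(1)[of 2] by simp
    then have "(\<Sum>e\<leftarrow>es. (Re e)\<^sup>2 - (Im e)\<^sup>2) = 0" by (simp add: Re_sum_list Re_power2)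
    moreover have "(\<Sum>e\<leftarrow>es. (Re e)\<^sup>2 - (Im e)\<^sup>2) = (\<Sum>e\<leftarrow>es. - ((Im e)\<^sup>2))"
      using re by (intro arg_cong[of _ _ sum_list] map_cong) auto
    ultimately have "(\<Sum>e\<leftarrow>es. (Im e)\<^sup>2) = 0" by (simp add: uminus_sum_list_map[unfolded o_def, symmetric])
    then have im: "Im e = 0" if "e \<in> set es" for e
      using that by (subst (asm) sum_list_nonneg_eq_0_iff) auto
    show ?thesis using es(3) re im by (simp add: complex_eq_iff)
  qed
  from nilpotent_imp_not_perfect[OF P \<open>P \<noteq> {0}\<close> this] perf show False by blast
qed

section \<open>Semisimple Lie algebras\<close>

lemma derived_series_stabilizes:
  assumes I: "lie_ideal br I h"
  obtains n where "lie_ideal br ((derived br ^^ n) I) h" "(derived br ^^ n) I \<subseteq> I"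
    "derived br ((derived br ^^ n) I) = (derived br ^^ n) I"
proof -
  let ?D = "\<lambda>n. (derived br ^^ n) I"
  have D: "lie_ideal br (?D n) h" for n
    by (induction n) (use I derived_ideal in auto)
  have step: "?D (Suc n) \<subseteq> ?D n" for n
    using derived_subset[OF lie_ideal_subalgebra[OF D[of n]]] by simp
  have sub: "?D n \<subseteq> I" for n
    by (induction n) (use step in auto)
  have "\<exists>n. ?D (Suc n) = ?D n"
  proof (rule ccontr)
    assume no: "\<nexists>n. ?D (Suc n) = ?D n"
    have less: "dim (?D (Suc n)) < dim (?D n)" for n
      using no step[of n] by (intro dim_strict_mono[OF fd] lie_idealD(1)[OF D]) blast
    have "dim (?D n) + n \<le> dim I" for n
    proof (induction n)
      case (Suc n)
      then show ?case using less[of n] by simp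
    qed simp
    from this[of "Suc (dim I)"] show False by simp
  qed
  then obtain n where "?D (Suc n) = ?D n" by blast
  then show ?thesis using that[of n] D sub by simp
qed

lemma disjoint_ideals_commute:
  assumes "lie_ideal br I h" "lie_ideal br J h" "I \<inter> J = {0}" "x \<in> I" "y \<in> J"
  shows "br x y = 0"
proof -
  have "br x y \<in> I" using lie_idealD(4)[OF assms(1)] lie_idealD(2)[OF assms(2)] assms(4,5) by (meson subsetD)
  moreover have "br x y \<in> J" using lie_idealD(3)[OF assms(2)] lie_idealD(2)[OF assms(1)] assms(4,5) by (meson subsetD)
  ultimately show ?thesis using assms(3) by auto
qed

lemma abelian_solvable:
  assumes "lie_subalgebra br I" "\<And>x y. x \<in> I \<Longrightarrow> y \<in> I \<Longrightarrow> br x y = 0"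
  shows "solvable_on br I"
proof -
  have "{br x y |x y. x \<in> I \<and> y \<in> I} \<subseteq> {0}" using assms(2) by blast
  then have "derived br I = {0}"
    unfolding derived_def by (rule span_subset_zero)
  then show ?thesis unfolding solvable_on_def by (intro exI[of _ 1]) simp
qed

lemma semisimple_solvable_ideal:
  assumes "lie_semisimple br s" "lie_ideal br I s" "solvable_on br I"
  shows "I = {0}"
proof -
  have "I \<subseteq> lie_radical br s" unfolding lie_radical_def
    using assms(2,3) by (auto intro: span_base)
  then show ?thesis using assms(1) lie_idealD(1)[OF assms(2)] subspace_0
    unfolding lie_semisimple_def by blast
qed

definition killing_perp :: "'a set \<Rightarrow> 'a set \<Rightarrow> 'a set" where
  "killing_perp h I = {x \<in> h. \<forall>y\<in>I. killing_form br h x y = 0}"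

context
  fixes s assumes ss: "lie_semisimple br s"
begin

lemma semisimple_subalgebra: "lie_subalgebra br s"
  using ss by (simp add: lie_semisimple_def)

text \<open>
  The derived series of \<open>I\<close> ends in a perfect ideal, which is zero by Cartan's criterion; so \<open>I\<close>
  is solvable.
\<close>

lemma killing_zero_ideal:
  assumes I: "lie_ideal br I s"
    and K0: "\<And>x y. x \<in> I \<Longrightarrow> y \<in> I \<Longrightarrow> killing_form br s x y = 0"
  shows "I = {0}"
proof -
  obtain n where n: "lie_ideal br ((derived br ^^ n) I) s" "(derived br ^^ n) I \<subseteq> I"
    "derived br ((derived br ^^ n) I) = (derived br ^^ n) I"
    using derived_series_stabilizes[OF I] .
  have "(derived br ^^ n) I = {0}"
    using K0 n(2) killing_ideal[OF semisimple_subalgebra n(1)]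
    by (intro cartan_perfect lie_ideal_subalgebra[OF n(1)] n(3)) (metis subsetD)
  then have "solvable_on br I" unfolding solvable_on_def by blast
  then show ?thesis by (rule semisimple_solvable_ideal[OF ss I])
qed

lemma killing_perp_ideal:
  assumes I: "lie_ideal br I s"
  shows "lie_ideal br (killing_perp s I) s"
proof -
  note sub = semisimple_subalgebra
  have "subspace (killing_perp s I)"
    unfolding real_vector.subspace_def killing_perp_def
    using subalgebra_subspace[OF sub] lie_idealD(2)[OF I] killing_scale[OF sub, of 0 _ 0]
    by (auto simp: killing_add[OF sub] killing_scale[OF sub] subspace_add subspace_scale subspace_0 subsetD)
  moreover have "br x y \<in> killing_perp s I" if x: "x \<in> s" and y: "y \<in> killing_perp s I" for x y
    using y lie_idealD(2,3)[OF I] x subalgebra_br[OF sub]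
    by (auto simp: killing_perp_def killing_invariant[OF sub] subsetD)
  ultimately show ?thesis by (auto simp: lie_ideal_def killing_perp_def)
qed

text \<open>
  The intersection is an ideal with vanishing Killing form. So the Killing form is nondegenerate
  on \<open>I\<close>, and the functional \<open>K x\<close> on \<open>I\<close> is represented by some element of \<open>I\<close>, the component
  of \<open>x\<close> in \<open>I\<close>.
\<close>

lemma semisimple_ideal_complement:
  assumes I: "lie_ideal br I s"
  shows "I \<inter> killing_perp s I = {0}" "\<And>x. x \<in> s \<Longrightarrow> \<exists>y\<in>I. \<exists>z\<in>killing_perp s I. x = y + z"
proof -
  note sub = semisimple_subalgebra
  note J = killing_perp_ideal[OF I]
  have IJ: "lie_ideal br (I \<inter> killing_perp s I) s"
    using lie_idealD[OF I] lie_idealD[OF J] by (auto simp: lie_ideal_def subspace_inter)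
  show int: "I \<inter> killing_perp s I = {0}"
    by (rule killing_zero_ideal[OF IJ]) (auto simp: killing_perp_def)
  fix x assume x: "x \<in> s"
  obtain K where "bilinear K \<and> (\<forall>x\<in>s. \<forall>y\<in>s. K x y = killing_form br s x y)"
    using killing_bilinear_extension[OF sub] ..
  then have K: "bilinear K" "\<And>x y. x \<in> s \<Longrightarrow> y \<in> s \<Longrightarrow> K x y = killing_form br s x y"
    by auto
  note sI = lie_idealD(1,2)[OF I]
  have nd: "u = 0" if u: "u \<in> I" "\<And>v. v \<in> I \<Longrightarrow> K v u = 0" for u
  proof -
    have "u \<in> killing_perp s I"
      using u sI(2) K(2) killing_sym[OF sub] by (auto simp: killing_perp_def subsetD)
    then show ?thesis using int u by blast
  qed
  have "\<exists>v\<in>I. \<forall>u\<in>I. K v u = K x u"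
    using nondegenerate_pairing_represents[OF fd K(1) sI(1) sI(1) nd, of "K x"]
    by (simp add: bilinear_radd[OF K(1)] bilinear_rmul[OF K(1)])
  then obtain v where v: "v \<in> I" "\<And>u. u \<in> I \<Longrightarrow> K v u = K x u" by blast
  have xv: "x - v \<in> s" using x v sI subalgebra_subspace[OF sub] by (auto intro: subspace_diff)
  have "K (x - v) u = 0" if "u \<in> I" for u using v(2)[OF that] by (simp add: bilinear_lsub[OF K(1)])
  then have "x - v \<in> killing_perp s I" using xv K(2) sI(2) by (auto simp: killing_perp_def subsetD)
  then show "\<exists>y\<in>I. \<exists>z\<in>killing_perp s I. x = y + z" using v(1) by (intro bexI[of _ v] bexI[of _ "x - v"]) auto
qed

lemma ideal_of_ideal:
  assumes I: "lie_ideal br I s" and J: "lie_ideal br J I"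
  shows "lie_ideal br J s"
proof -
  have "br x y \<in> J" if x: "x \<in> s" and y: "y \<in> J" for x y
  proof -
    obtain u v where uv: "u \<in> I" "v \<in> killing_perp s I" "x = u + v"
      using semisimple_ideal_complement(2)[OF I x] by blast
    have "br y v = 0"
      using disjoint_ideals_commute[OF I killing_perp_ideal[OF I] semisimple_ideal_complement(1)[OF I] _ uv(2)]
        y lie_idealD(2)[OF J] by blast
    then have "br v y = 0" using br_antisym[of v y] by simp
    then show ?thesis using uv lie_idealD(3)[OF J] y by (simp add: br_simps)
  qed
  then show ?thesis using lie_idealD(1,2)[OF J] lie_idealD(2)[OF I] by (auto simp: lie_ideal_def)
qed

lemma semisimple_ideal:
  assumes I: "lie_ideal br I s"
  shows "lie_semisimple br I"
proof -
  have "\<Union> {J. lie_ideal br J I \<and> solvable_on br J} \<subseteq> {0}"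
    using ideal_of_ideal[OF I] semisimple_solvable_ideal[OF ss] by blast
  then have "lie_radical br I = {0}"
    unfolding lie_radical_def by (rule span_subset_zero)
  then show ?thesis using lie_ideal_subalgebra[OF I] by (simp add: lie_semisimple_def)
qed

lemma semisimple_abelian_ideal:
  assumes I: "lie_ideal br I s" and "\<And>x y. x \<in> I \<Longrightarrow> y \<in> I \<Longrightarrow> br x y = 0"
  shows "I = {0}"
  using assms abelian_solvable lie_ideal_subalgebra semisimple_solvable_ideal[OF ss] by blast

lemma semisimple_center:
  assumes "x \<in> s" "\<And>y. y \<in> s \<Longrightarrow> br x y = 0"
  shows "x = 0"
proof -
  let ?Z = "{x \<in> s. \<forall>y\<in>s. br x y = 0}"
  note sub = semisimple_subalgebra
  have "br u (br v w) = 0 \<and> br (br v w) u = 0" if "w \<in> ?Z" "v \<in> s" "u \<in> s" for u v w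
    using that br_antisym[of v w] by auto
  then have "lie_ideal br ?Z s"
    using subalgebra_subspace[OF sub] subalgebra_br[OF sub]
    by (auto simp: lie_ideal_def real_vector.subspace_def br_simps)
  then have "?Z = {0}" by (rule semisimple_abelian_ideal) blast
  then show ?thesis using assms by blast
qed

text \<open>
  The complement of \<open>[I, I]\<close> within \<open>I\<close> is an abelian ideal.
\<close>

lemma semisimple_ideal_perfect:
  assumes I: "lie_ideal br I s"
  shows "derived br I = I"
proof -
  note D = derived_ideal[OF I]
  let ?J = "I \<inter> killing_perp s (derived br I)"
  note P = killing_perp_ideal[OF D]
  have J: "lie_ideal br ?J s"
    using lie_idealD[OF I] lie_idealD[OF P] by (auto simp: lie_ideal_def subspace_inter)
  have dI: "derived br I \<subseteq> I" by (rule derived_subset[OF lie_ideal_subalgebra[OF I]])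
  have "?J = {0}"
  proof (rule semisimple_abelian_ideal[OF J])
    fix x y assume xy: "x \<in> ?J" "y \<in> ?J"
    have "br x y \<in> derived br I" using xy by (intro derived_mem) auto
    moreover have "br x y \<in> killing_perp s (derived br I)"
      using xy lie_idealD(2,3)[OF P] by blast
    ultimately show "br x y = 0" using semisimple_ideal_complement(1)[OF D] by blast
  qed
  have "x \<in> derived br I" if x: "x \<in> I" for x
  proof -
    obtain y z where yz: "y \<in> derived br I" "z \<in> killing_perp s (derived br I)" "x = y + z"
      using semisimple_ideal_complement(2)[OF D] x lie_idealD(2)[OF I] by blast
    have "z = x - y" using yz(3) by simp
    then have "z \<in> I" using x yz(1) dI lie_idealD(1)[OF I] by (auto intro: subspace_diff)
    then have "z = 0" using \<open>?J = {0}\<close> yz(2) by blast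
    then show ?thesis using yz by simp
  qed
  then show ?thesis using dI by blast
qed

end

end

section \<open>Exponentials of nilpotent operators\<close>

text \<open>
  The exponential series cut off at \<open>N\<close>, which is the exponential if \<open>D ^^ N\<close> is zero.
\<close>

definition texp :: "nat \<Rightarrow> ('a::real_vector \<Rightarrow> 'a) \<Rightarrow> 'a \<Rightarrow> 'a" where
  "texp N D x = (\<Sum>n<N. (1 / fact n) *\<^sub>R (D ^^ n) x)"

lemma funpow_zero_mono:
  fixes D :: "'a::real_vector \<Rightarrow> 'a"
  assumes "(D ^^ N) x = 0" "linear D" "N \<le> n"
  shows "(D ^^ n) x = 0"
proof -
  have z: "(D ^^ k) 0 = 0" for k by (induction k) (simp_all add: linear_0[OF assms(2)])
  have "(D ^^ n) x = (D ^^ (n - N)) ((D ^^ N) x)"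
    using assms(3) by (simp flip: funpow_add[THEN fun_cong, unfolded o_apply])
  then show ?thesis using assms(1) z by simp
qed

lemma linear_funpow: "linear D \<Longrightarrow> linear (D ^^ n)" for D :: "'a::real_vector \<Rightarrow> 'a"
  by (induction n) (simp_all only: funpow.simps linear_id linear_compose)

lemma linear_texp: "linear D \<Longrightarrow> linear (texp N D)"
  unfolding texp_def
  by (intro linear_compose_sum ballI linear_compose_scale_right linear_funpow)

text \<open>
  The triangle \<open>i + j < 2 * N\<close> contains the square \<open>i, j < N\<close>, and all terms outside the square
  vanish.
\<close>

lemma cauchy_product_finite:
  fixes f :: "nat \<Rightarrow> nat \<Rightarrow> 'a::comm_monoid_add"
  assumes "\<And>i j. N \<le> i \<or> N \<le> j \<Longrightarrow> f i j = 0"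
  shows "(\<Sum>n<2 * N. \<Sum>i\<le>n. f i (n - i)) = (\<Sum>i<N. \<Sum>j<N. f i j)"
proof -
  have z: "i < N \<and> j < N" if "f i j \<noteq> 0" for i j
    using assms[of i j] that by (meson not_less)
  have "(\<Sum>n<2 * N. \<Sum>i\<le>n. f i (n - i)) = (\<Sum>(i, j)\<in>{(i, j). i + j < 2 * N}. f i j)"
    by (rule sum.triangle_reindex[symmetric])
  also have "\<dots> = (\<Sum>(i, j)\<in>{..<N} \<times> {..<N}. f i j)"
  proof (rule sum.mono_neutral_right)
    have "{(i, j). i + j < 2 * N} \<subseteq> {..<2 * N} \<times> {..<2 * N}" by auto
    then show "finite {(i, j). i + j < 2 * N}" by (rule finite_subset) simp
  qed (use z in auto)
  finally show ?thesis by (simp add: sum.cartesian_product)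
qed

lemma texp_double:
  assumes "\<And>x. (D ^^ N) x = (0::'a::real_vector)" "linear D"
  shows "texp N D x = (\<Sum>n<2 * N. (1 / fact n) *\<^sub>R (D ^^ n) x)"
  unfolding texp_def
  by (rule sum.mono_neutral_left) (use funpow_zero_mono[OF assms(1,2)] in auto)

lemma derivation_leibniz:
  assumes br: "bilinear br" and D: "derivation br D"
  shows "(1 / fact n) *\<^sub>R (D ^^ n) (br x y)
    = (\<Sum>i\<le>n. br ((1 / fact i) *\<^sub>R (D ^^ i) x) ((1 / fact (n - i)) *\<^sub>R (D ^^ (n - i)) y))"
proof -
  have l: "linear D" and der: "\<And>x y. D (br x y) = br (D x) y + br x (D y)"
    using D by (auto simp: derivation_def)
  have "(D ^^ n) (br x y) = (\<Sum>i\<le>n. real (n choose i) *\<^sub>R br ((D ^^ i) x) ((D ^^ (n - i)) y))"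
  proof (induction n)
    case (Suc n)
    let ?f = "\<lambda>i j. br ((D ^^ i) x) ((D ^^ j) y)"
    have "(D ^^ Suc n) (br x y)
        = (\<Sum>i\<le>n. real (n choose i) *\<^sub>R ?f (Suc i) (n - i)) + (\<Sum>i\<le>n. real (n choose i) *\<^sub>R ?f i (Suc (n - i)))"
      by (simp add: Suc linear_sum[OF l] linear_scale[OF l] der scaleR_add_right sum.distrib)
    also have "(\<Sum>i\<le>n. real (n choose i) *\<^sub>R ?f i (Suc (n - i)))
        = (\<Sum>i\<le>Suc n. real (n choose i) *\<^sub>R ?f i (Suc n - i))"
      by (simp add: Suc_diff_le)
    also have "\<dots> = ?f 0 (Suc n) + (\<Sum>i\<le>n. real (n choose Suc i) *\<^sub>R ?f (Suc i) (n - i))"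
      by (subst sum.atMost_Suc_shift) simp
    also have "(\<Sum>i\<le>n. real (n choose i) *\<^sub>R ?f (Suc i) (n - i)) + \<dots>
        = ?f 0 (Suc n) + (\<Sum>i\<le>n. real (Suc n choose Suc i) *\<^sub>R ?f (Suc i) (n - i))"
      by (simp add: sum.distrib scaleR_add_left)
    also have "\<dots> = (\<Sum>i\<le>Suc n. real (Suc n choose i) *\<^sub>R ?f i (Suc n - i))"
      by (subst sum.atMost_Suc_shift) simp
    finally show ?case .
  qed simp
  then have "(1 / fact n) *\<^sub>R (D ^^ n) (br x y)
      = (\<Sum>i\<le>n. (real (n choose i) / fact n) *\<^sub>R br ((D ^^ i) x) ((D ^^ (n - i)) y))"
    by (simp add: scaleR_sum_right)
  also have "\<dots> = (\<Sum>i\<le>n. br ((1 / fact i) *\<^sub>R (D ^^ i) x) ((1 / fact (n - i)) *\<^sub>R (D ^^ (n - i)) y))"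
  proof (rule sum.cong[OF refl])
    fix i assume "i \<in> {..n}"
    then have "real (n choose i) / fact n = (1 / fact i) * (1 / fact (n - i))"
      by (simp add: binomial_fact)
    then show "(real (n choose i) / fact n) *\<^sub>R br ((D ^^ i) x) ((D ^^ (n - i)) y)
        = br ((1 / fact i) *\<^sub>R (D ^^ i) x) ((1 / fact (n - i)) *\<^sub>R (D ^^ (n - i)) y)"
      by (simp add: bilinear_lmul[OF br] bilinear_rmul[OF br] mult.commute)
  qed
  finally show ?thesis .
qed

lemma texp_hom:
  assumes br: "bilinear br" and D: "derivation br D" and nil: "\<And>x. (D ^^ N) x = 0"
  shows "texp N D (br x y) = br (texp N D x) (texp N D y)"
proof -
  have l: "linear D" using D by (simp add: derivation_def)
  let ?f = "\<lambda>i j. br ((1 / fact i) *\<^sub>R (D ^^ i) x) ((1 / fact j) *\<^sub>R (D ^^ j) y)"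
  have "texp N D (br x y) = (\<Sum>n<2 * N. \<Sum>i\<le>n. ?f i (n - i))"
    unfolding texp_double[OF nil l] by (intro sum.cong refl derivation_leibniz[OF br D])
  also have "\<dots> = (\<Sum>i<N. \<Sum>j<N. ?f i j)"
    by (rule cauchy_product_finite)
      (use funpow_zero_mono[OF nil l] in \<open>auto simp: bilinear_lzero[OF br] bilinear_rzero[OF br]\<close>)
  also have "\<dots> = br (texp N D x) (texp N D y)"
    unfolding texp_def using br by (subst bilinear_sum) (simp_all add: sum.cartesian_product)
  finally show ?thesis .
qed

lemma texp_inverse:
  fixes D :: "'a::real_vector \<Rightarrow> 'a"
  assumes l: "linear D" and nil: "\<And>x. (D ^^ N) x = 0"
  shows "texp N D (texp N (\<lambda>x. - D x) x) = x"
proof -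
  have neg: "((\<lambda>x. - D x) ^^ j) x = (-1) ^ j *\<^sub>R (D ^^ j) x" for j x
    by (induction j) (simp_all add: linear_neg[OF l] linear_scale[OF l])
  let ?f = "\<lambda>i j. ((1 / fact i) * (1 / fact j) * (-1) ^ j) *\<^sub>R (D ^^ (i + j)) x"
  have "texp N D (texp N (\<lambda>x. - D x) x) = (\<Sum>i<N. \<Sum>j<N. ?f i j)"
    unfolding texp_def
    by (simp add: neg linear_sum[OF linear_funpow[OF l]] linear_scale[OF linear_funpow[OF l]]
        scaleR_sum_right funpow_add)
  also have "\<dots> = (\<Sum>n<2 * N. \<Sum>i\<le>n. ?f i (n - i))"
    by (rule cauchy_product_finite[symmetric]) (use funpow_zero_mono[OF nil l] in auto)
  also have "\<dots> = (\<Sum>n<2 * N. if n = 0 then x else 0)"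
  proof (rule sum.cong[OF refl])
    fix n
    have "(\<Sum>i\<le>n. ?f i (n - i)) = (\<Sum>i\<le>n. ((1 / fact n) * (real (n choose i) * 1 ^ i * (-1) ^ (n - i))) *\<^sub>R (D ^^ n) x)"
      by (intro sum.cong refl) (simp add: binomial_fact)
    also have "\<dots> = ((1 / fact n) * (\<Sum>i\<le>n. real (n choose i) * 1 ^ i * (-1) ^ (n - i))) *\<^sub>R (D ^^ n) x"
      by (simp only: scaleR_sum_left sum_distrib_left)
    also have "(\<Sum>i\<le>n. real (n choose i) * 1 ^ i * (-1) ^ (n - i)) = (1 + (-1)) ^ n"
      by (rule binomial_ring[symmetric])
    finally show "(\<Sum>i\<le>n. ?f i (n - i)) = (if n = 0 then x else 0)"
      by (simp add: power_0_left)
  qed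
  also have "\<dots> = x"
    using nil[of x] by (cases "N = 0") auto
  finally show ?thesis .
qed

text \<open>
  Induction on the degree: if \<open>p t\<close> denotes the sum up to degree \<open>N\<close>, then \<open>p (2 * t) - 2 ^ N
  *\<^sub>R p t\<close> has no term of the top degree \<open>N\<close>, and its other coefficients are nonzero multiples
  of those of \<open>p\<close>.
\<close>

lemma polynomial_coefficients_in_subspace:
  fixes c :: "nat \<Rightarrow> 'a::real_vector"
  assumes S: "subspace S" and "\<And>t::real. (\<Sum>j<N. t ^ j *\<^sub>R c j) \<in> S" "j < N"
  shows "c j \<in> S"
  using assms(2,3)
proof (induction N arbitrary: c j)
  case (Suc N)
  have low: "c j \<in> S" if j: "j < N" for j
  proof -
    have "(\<Sum>j<N. t ^ j *\<^sub>R ((2 ^ j - 2 ^ N) *\<^sub>R c j)) \<in> S" for t :: real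
    proof -
      have "(\<Sum>j<Suc N. (2 * t) ^ j *\<^sub>R c j) - 2 ^ N *\<^sub>R (\<Sum>j<Suc N. t ^ j *\<^sub>R c j) \<in> S"
        using Suc.prems(1) by (intro subspace_diff[OF S] subspace_scale[OF S])
      also have "(\<Sum>j<Suc N. (2 * t) ^ j *\<^sub>R c j) - 2 ^ N *\<^sub>R (\<Sum>j<Suc N. t ^ j *\<^sub>R c j)
          = (\<Sum>j<N. t ^ j *\<^sub>R ((2 ^ j - 2 ^ N) *\<^sub>R c j))"
        by (simp add: scaleR_sum_right sum_subtractf[symmetric] power_mult_distrib algebra_simps)
      finally show ?thesis .
    qed
    then have "(2 ^ j - 2 ^ N :: real) *\<^sub>R c j \<in> S" by (rule Suc.IH) (rule j)
    then have "(1 / (2 ^ j - 2 ^ N :: real)) *\<^sub>R ((2 ^ j - 2 ^ N :: real) *\<^sub>R c j) \<in> S"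
      by (rule subspace_scale[OF S])
    moreover have "(2 ^ j - 2 ^ N :: real) \<noteq> 0" using j by simp
    ultimately show ?thesis by simp
  qed
  show ?case
  proof (cases "j = N")
    case True
    have "(\<Sum>j<Suc N. 1 ^ j *\<^sub>R c j) - (\<Sum>j<N. c j) \<in> S"
      using low by (intro subspace_diff[OF S Suc.prems(1)] subspace_sum[OF S]) auto
    then show ?thesis using True by simp
  next
    case False
    then show ?thesis using low Suc.prems(2) by simp
  qed
qed simp

section \<open>Nilpotent elements span a semisimple algebra without compact factors\<close>

context fd_lie_algebra
begin

text \<open>
  Diagonalizable derivations that preserve \<open>s\<close>. The eigenspaces grade \<open>s\<close> and the whole algebra
  by real numbers.
\<close>

definition grading_derivation :: "'a set \<Rightarrow> ('a \<Rightarrow> 'a) \<Rightarrow> bool" where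
  "grading_derivation s M \<longleftrightarrow> derivation br M \<and> M ` s \<subseteq> s \<and>
     s \<subseteq> span {w \<in> s. \<exists>a. M w = a *\<^sub>R w} \<and> span {w. \<exists>a. M w = a *\<^sub>R w} = UNIV"

text \<open>
  The elements that are homogeneous of nonzero degree for some grading. No grading is singled
  out, so that the set is stable under the exponentials of its elements, which act on the
  gradings.
\<close>

definition graded_elements :: "'a set \<Rightarrow> 'a set" where
  "graded_elements s = {u \<in> s. \<exists>M a. grading_derivation s M \<and> a \<noteq> 0 \<and> M u = a *\<^sub>R u}"

lemma locally_nilpotent_imp_nilpotent:
  fixes F :: "'a \<Rightarrow> 'a"
  assumes l: "linear F" and S: "span S = UNIV" and "\<And>w. w \<in> S \<Longrightarrow> \<exists>k. (F ^^ k) w = 0"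
  shows "nilpotent_op F"
proof -
  have loc: "\<exists>k. (F ^^ k) x = 0" for x
  proof -
    have "x \<in> span S" using S by simp
    then show ?thesis
    proof (induction x rule: span_induct_alt)
      case (step c x y)
      then obtain i j where ij: "(F ^^ i) x = 0" "(F ^^ j) y = 0" using assms(3) by blast
      have "(F ^^ (i + j)) x = 0" "(F ^^ (i + j)) y = 0"
        using funpow_zero_mono[OF ij(1) l] funpow_zero_mono[OF ij(2) l] by simp_all
      then have "(F ^^ (i + j)) (c *\<^sub>R x + y) = 0"
        by (simp add: linear_add[OF linear_funpow[OF l]] linear_scale[OF linear_funpow[OF l]])
      then show ?case by blast
    qed (auto intro: exI[of _ 0])
  qed
  then obtain k where k: "\<And>x. (F ^^ k x) x = 0" by metis
  obtain B :: "'a set" where B: "finite B" "span B = UNIV"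
    using fd unfolding finite_dimensional_def by blast
  let ?n = "\<Sum>b\<in>B. k b"
  have n: "(F ^^ ?n) b = 0" if "b \<in> B" for b
    by (rule funpow_zero_mono[OF k l]) (rule member_le_sum, use B that in auto)
  have "(F ^^ ?n) x = 0" for x
  proof -
    have "x \<in> span B" using B by simp
    then show ?thesis
      by (induction x rule: span_induct_alt)
        (simp_all add: n linear_0[OF linear_funpow[OF l]] linear_add[OF linear_funpow[OF l]]
          linear_scale[OF linear_funpow[OF l]])
  qed
  then show ?thesis unfolding nilpotent_op_def by blast
qed

text \<open>
  If \<open>w\<close> has degree \<open>b\<close>, then \<open>(br u ^^ k) w\<close> has degree \<open>b + k * a\<close>. Were they all nonzero, the
  polynomial that annihilates \<open>M\<close> would have infinitely many roots.
\<close>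

lemma graded_element_nilpotent:
  assumes "u \<in> graded_elements s"
  shows "nilpotent_op (br u)"
proof -
  obtain M a where M: "derivation br M" "span {w. \<exists>a. M w = a *\<^sub>R w} = UNIV"
    and a: "a \<noteq> 0" "M u = a *\<^sub>R u"
    using assms by (auto simp: graded_elements_def grading_derivation_def)
  have lM: "linear M" and der: "\<And>x y. M (br x y) = br (M x) y + br x (M y)"
    using M(1) by (auto simp: derivation_def)
  interpret r: operator_polynomial scaleR M by (rule real_operator_polynomial[OF lM])
  obtain m where m: "m \<noteq> 0" "\<And>x. rpop M m x = 0"
    using exists_annihilating_polynomial[OF fd lM] by blast
  have "\<exists>k. (br u ^^ k) w = 0" if w: "w \<in> {w. \<exists>a. M w = a *\<^sub>R w}" for w
  proof (rule ccontr)
    assume no: "\<nexists>k. (br u ^^ k) w = 0"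
    obtain b where b: "M w = b *\<^sub>R w" using w by blast
    have eig: "M ((br u ^^ k) w) = (b + of_nat k * a) *\<^sub>R (br u ^^ k) w" for k
    proof (induction k)
      case (Suc k)
      then show ?case by (simp add: der a br_simps algebra_simps)
    qed (simp add: b)
    have "poly m (b + of_nat k * a) = 0" for k
      using r.pop_eigen[OF eig, of m k] m(2) no by auto
    then have "range (\<lambda>k::nat. b + of_nat k * a) \<subseteq> {x. poly m x = 0}" by blast
    moreover have "finite {x. poly m x = 0}" using m(1) by (rule poly_roots_finite)
    ultimately have "finite (range (\<lambda>k::nat. b + of_nat k * a))" by (rule finite_subset)
    moreover have "inj (\<lambda>k::nat. b + of_nat k * a)" using a(1) by (auto simp: inj_on_def)
    ultimately show False using finite_imageD infinite_UNIV_nat by blast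
  qed
  then show ?thesis by (rule locally_nilpotent_imp_nilpotent[OF linear_br M(2)])
qed

lemma texp_br_mem:
  assumes "lie_subalgebra br s" "y \<in> s" "x \<in> s"
  shows "texp N (br y) x \<in> s"
proof -
  have "(br y ^^ n) x \<in> s" for n
    by (induction n) (use assms subalgebra_br in auto)
  then show ?thesis unfolding texp_def
    using subalgebra_subspace[OF assms(1)] by (intro subspace_sum subspace_scale)
qed

text \<open>
  If \<open>M\<close> witnesses that \<open>u\<close> is graded, then its conjugate by the automorphism \<open>exp (ad y)\<close> does
  so for the image of \<open>u\<close>.
\<close>

lemma graded_elements_conj:
  assumes s: "lie_subalgebra br s" and y: "y \<in> s" and nil: "\<And>x. (br y ^^ N) x = 0"
    and u: "u \<in> graded_elements s"
  shows "texp N (br y) u \<in> graded_elements s"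
proof -
  obtain M a where M: "derivation br M" "M ` s \<subseteq> s" "s \<subseteq> span {w \<in> s. \<exists>a. M w = a *\<^sub>R w}"
    "span {w. \<exists>a. M w = a *\<^sub>R w} = UNIV" and a: "a \<noteq> 0" "M u = a *\<^sub>R u" and us: "u \<in> s"
    using u by (auto simp: graded_elements_def grading_derivation_def)
  have lM: "linear M" and der: "\<And>x y. M (br x y) = br (M x) y + br x (M y)"
    using M(1) by (auto simp: derivation_def)
  let ?f = "texp N (br y)" and ?g = "texp N (br (- y))"
  have minus: "br (- y) = (\<lambda>x. - br y x)" "br y = (\<lambda>x. - br (- y) x)"
    by (simp_all add: fun_eq_iff br_simps)
  have pw: "(br (- y) ^^ n) x = (-1) ^ n *\<^sub>R (br y ^^ n) x" for n x
    by (induction n) (simp_all add: br_simps)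
  have nil': "(br (- y) ^^ N) x = 0" for x using nil by (simp add: pw)
  have fg: "?f (?g x) = x" for x using texp_inverse[OF linear_br nil] minus(1) by simp
  have gf: "?g (?f x) = x" for x using texp_inverse[OF linear_br nil', of x] minus(2) by simp
  have lf: "linear ?f" and lg: "linear ?g" by (simp_all add: linear_texp linear_br)
  have fh: "?f (br x z) = br (?f x) (?f z)" for x z by (rule texp_hom[OF bilinear_br derivation_br nil])
  have gh: "?g (br x z) = br (?g x) (?g z)" for x z by (rule texp_hom[OF bilinear_br derivation_br nil'])
  have fs: "?f x \<in> s" and gs: "?g x \<in> s" if "x \<in> s" for x
    using texp_br_mem[OF s] y subspace_neg[OF subalgebra_subspace[OF s]] that by auto
  define M' where "M' = (\<lambda>x. ?f (M (?g x)))"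
  have eig: "M' (?f w) = b *\<^sub>R ?f w" if "M w = b *\<^sub>R w" for w b
    using that by (simp add: M'_def gf linear_scale[OF lf])
  have im: "?f w \<in> span (?f ` S)" if "w \<in> span S" for w S
    using that linear_span_image[OF lf, of S] by blast
  have "linear M'" unfolding M'_def
    using linear_compose[OF lg linear_compose[OF lM lf]] by (simp add: o_def)
  then have "derivation br M'"
    by (simp add: derivation_def M'_def gh fh der linear_add[OF lf] fg)
  moreover have "M' ` s \<subseteq> s" using fs gs M(2) by (auto simp: M'_def)
  moreover have "s \<subseteq> span {w \<in> s. \<exists>a. M' w = a *\<^sub>R w}"
  proof
    fix x assume "x \<in> s"
    then have "?f (?g x) \<in> span (?f ` {w \<in> s. \<exists>a. M w = a *\<^sub>R w})"
      using subsetD[OF M(3) gs] by (intro im)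
    moreover have "?f ` {w \<in> s. \<exists>a. M w = a *\<^sub>R w} \<subseteq> {w \<in> s. \<exists>a. M' w = a *\<^sub>R w}"
      using eig fs by auto
    ultimately show "x \<in> span {w \<in> s. \<exists>a. M' w = a *\<^sub>R w}"
      unfolding fg by (meson span_mono subsetD)
  qed
  moreover have "span {w. \<exists>a. M' w = a *\<^sub>R w} = UNIV"
  proof (rule UNIV_eq_I[symmetric])
    fix x
    have "?f (?g x) \<in> span (?f ` {w. \<exists>a. M w = a *\<^sub>R w})"
      using M(4) by (intro im) simp
    moreover have "?f ` {w. \<exists>a. M w = a *\<^sub>R w} \<subseteq> {w. \<exists>a. M' w = a *\<^sub>R w}"
      using eig by auto
    ultimately show "x \<in> span {w. \<exists>a. M' w = a *\<^sub>R w}"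
      unfolding fg by (meson span_mono subsetD)
  qed
  ultimately have "grading_derivation s M'" by (simp add: grading_derivation_def)
  then show ?thesis unfolding graded_elements_def using fs[OF us] a(1) eig[OF a(2)] by blast
qed

text \<open>
  Let \<open>u\<close> have degree \<open>a\<close>. Brackets with an element \<open>w\<close> of degree \<open>b\<close> have degree \<open>a + b\<close>, so
  only \<open>b = - a\<close> needs an argument. Then \<open>w\<close> is itself graded, hence \<open>ad w\<close> is nilpotent, and
  \<open>exp (t * ad w) u\<close> is graded for all real \<open>t\<close>. This is a polynomial in \<open>t\<close> with values in the
  span, and \<open>br w u\<close> is its linear coefficient.
\<close>

lemma graded_span_ideal:
  assumes s: "lie_subalgebra br s"
  shows "lie_ideal br (span (graded_elements s)) s"
proof -
  have gs: "graded_elements s \<subseteq> s" by (auto simp: graded_elements_def)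
  have gen: "br y u \<in> span (graded_elements s)" if y: "y \<in> s" and u: "u \<in> graded_elements s" for y u
  proof -
    obtain M a where M: "grading_derivation s M" and a: "a \<noteq> 0" "M u = a *\<^sub>R u" and us: "u \<in> s"
      using u by (auto simp: graded_elements_def)
    have der: "\<And>x y. M (br x y) = br (M x) y + br x (M y)"
      using M by (auto simp: grading_derivation_def derivation_def)
    have eig: "br w u \<in> span (graded_elements s)" if w: "w \<in> s" and b: "M w = b *\<^sub>R w" for w b
    proof (cases "a + b = 0")
      case False
      have "M (br w u) = (a + b) *\<^sub>R br w u" by (simp add: der a b br_simps algebra_simps)
      then have "br w u \<in> graded_elements s"
        unfolding graded_elements_def using False M subalgebra_br[OF s w us] by blast
      then show ?thesis by (rule span_base)
    next
      case True
      then have "b \<noteq> 0" using a(1) by auto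
      then have "w \<in> graded_elements s" unfolding graded_elements_def using M w b by blast
      then obtain n where n: "\<And>x. (br w ^^ n) x = 0"
        using graded_element_nilpotent unfolding nilpotent_op_def by blast
      \<comment> \<open>at least 2, so that the linear coefficient is present\<close>
      define N where "N = n + 2"
      have N: "(br w ^^ N) x = 0" for x
        by (rule funpow_zero_mono[OF n linear_br]) (simp add: N_def)
      have pw: "(br (t *\<^sub>R w) ^^ j) x = t ^ j *\<^sub>R (br w ^^ j) x" for t j x
        by (induction j) (simp_all add: br_simps)
      have "(\<Sum>j<N. t ^ j *\<^sub>R ((1 / fact j) *\<^sub>R (br w ^^ j) u)) \<in> span (graded_elements s)" for t :: real
      proof -
        have "texp N (br (t *\<^sub>R w)) u \<in> graded_elements s"
          using subspace_scale[OF subalgebra_subspace[OF s] w] N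
          by (intro graded_elements_conj[OF s _ _ u]) (auto simp: pw)
        moreover have "texp N (br (t *\<^sub>R w)) u = (\<Sum>j<N. t ^ j *\<^sub>R ((1 / fact j) *\<^sub>R (br w ^^ j) u))"
          by (simp add: texp_def pw)
        ultimately show ?thesis by (simp add: span_base)
      qed
      then have "(1 / fact 1) *\<^sub>R (br w ^^ 1) u \<in> span (graded_elements s)"
        by (rule polynomial_coefficients_in_subspace[OF subspace_span]) (simp add: N_def)
      then show ?thesis by simp
    qed
    have "y \<in> span {w \<in> s. \<exists>a. M w = a *\<^sub>R w}" using M y by (auto simp: grading_derivation_def)
    then show ?thesis
    proof (induction y rule: span_induct_alt)
      case (step c x z)
      then show ?case using eig by (auto simp: br_simps intro!: span_add span_scale)
    qed (simp add: span_zero)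
  qed
  have "br y u \<in> span (graded_elements s)" if "y \<in> s" "u \<in> span (graded_elements s)" for y u
    by (rule span_br_closed[OF gen that(2)]) (use that in auto)
  then show ?thesis
    using span_minimal[OF gs subalgebra_subspace[OF s]] by (simp add: lie_ideal_def)
qed

text \<open>
  The vector \<open>u + \<i> v\<close> is an eigenvector of \<open>ad x\<close> for \<open>a + \<i> b\<close>, so the real part of \<open>ad x\<close>
  acts on \<open>u\<close> and \<open>v\<close> by \<open>a\<close>.
\<close>

lemma real_eigen_part_graded:
  assumes s: "lie_subalgebra br s" and x: "x \<in> s" and u: "u \<in> s" "v \<in> s" and a: "a \<noteq> 0"
    and eig: "br x u = a *\<^sub>R u - b *\<^sub>R v" "br x v = b *\<^sub>R u + a *\<^sub>R v"
  shows "u \<in> graded_elements s" "v \<in> graded_elements s"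
proof -
  obtain p where "real_part_polynomial (br x) p"
    using real_part_operator[OF fd linear_br[of x]] ..
  note pp = this[unfolded real_part_polynomial_def]
  interpret r: operator_polynomial scaleR "br x" by (rule real_operator_polynomial[OF linear_br])
  let ?M = "rpop (br x) p"
  note sub = subalgebra_subspace[OF s]
  have diag: "W \<subseteq> span {w \<in> W. \<exists>a. ?M w = a *\<^sub>R w}" if "subspace W" "br x ` W \<subseteq> W" for W
    using conjunct1[OF conjunct2[OF conjunct2[OF pp]]] that by blast
  have "derivation br ?M" using pp bilinear_br derivation_br[of x] by blast
  moreover have "?M ` s \<subseteq> s"
    using sub br_image[OF s x] by (auto intro!: r.pop_mem simp: subspace_raw_def[symmetric])
  moreover have "s \<subseteq> span {w \<in> s. \<exists>a. ?M w = a *\<^sub>R w}" by (rule diag[OF sub br_image[OF s x]])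
  moreover have "span {w. \<exists>a. ?M w = a *\<^sub>R w} = UNIV" using diag[OF subspace_UNIV] by auto
  ultimately have "grading_derivation s ?M" by (simp add: grading_derivation_def)
  moreover have "?M u = a *\<^sub>R u" "?M v = a *\<^sub>R v" using conjunct1[OF pp] eig by blast+
  ultimately show "u \<in> graded_elements s" "v \<in> graded_elements s"
    unfolding graded_elements_def using u a by blast+
qed

text \<open>
  An eigenvalue of \<open>ad x\<close> on \<open>c\<close> with nonzero real part would put graded elements into \<open>c\<close>. So
  the eigenvalues are purely imaginary and their squares sum up to \<open>tr ((ad x)\<^sup>2) \<le> 0\<close>.
\<close>

lemma killing_nonpositive:
  assumes s: "lie_subalgebra br s" and c: "lie_ideal br c s"
    and disj: "c \<inter> span (graded_elements s) = {0}" and x: "x \<in> c"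
  shows "killing_form br c x x \<le> 0"
proof -
  note cD = lie_idealD[OF c]
  have xs: "x \<in> s" using x cD(2) by blast
  have im: "br x ` c \<subseteq> c" using cD(3)[OF xs] by blast
  obtain es where "eigenvalue_list c (br x) es"
    using trace_power_sums[OF fd linear_br cD(1) im] ..
  note es = this[unfolded eigenvalue_list_def]
  have re: "Re e = 0" if e: "e \<in> set es" for e
  proof (rule ccontr)
    assume ne: "Re e \<noteq> 0"
    obtain u v where uv: "u \<in> c" "v \<in> c" "u \<noteq> 0 \<or> v \<noteq> 0"
      "br x u = Re e *\<^sub>R u - Im e *\<^sub>R v" "br x v = Im e *\<^sub>R u + Re e *\<^sub>R v"
      using es e by blast
    have "u \<in> s" "v \<in> s" using uv cD(2) by auto
    from real_eigen_part_graded[OF s xs this ne uv(4,5)]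
    have "u \<in> c \<inter> span (graded_elements s)" "v \<in> c \<inter> span (graded_elements s)"
      using uv span_base by auto
    then show False using disj uv(3) by simp
  qed
  have "killing_form br c x x = Re (of_real (trace_on c (br x ^^ 2)))"
    by (simp add: killing_form_def numeral_2_eq_2)
  also have "\<dots> = (\<Sum>e\<leftarrow>es. (Re e)\<^sup>2 - (Im e)\<^sup>2)"
    using conjunct1[OF es] by (simp add: Re_sum_list Re_power2)
  also have "\<dots> \<le> 0" using re by (intro sum_list_nonpos) auto
  finally show ?thesis .
qed

text \<open>
  A minimal ideal \<open>I\<close> inside the Killing complement \<open>c\<close> of the span is simple. The Killing form
  is semidefinite on it by the previous lemma and nondegenerate by Cartan's criterion, hence
  definite, so that \<open>I\<close> is a compact factor.
\<close>

lemma graded_elements_span_semisimple: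
  assumes ss: "lie_semisimple br s" and nc: "no_compact_factors br s"
  shows "span (graded_elements s) = s"
proof -
  note s = semisimple_subalgebra[OF ss]
  note n = graded_span_ideal[OF s]
  define c where "c = killing_perp s (span (graded_elements s))"
  have c: "lie_ideal br c s" unfolding c_def by (rule killing_perp_ideal[OF ss n])
  have disj: "c \<inter> span (graded_elements s) = {0}"
    unfolding c_def using semisimple_ideal_complement(1)[OF ss n] by (simp add: Int_commute)
  have "c = {0}"
  proof (rule ccontr)
    assume c0: "c \<noteq> {0}"
    let ?Q = "\<lambda>I. lie_ideal br I s \<and> I \<subseteq> c \<and> I \<noteq> {0}"
    have "?Q c" using c c0 by simp
    then obtain I where I: "?Q I" and min: "\<And>J. ?Q J \<Longrightarrow> dim I \<le> dim J"
      using ex_has_least_nat[of ?Q c dim] by blast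
    have II: "lie_ideal br I s" using I by simp
    note subI = lie_ideal_subalgebra[OF II]
    have "\<not> abelian_on br I"
      using semisimple_abelian_ideal[OF ss II] I unfolding abelian_on_def by blast
    moreover have "J = {0} \<or> J = I" if J: "lie_ideal br J I" for J
    proof (rule ccontr)
      assume no: "\<not> (J = {0} \<or> J = I)"
      have "lie_ideal br J s" by (rule ideal_of_ideal[OF ss II J])
      then have "dim I \<le> dim J" using no I lie_idealD(2)[OF J] by (intro min) auto
      moreover have "dim J < dim I"
        using no lie_idealD(2)[OF J] by (intro dim_strict_mono[OF fd] lie_idealD(1)[OF J] lie_idealD(1)[OF II]) auto
      ultimately show False by simp
    qed
    ultimately have simple: "lie_simple br I" using subI by (auto simp: lie_simple_def)
    let ?K = "killing_form br I"
    have neg: "?K x x \<le> 0" if "x \<in> I" for x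
    proof -
      have "killing_form br c x x \<le> 0" using killing_nonpositive[OF s c disj] that I by blast
      moreover have "?K x x = killing_form br s x x" using killing_ideal[OF s II that that] by simp
      moreover have "killing_form br c x x = killing_form br s x x"
        using killing_ideal[OF s c, of x x] that I by auto
      ultimately show ?thesis by simp
    qed
    have "?K x x < 0" if x: "x \<in> I" "x \<noteq> 0" for x
    proof (rule ccontr)
      assume "\<not> ?K x x < 0"
      then have Kxx: "?K x x = 0" using neg[OF x(1)] by simp
      have "?K x y = 0" if y: "y \<in> I" for y
      proof -
        have "2 * t * ?K x y + ?K y y \<le> 0" for t
        proof -
          have tx: "t *\<^sub>R x \<in> I" and txy: "t *\<^sub>R x + y \<in> I"
            using x y subalgebra_subspace[OF subI] by (auto intro: subspace_scale subspace_add)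
          have "?K (t *\<^sub>R x + y) (t *\<^sub>R x + y) = ?K (t *\<^sub>R x) (t *\<^sub>R x + y) + ?K y (t *\<^sub>R x + y)"
            by (rule killing_add[OF subI tx y txy])
          also have "?K (t *\<^sub>R x) (t *\<^sub>R x + y) = t * ?K (t *\<^sub>R x + y) x"
            using killing_scale[OF subI x(1) txy] killing_sym[OF subI x(1) txy] by simp
          also have "?K (t *\<^sub>R x + y) x = t * ?K x x + ?K y x"
            using killing_add[OF subI tx y x(1)] killing_scale[OF subI x(1) x(1)] by simp
          also have "?K y (t *\<^sub>R x + y) = ?K (t *\<^sub>R x + y) y" by (rule killing_sym[OF subI y txy])
          also have "\<dots> = t * ?K x y + ?K y y"
            using killing_add[OF subI tx y y] killing_scale[OF subI x(1) y] by simp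
          finally have "?K (t *\<^sub>R x + y) (t *\<^sub>R x + y) = 2 * t * ?K x y + ?K y y"
            using Kxx killing_sym[OF subI y x(1)] by simp
          then show ?thesis using neg[OF txy] by simp
        qed
        \<comment> \<open>A linear function of \<open>t\<close> that is bounded above is constant; at this \<open>t\<close> it would be 1.\<close>
        from this[of "(1 - ?K y y) / (2 * ?K x y)"] show ?thesis
          by (cases "?K x y = 0") auto
      qed
      then have "x \<in> killing_perp s I"
        using killing_ideal[OF s II x(1)] x(1) lie_idealD(2)[OF II] by (auto simp: killing_perp_def)
      then show False using semisimple_ideal_complement(1)[OF ss II] x by blast
    qed
    then have "definite_on ?K I" by (simp add: definite_on_def)
    then have "compact_type br I" using semisimple_ideal[OF ss II] by (simp add: compact_type_def)
    then show False using nc II simple unfolding no_compact_factors_def by blast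
  qed
  have "x \<in> span (graded_elements s)" if "x \<in> s" for x
    using semisimple_ideal_complement(2)[OF ss n that] \<open>c = {0}\<close> unfolding c_def by auto
  then show ?thesis using lie_idealD(2)[OF n] by blast
qed

end

section \<open>Nil-invariance and skew-symmetry\<close>

text \<open>
  All \<open>exp (t * ad x)\<close> are inner automorphisms, so \<open>ad x\<close> belongs to the Lie algebra of any
  group that contains them. For nilpotent \<open>ad x\<close> the exponential series is finite, and it is an
  automorphism by the Leibniz rule.
\<close>

lemma nil_invariant_skew_of_ad_nilpotent:
  fixes br :: "'a::real_normed_vector \<Rightarrow> 'a \<Rightarrow> 'a"
  assumes "fd_lie_algebra br" and ni: "nil_invariant br form" and nil: "nilpotent_op (br x)"
  shows "form (br x u) v = - form u (br x v)"
proof -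
  interpret fd_lie_algebra br by fact
  obtain N where N: "\<And>v. (br x ^^ N) v = 0" using nil unfolding nilpotent_op_def by blast
  have exp_in: "op_exp (\<lambda>v. t *\<^sub>R br x v) \<in> zariski_closure_in (lie_aut br) (inn br)" for t
  proof -
    let ?y = "t *\<^sub>R x"
    have pw: "(br (c *\<^sub>R x) ^^ j) v = c ^ j *\<^sub>R (br x ^^ j) v" for c j v
      by (induction j) (simp_all add: br_simps)
    have nily: "(br (c *\<^sub>R x) ^^ N) v = 0" for c v using N by (simp add: pw)
    have expy: "op_exp (br (c *\<^sub>R x)) = texp N (br (c *\<^sub>R x))" for c
    proof
      fix v
      show "op_exp (br (c *\<^sub>R x)) v = texp N (br (c *\<^sub>R x)) v"
        unfolding op_exp_def texp_def
        by (rule suminf_finite) (use funpow_zero_mono[OF nily linear_br] in auto)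
    qed
    have minus: "br (- t *\<^sub>R x) = (\<lambda>v. - br ?y v)" "br ?y = (\<lambda>v. - br (- t *\<^sub>R x) v)"
      by (simp_all add: fun_eq_iff br_simps)
    have "texp N (br ?y) (texp N (br (- t *\<^sub>R x)) v) = v" for v
      unfolding minus(1) by (rule texp_inverse[OF linear_br nily[of t]])
    moreover have "texp N (br (- t *\<^sub>R x)) (texp N (br ?y) v) = v" for v
      unfolding minus(2) by (rule texp_inverse[OF linear_br nily[of "- t"]])
    ultimately have "bij (texp N (br ?y))" by (intro o_bij[of "texp N (br (- t *\<^sub>R x))"] ext) simp_all
    then have "texp N (br ?y) \<in> lie_aut br"
      using linear_texp[OF linear_br] texp_hom[OF bilinear_br derivation_br nily]
      by (simp add: lie_aut_def)
    then have "op_exp (br ?y) \<in> lie_aut br" by (simp add: expy)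
    moreover have "(\<lambda>v. t *\<^sub>R br x v) = br ?y" by (simp add: fun_eq_iff br_simps)
    ultimately show ?thesis using inn_exp[of br ?y] by (auto simp: zariski_closure_in_def)
  qed
  then have "br x \<in> lie_algebra_of_group (zariski_closure_in (lie_aut br) (inn br))"
    using linear_br by (simp add: lie_algebra_of_group_def)
  then show ?thesis using ni nil unfolding nil_invariant_def by blast
qed

section \<open>The orthogonal decomposition\<close>

text \<open>
  The situation after the structure theory has been used: \<open>k\<close>, \<open>s\<close> and \<open>r\<close> decompose the
  algebra, the form is skew under \<open>s\<close> and \<open>r\<close>, and its kernel contains no nonzero ideal. The
  latter is used as a method to show that ideals vanish.
\<close>

locale effective_split_lie_algebra = fd_lie_algebra br
  for br :: "'a::real_vector \<Rightarrow> 'a \<Rightarrow> 'a" +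
  fixes form :: "'a \<Rightarrow> 'a \<Rightarrow> real" and k s r :: "'a set"
  assumes bilinear_form: "bilinear form"
    and form_sym: "form x y = form y x"
    and effective: "lie_ideal br I UNIV \<Longrightarrow> I \<subseteq> form_kernel form \<Longrightarrow> I = {0}"
    and r_ideal: "lie_ideal br r UNIV"
    and r_abelian: "x \<in> r \<Longrightarrow> y \<in> r \<Longrightarrow> br x y = 0"
    and k_subalgebra: "lie_subalgebra br k"
    and s_semisimple: "lie_semisimple br s"
    and k_s: "x \<in> k \<Longrightarrow> y \<in> s \<Longrightarrow> br x y = 0"
    and decompose: "\<exists>p\<in>k. \<exists>q\<in>s. \<exists>t\<in>r. w = p + q + t"
    and independent_summands: "p \<in> k \<Longrightarrow> q \<in> s \<Longrightarrow> t \<in> r \<Longrightarrow> p + q + t = 0 \<Longrightarrow> p = 0 \<and> q = 0 \<and> t = 0"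
    and skew: "x \<in> s \<or> x \<in> r \<Longrightarrow> form (br x u) v = - form u (br x v)"
begin

lemmas form_simps = bilinear_ladd[OF bilinear_form] bilinear_radd[OF bilinear_form]
  bilinear_lmul[OF bilinear_form] bilinear_rmul[OF bilinear_form]
  bilinear_lneg[OF bilinear_form] bilinear_rneg[OF bilinear_form]
  bilinear_lsub[OF bilinear_form] bilinear_rsub[OF bilinear_form]
  bilinear_lzero[OF bilinear_form] bilinear_rzero[OF bilinear_form]

lemma linear_form: "linear (form x)" "linear (\<lambda>x. form x y)"
  using bilinear_form by (simp_all add: bilinear_def)

lemma s_subalgebra: "lie_subalgebra br s"
  by (rule semisimple_subalgebra[OF s_semisimple])

lemma s_ideal: "lie_ideal br s s"
  using s_subalgebra by (simp add: lie_ideal_def lie_subalgebra_def)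

lemma s_k: "x \<in> s \<Longrightarrow> y \<in> k \<Longrightarrow> br x y = 0"
  using k_s[of y x] br_antisym[of x y] by simp

lemma r_mem: "y \<in> r \<Longrightarrow> br x y \<in> r" "y \<in> r \<Longrightarrow> br y x \<in> r"
  using lie_idealD(3,4)[OF r_ideal] by auto

lemmas r_subspace = lie_idealD(1)[OF r_ideal]
lemmas s_subspace = subalgebra_subspace[OF s_subalgebra]
lemmas k_subspace = subalgebra_subspace[OF k_subalgebra]
lemmas s_mem = subalgebra_br[OF s_subalgebra]

lemma form_br_swap:
  assumes "y \<in> s \<or> y \<in> r"
  shows "form (br z y) u = form z (br y u)"
  using skew[OF assms, of z u] br_antisym[of z y] by (simp add: form_simps)

text \<open>
  Here \<open>z\<close> is arbitrary: the form restricted to \<open>s + r\<close> is invariant under the whole algebra,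
  since the operator \<open>ad z\<close> can be exchanged for \<open>ad x\<close> and \<open>ad y\<close>.
\<close>

lemma skew_on_s_r:
  assumes x: "x \<in> s \<or> x \<in> r" and y: "y \<in> s \<or> y \<in> r"
  shows "form (br z x) y = - form x (br z y)"
proof -
  have "form (br z x) y = form z (br x y)" by (rule form_br_swap[OF x])
  moreover have "form x (br z y) = form z (br y x)"
    using form_br_swap[OF y, of z x] form_sym[of x] by simp
  moreover have "br y x = - br x y" by (rule br_antisym)
  ultimately show ?thesis by (simp add: form_simps)
qed

text \<open>
  The commutator of \<open>s\<close> and \<open>r\<close>, which becomes the dual of \<open>s1\<close>.
\<close>

definition sr :: "'a set" where
  "sr = span {br x y |x y. x \<in> s \<and> y \<in> r}"

lemma sr_base: "x \<in> s \<Longrightarrow> y \<in> r \<Longrightarrow> br x y \<in> sr"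
  unfolding sr_def by (rule span_base) blast

lemma sr_subspace: "subspace sr" by (simp add: sr_def)

lemma sr_subset_r: "sr \<subseteq> r"
  unfolding sr_def by (rule span_minimal) (use r_mem r_subspace in auto)

lemma sr_linear_zero:
  assumes "linear f" "\<And>x y. x \<in> s \<Longrightarrow> y \<in> r \<Longrightarrow> f (br x y) = 0" "v \<in> sr"
  shows "f v = 0"
  by (rule linear_eq_0_on_span[OF assms(1) _ assms(3)[unfolded sr_def]]) (use assms(2) in blast)

text \<open>
  The span of all \<open>[z, [x, y]]\<close> with \<open>z \<in> k\<close>, \<open>x \<in> s\<close>, \<open>y \<in> r\<close> is an ideal in the kernel.
  Writing its generators as \<open>[x, [z, y]]\<close> and moving \<open>x\<close> to the other side leaves only products
  \<open>form [z, y] w\<close> with \<open>w \<in> s + r\<close>. For \<open>w \<in> r\<close> they vanish because \<open>r\<close> is abelian, and for \<open>w \<in>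
  s\<close> because \<open>z\<close> commutes with \<open>w\<close>.
\<close>

lemma k_sr: "z \<in> k \<Longrightarrow> v \<in> sr \<Longrightarrow> br z v = 0"
proof -
  let ?G = "{br z (br x y) |z x y. z \<in> k \<and> x \<in> s \<and> y \<in> r}"
  have swap: "br z (br x y) = br x (br z y)" if "z \<in> k" "x \<in> s" for x y z
    using jacobi[of z x y] k_s[OF that] by simp
  have "lie_ideal br (span ?G) UNIV"
  proof -
    have "br w g \<in> span ?G" if g: "g \<in> ?G" for w g
    proof -
      obtain z x y where zxy: "z \<in> k" "x \<in> s" "y \<in> r" "g = br z (br x y)" using g by blast
      obtain p q t where w: "p \<in> k" "q \<in> s" "t \<in> r" "w = p + q + t" using decompose by blast
      have "br p g = br (br p z) (br x y) + br z (br x (br p y))"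
        unfolding zxy(4) jacobi[of p z] swap[OF w(1) zxy(2)] ..
      moreover have "br (br p z) (br x y) \<in> ?G" "br z (br x (br p y)) \<in> ?G"
        using zxy w subalgebra_br[OF k_subalgebra] r_mem by blast+
      moreover have "br q g = br z (br q (br x y))"
        unfolding zxy(4) jacobi[of q z] using s_k[OF w(2) zxy(1)] by simp
      moreover have "br z (br q (br x y)) \<in> ?G" using zxy w r_mem by blast
      moreover have "br t g = 0" using zxy w r_mem by (intro r_abelian) auto
      ultimately show ?thesis unfolding w(4) by (simp add: br_simps span_add span_base)
    qed
    then have "br w g \<in> span ?G" if "g \<in> span ?G" for w g
      using span_br_closed[of ?G w g] that by blast
    then show ?thesis by (simp add: lie_ideal_def)
  qed
  moreover have "span ?G \<subseteq> form_kernel form"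
  proof (rule span_minimal)
    show "?G \<subseteq> form_kernel form"
    proof
      fix g assume "g \<in> ?G"
      then obtain z x y where zxy: "z \<in> k" "x \<in> s" "y \<in> r" "g = br z (br x y)" by blast
      have "form g w = 0" for w
      proof -
        obtain p q t where w: "p \<in> k" "q \<in> s" "t \<in> r" "w = p + q + t" using decompose by blast
        have xw: "br x w = br x q + br x t" unfolding w(4) using s_k[OF zxy(2) w(1)] by (simp add: br_simps)
        have "form g w = - form (br z y) (br x q) - form (br z y) (br x t)"
          unfolding zxy(4) swap[OF zxy(1,2)] using skew zxy(2) by (simp add: xw form_simps)
        moreover have "form (br z y) (br x t) = 0"
          using form_br_swap[of y z "br x t"] r_abelian[OF zxy(3) r_mem(1)[OF w(3)]] zxy(3)
          by (simp add: form_simps)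
        moreover have "form (br z y) (br x q) = 0"
          using skew_on_s_r[of y "br x q" z] zxy s_mem[OF zxy(2) w(2)] k_s by (simp add: form_simps)
        ultimately show ?thesis by simp
      qed
      then show "g \<in> form_kernel form" by (simp add: form_kernel_def)
    qed
    show "subspace (form_kernel form)"
      by (auto simp: form_kernel_def real_vector.subspace_def form_simps)
  qed
  ultimately have "span ?G = {0}" by (rule effective)
  then have G0: "g = 0" if "g \<in> ?G" for g using span_base[OF that] by simp
  have gen: "br z (br x y) = 0" if "z \<in> k" "x \<in> s" "y \<in> r" for x y z
  proof (rule G0)
    show "br z (br x y) \<in> ?G" using that by blast
  qed
  show "br z v = 0" if "z \<in> k" "v \<in> sr"
    by (rule sr_linear_zero[OF linear_br gen[OF that(1)] that(2)])
qed

lemma sr_mem: "v \<in> sr \<Longrightarrow> br w v \<in> sr"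
proof -
  assume v: "v \<in> sr"
  obtain p q t where w: "p \<in> k" "q \<in> s" "t \<in> r" "w = p + q + t" using decompose by blast
  have vr: "v \<in> r" using v sr_subset_r by blast
  have "br w v = br q v" unfolding w(4) using k_sr[OF w(1) v] r_abelian[OF w(3) vr] by (simp add: br_simps)
  then show ?thesis using sr_base[OF w(2) vr] by simp
qed

lemma sr_perp_k: "v \<in> sr \<Longrightarrow> w \<in> k \<Longrightarrow> form v w = 0"
  by (rule sr_linear_zero[OF linear_form(2)]) (simp_all add: skew s_k form_simps)

lemma sr_perp_r: "v \<in> sr \<Longrightarrow> w \<in> r \<Longrightarrow> form v w = 0"
  by (rule sr_linear_zero[OF linear_form(2)]) (simp_all add: form_br_swap r_abelian form_simps)

definition a :: "'a set" where
  "a = {v \<in> r. \<forall>w\<in>s. form v w = 0}"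

lemma a_subspace: "subspace a"
  using r_subspace by (auto simp: a_def real_vector.subspace_def form_simps)

text \<open>
  The intersection is an ideal, and it is orthogonal to \<open>k\<close>, \<open>s\<close> and \<open>r\<close>.
\<close>

lemma sr_a_disjoint: "v \<in> sr \<Longrightarrow> v \<in> a \<Longrightarrow> v = 0"
proof -
  have "lie_ideal br (sr \<inter> a) UNIV"
  proof -
    have "br w v \<in> sr \<inter> a" if v: "v \<in> sr \<inter> a" for w v
    proof -
      obtain p q t where w: "p \<in> k" "q \<in> s" "t \<in> r" "w = p + q + t" using decompose by blast
      have vr: "v \<in> r" using v by (simp add: a_def)
      have wv: "br w v = br q v" unfolding w(4)
        using k_sr[OF w(1)] v r_abelian[OF w(3) vr] by (simp add: br_simps)
      have "form (br q v) u = 0" if "u \<in> s" for u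
        using skew[of q v u] w(2) v s_mem[OF w(2) that] by (simp add: a_def)
      then show ?thesis using sr_base[OF w(2) vr] r_mem[OF vr] unfolding wv by (simp add: a_def)
    qed
    then show ?thesis using sr_subspace a_subspace by (simp add: lie_ideal_def subspace_inter)
  qed
  moreover have "sr \<inter> a \<subseteq> form_kernel form"
  proof
    fix v assume v: "v \<in> sr \<inter> a"
    have "form v w = 0" for w
    proof -
      obtain p q t where w: "p \<in> k" "q \<in> s" "t \<in> r" "w = p + q + t" using decompose by blast
      then show ?thesis using v sr_perp_k sr_perp_r by (simp add: form_simps a_def)
    qed
    then show "v \<in> form_kernel form" by (simp add: form_kernel_def)
  qed
  ultimately have "sr \<inter> a = {0}" by (rule effective)
  then show "v \<in> sr \<Longrightarrow> v \<in> a \<Longrightarrow> v = 0" by blast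
qed

lemma s_a: "x \<in> s \<Longrightarrow> v \<in> a \<Longrightarrow> br x v = 0"
proof (rule sr_a_disjoint)
  assume x: "x \<in> s" and v: "v \<in> a"
  have vr: "v \<in> r" using v by (simp add: a_def)
  show "br x v \<in> sr" by (rule sr_base[OF x vr])
  have "form (br x v) w = 0" if "w \<in> s" for w
    using skew[of x v w] x v s_mem[OF x that] by (simp add: a_def)
  then show "br x v \<in> a" using r_mem[OF vr] by (simp add: a_def)
qed

text \<open>
  As \<open>I = [I, I]\<close>, it is enough to see \<open>form [y, z] w = - form z [y, w] = 0\<close>.
\<close>

lemma perfect_ideal_perp:
  assumes I: "lie_ideal br I s" and w: "\<And>x. x \<in> I \<Longrightarrow> br x w = 0" and x: "x \<in> I"
  shows "form x w = 0"
proof -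
  have "x \<in> span {br x y |x y. x \<in> I \<and> y \<in> I}"
    using x semisimple_ideal_perfect[OF s_semisimple I] unfolding derived_def by simp
  moreover have "form (br y z) w = 0" if "y \<in> I" "z \<in> I" for y z
  proof -
    have "y \<in> s" using that(1) lie_idealD(2)[OF I] by blast
    then show ?thesis using skew[of y z w] w[OF that(1)] by (simp add: form_simps)
  qed
  then have "form v w = 0" if "v \<in> {br x y |x y. x \<in> I \<and> y \<in> I}" for v
    using that by auto
  ultimately show ?thesis by (rule linear_eq_0_on_span[OF linear_form(2), rotated])
qed

lemma centralizer_subset_a:
  assumes "v \<in> r" "\<And>x. x \<in> s \<Longrightarrow> br x v = 0"
  shows "v \<in> a"
  using perfect_ideal_perp[OF s_ideal assms(2)] form_sym assms(1) by (auto simp: a_def)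

definition s0 :: "'a set" where
  "s0 = {x \<in> s. \<forall>v\<in>r. form x v = 0}"

definition s1 :: "'a set" where
  "s1 = killing_perp s s0"

lemma s0_ideal: "lie_ideal br s0 s"
proof -
  have "subspace s0"
    using s_subspace by (auto simp: s0_def real_vector.subspace_def form_simps)
  moreover have "form (br q x) v = 0" if "q \<in> s" "x \<in> s0" "v \<in> r" for q x v
    using skew[of q x v] that r_mem(1)[of v q] by (auto simp: s0_def)
  ultimately show ?thesis using s_mem by (auto simp: lie_ideal_def s0_def)
qed

lemma s1_ideal: "lie_ideal br s1 s"
  unfolding s1_def by (rule killing_perp_ideal[OF s_semisimple s0_ideal])

lemmas s0_subspace = lie_idealD(1)[OF s0_ideal] and s1_subspace = lie_idealD(1)[OF s1_ideal]
lemmas s0_s = lie_idealD(2)[OF s0_ideal, THEN subsetD] and s1_s = lie_idealD(2)[OF s1_ideal, THEN subsetD]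

lemma s0_s1_disjoint: "s0 \<inter> s1 = {0}"
  unfolding s1_def by (rule semisimple_ideal_complement(1)[OF s_semisimple s0_ideal])

lemma s_decompose: "x \<in> s \<Longrightarrow> \<exists>y\<in>s0. \<exists>z\<in>s1. x = y + z"
  unfolding s1_def by (rule semisimple_ideal_complement(2)[OF s_semisimple s0_ideal])

lemma s0_s1: "x \<in> s0 \<Longrightarrow> y \<in> s1 \<Longrightarrow> br x y = 0"
  by (rule disjoint_ideals_commute[OF s0_ideal s1_ideal s0_s1_disjoint])

lemma s0_perp_r: "x \<in> s0 \<Longrightarrow> v \<in> r \<Longrightarrow> form x v = 0"
  by (simp add: s0_def)

text \<open>
  Both \<open>sr\<close> and \<open>a\<close> contain \<open>[x, v]\<close>.
\<close>

lemma s0_r: "x \<in> s0 \<Longrightarrow> v \<in> r \<Longrightarrow> br x v = 0"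
proof (rule sr_a_disjoint)
  assume x: "x \<in> s0" and v: "v \<in> r"
  show "br x v \<in> sr" by (rule sr_base[OF s0_s[OF x] v])
  have "form (br x v) w = 0" if "w \<in> s" for w
    using skew[of x v w] s0_s[OF x] s0_perp_r[OF lie_idealD(4)[OF s0_ideal that x] v] form_sym[of v]
    by simp
  then show "br x v \<in> a" using r_mem[OF v] by (simp add: a_def)
qed

lemma s0_perp_s1: "x \<in> s0 \<Longrightarrow> y \<in> s1 \<Longrightarrow> form x y = 0"
  by (rule perfect_ideal_perp[OF s0_ideal]) (simp_all add: s0_s1)

lemma s_perp_k: "x \<in> s \<Longrightarrow> y \<in> k \<Longrightarrow> form x y = 0"
  by (rule perfect_ideal_perp[OF s_ideal]) (simp_all add: s_k)

text \<open>
  If \<open>u\<close> is orthogonal to \<open>[s, r]\<close>, then \<open>[s, u]\<close> is orthogonal to \<open>r\<close> and so lies in \<open>s0 \<inter> s1 =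
  {0}\<close>; thus \<open>u\<close> is central in \<open>s\<close>.
\<close>

lemma sr_separates_s1:
  assumes u: "u \<in> s1" and perp: "\<And>v. v \<in> sr \<Longrightarrow> form v u = 0"
  shows "u = 0"
proof (rule semisimple_center[OF s_semisimple s1_s[OF u]])
  fix x assume x: "x \<in> s"
  have "form (br x u) y = 0" if "y \<in> r" for y
    using skew[of x y u] x perp[OF sr_base[OF x that]] form_sym[of y] by simp
  then have "br x u \<in> s0" using s_mem[OF x s1_s[OF u]] by (simp add: s0_def)
  moreover have "br x u \<in> s1" by (rule lie_idealD(3)[OF s1_ideal x u])
  ultimately have "br x u = 0" using s0_s1_disjoint by blast
  then show "br u x = 0" using br_antisym[of u x] by simp
qed

lemma s1_separates_sr:
  assumes v: "v \<in> sr" and perp: "\<And>u. u \<in> s1 \<Longrightarrow> form v u = 0"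
  shows "v = 0"
proof (rule sr_a_disjoint[OF v])
  have vr: "v \<in> r" using v sr_subset_r by blast
  have "form v w = 0" if w: "w \<in> s" for w
  proof -
    obtain y z where "y \<in> s0" "z \<in> s1" "w = y + z" using s_decompose[OF w] by blast
    then show ?thesis using perp s0_perp_r[OF _ vr] form_sym[of v y] by (simp add: form_simps)
  qed
  then show "v \<in> a" using vr by (simp add: a_def)
qed

lemma s1_functional_represented:
  assumes "\<And>x y. x \<in> s1 \<Longrightarrow> y \<in> s1 \<Longrightarrow> f (x + y) = f x + f y"
    "\<And>c x. x \<in> s1 \<Longrightarrow> f (c *\<^sub>R x) = c * f x"
  shows "\<exists>v\<in>sr. \<forall>u\<in>s1. form v u = f u"
  by (rule nondegenerate_pairing_represents[OF fd bilinear_form sr_subspace s1_subspace])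
    (use sr_separates_s1 assms in auto)

text \<open>
  The component of \<open>t\<close> in \<open>sr\<close> is the element that induces the same functional on \<open>s1\<close> as \<open>t\<close>.
  The difference is then orthogonal to \<open>s1\<close>, and to \<open>s0\<close> anyway.
\<close>

lemma r_decompose: "t \<in> r \<Longrightarrow> \<exists>n\<in>a. \<exists>v\<in>sr. t = n + v"
proof -
  assume t: "t \<in> r"
  obtain v where v: "v \<in> sr" "\<And>u. u \<in> s1 \<Longrightarrow> form v u = form t u"
    using s1_functional_represented[of "form t"] by (auto simp: form_simps)
  have tv: "t - v \<in> r" using t v(1) sr_subset_r r_subspace by (auto intro: subspace_diff)
  have "form (t - v) w = 0" if w: "w \<in> s" for w
  proof -
    obtain y z where yz: "y \<in> s0" "z \<in> s1" "w = y + z" using s_decompose[OF w] by blast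
    have "form (t - v) y = 0" using s0_perp_r[OF yz(1) tv] form_sym by simp
    then show ?thesis using v(2)[OF yz(2)] yz(3) by (simp add: form_simps)
  qed
  then have "t - v \<in> a" using tv by (simp add: a_def)
  then show ?thesis using v(1) by (intro bexI[of _ "t - v"] bexI[of _ v]) auto
qed

lemma k_a: "p \<in> k \<Longrightarrow> v \<in> a \<Longrightarrow> br p v \<in> a"
proof (rule centralizer_subset_a)
  assume p: "p \<in> k" and v: "v \<in> a"
  show "br p v \<in> r" using v r_mem by (simp add: a_def)
  show "br x (br p v) = 0" if x: "x \<in> s" for x
    using jacobi[of x p v] s_k[OF x p] s_a[OF x v] by simp
qed

definition g1 :: "'a set" where "g1 = {p + v |p v. p \<in> k \<and> v \<in> a}"
definition g3 :: "'a set" where "g3 = {x + v |x v. x \<in> s1 \<and> v \<in> sr}"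

lemma a_r: "v \<in> a \<Longrightarrow> v \<in> r" by (simp add: a_def)
lemma sr_r: "v \<in> sr \<Longrightarrow> v \<in> r" using sr_subset_r by blast

lemma g1_subalgebra: "lie_subalgebra br g1"
proof -
  have "br x y \<in> g1" if "x \<in> g1" "y \<in> g1" for x y
  proof -
    obtain p v q w where xy: "p \<in> k" "v \<in> a" "q \<in> k" "w \<in> a" "x = p + v" "y = q + w"
      using \<open>x \<in> g1\<close> \<open>y \<in> g1\<close> by (auto simp: g1_def)
    have "br x y = br p q + (br p w - br q v)"
      using xy r_abelian[OF a_r a_r] br_antisym[of v q] by (simp add: br_simps)
    moreover have "br p q \<in> k" using xy subalgebra_br[OF k_subalgebra] by simp
    moreover have "br p w - br q v \<in> a" using xy k_a a_subspace by (simp add: subspace_diff)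
    ultimately show ?thesis unfolding g1_def by blast
  qed
  then show ?thesis
    unfolding lie_subalgebra_def using subspace_sums[OF k_subspace a_subspace] by (simp add: g1_def)
qed

lemma g3_subalgebra: "lie_subalgebra br g3"
proof -
  have "br x y \<in> g3" if "x \<in> g3" "y \<in> g3" for x y
  proof -
    obtain p v q w where xy: "p \<in> s1" "v \<in> sr" "q \<in> s1" "w \<in> sr" "x = p + v" "y = q + w"
      using \<open>x \<in> g3\<close> \<open>y \<in> g3\<close> by (auto simp: g3_def)
    have "br x y = br p q + (br p w - br q v)"
      using xy r_abelian[OF sr_r sr_r] br_antisym[of v q] by (simp add: br_simps)
    moreover have "br p q \<in> s1" using xy lie_idealD(3)[OF s1_ideal] s1_s by simp
    moreover have "br p w - br q v \<in> sr" using xy sr_mem sr_subspace by (simp add: subspace_diff)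
    ultimately show ?thesis unfolding g3_def by blast
  qed
  then show ?thesis
    unfolding lie_subalgebra_def using subspace_sums[OF s1_subspace sr_subspace] by (simp add: g3_def)
qed

lemma g1_s0: "x \<in> g1 \<Longrightarrow> y \<in> s0 \<Longrightarrow> br x y = 0" "x \<in> g1 \<Longrightarrow> y \<in> s0 \<Longrightarrow> br y x = 0"
proof -
  show "br y x = 0" if "x \<in> g1" "y \<in> s0" for x y
    using that s_k s0_r a_r s0_s by (auto simp: g1_def br_simps)
  then show "br x y = 0" if "x \<in> g1" "y \<in> s0" for x y
    using that br_antisym[of x y] by simp
qed

lemma g1_g3: "x \<in> g1 \<Longrightarrow> y \<in> g3 \<Longrightarrow> br x y = 0" "x \<in> g1 \<Longrightarrow> y \<in> g3 \<Longrightarrow> br y x = 0"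
proof -
  show *: "br x y = 0" if xg: "x \<in> g1" and yg: "y \<in> g3" for x y
  proof -
    obtain p v q w where xy: "p \<in> k" "v \<in> a" "q \<in> s1" "w \<in> sr" "x = p + v" "y = q + w"
      using xg yg by (auto simp: g1_def g3_def)
    then show ?thesis
      using k_s[OF xy(1) s1_s] k_sr[OF xy(1,4)] s_a[OF s1_s[OF xy(3)] xy(2)] br_antisym[of v q]
        r_abelian[OF a_r sr_r] by (simp add: br_simps)
  qed
  then show "br y x = 0" if "x \<in> g1" "y \<in> g3" for x y
    using that br_antisym[of y x] by simp
qed

lemma s0_g3: "x \<in> s0 \<Longrightarrow> y \<in> g3 \<Longrightarrow> br x y = 0" "x \<in> s0 \<Longrightarrow> y \<in> g3 \<Longrightarrow> br y x = 0"
proof -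
  show "br x y = 0" if "x \<in> s0" "y \<in> g3" for x y
    using that s0_s1 s0_r sr_r by (auto simp: g3_def br_simps)
  then show "br y x = 0" if "x \<in> s0" "y \<in> g3" for x y
    using that br_antisym[of y x] by simp
qed

lemma g_decompose: "\<exists>x\<in>g1. \<exists>y\<in>s0. \<exists>z\<in>g3. w = x + y + z"
proof -
  obtain p q t where w: "p \<in> k" "q \<in> s" "t \<in> r" "w = p + q + t" using decompose by blast
  obtain y z where yz: "y \<in> s0" "z \<in> s1" "q = y + z" using s_decompose[OF w(2)] by blast
  obtain n v where nv: "n \<in> a" "v \<in> sr" "t = n + v" using r_decompose[OF w(3)] by blast
  have "p + n \<in> g1" "z + v \<in> g3" using w yz nv by (auto simp: g1_def g3_def)
  moreover have "w = (p + n) + y + (z + v)" using w yz nv by simp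
  ultimately show ?thesis using yz(1) by blast
qed

text \<open>
  The three summands are subalgebras that commute with each other, and this makes each of them
  an ideal.
\<close>

lemma g1_ideal: "lie_ideal br g1 UNIV"
proof -
  have "br w x \<in> g1" if x: "x \<in> g1" for w x
  proof -
    obtain u y z where w: "u \<in> g1" "y \<in> s0" "z \<in> g3" "w = u + y + z" using g_decompose by blast
    have "br w x = br u x" unfolding w(4) using g1_s0(2)[OF x w(2)] g1_g3(2)[OF x w(3)] by (simp add: br_simps)
    then show ?thesis using subalgebra_br[OF g1_subalgebra w(1) x] by simp
  qed
  then show ?thesis using subalgebra_subspace[OF g1_subalgebra] by (simp add: lie_ideal_def)
qed

lemma s0_ideal_UNIV: "lie_ideal br s0 UNIV"
proof -
  have "br w x \<in> s0" if x: "x \<in> s0" for w x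
  proof -
    obtain u y z where w: "u \<in> g1" "y \<in> s0" "z \<in> g3" "w = u + y + z" using g_decompose by blast
    have "br w x = br y x" unfolding w(4) using g1_s0(1)[OF w(1) x] s0_g3(2)[OF x w(3)] by (simp add: br_simps)
    then show ?thesis using lie_idealD(3)[OF s0_ideal s0_s[OF w(2)] x] by simp
  qed
  then show ?thesis using s0_subspace by (simp add: lie_ideal_def)
qed

lemma g3_ideal: "lie_ideal br g3 UNIV"
proof -
  have "br w x \<in> g3" if x: "x \<in> g3" for w x
  proof -
    obtain u y z where w: "u \<in> g1" "y \<in> s0" "z \<in> g3" "w = u + y + z" using g_decompose by blast
    have "br w x = br z x" unfolding w(4) using g1_g3(1)[OF w(1) x] s0_g3(1)[OF w(2) x] by (simp add: br_simps)
    then show ?thesis using subalgebra_br[OF g3_subalgebra w(3) x] by simp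
  qed
  then show ?thesis using subalgebra_subspace[OF g3_subalgebra] by (simp add: lie_ideal_def)
qed

lemma g1_perp_s0: "x \<in> g1 \<Longrightarrow> y \<in> s0 \<Longrightarrow> form x y = 0"
proof -
  assume "x \<in> g1" and y: "y \<in> s0"
  then obtain p v where x: "p \<in> k" "v \<in> a" "x = p + v" by (auto simp: g1_def)
  have "form y x = 0"
    using s_perp_k[OF s0_s[OF y] x(1)] s0_perp_r[OF y a_r[OF x(2)]] x(3) by (simp add: form_simps)
  then show ?thesis using form_sym by simp
qed

lemma g1_perp_g3: "x \<in> g1 \<Longrightarrow> y \<in> g3 \<Longrightarrow> form x y = 0"
proof -
  assume "x \<in> g1" and "y \<in> g3"
  then obtain p v q w where xy: "p \<in> k" "v \<in> a" "q \<in> s1" "w \<in> sr" "x = p + v" "y = q + w"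
    by (auto simp: g1_def g3_def)
  have "form p q = 0" using s_perp_k[OF s1_s[OF xy(3)] xy(1)] form_sym by simp
  moreover have "form p w = 0" using sr_perp_k[OF xy(4,1)] form_sym by simp
  moreover have "form v q = 0" using xy(2) s1_s[OF xy(3)] by (simp add: a_def)
  moreover have "form v w = 0" using sr_perp_r[OF xy(4) a_r[OF xy(2)]] form_sym by simp
  ultimately show ?thesis using xy(5,6) by (simp add: form_simps)
qed

lemma s0_perp_g3: "x \<in> s0 \<Longrightarrow> y \<in> g3 \<Longrightarrow> form x y = 0"
  using s0_perp_s1 s0_perp_r sr_r by (auto simp: g3_def form_simps)

text \<open>
  The kernel of the restricted form is an ideal, because \<open>s0\<close> commutes with \<open>g1\<close> and \<open>g3\<close>, and
  it lies in the kernel of the form, because \<open>s0\<close> is orthogonal to them.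
\<close>

lemma s0_nondegenerate: "nondegenerate_on form s0"
proof -
  let ?J = "{x \<in> s0. \<forall>y\<in>s0. form x y = 0}"
  have "lie_ideal br ?J UNIV"
  proof -
    have "subspace ?J" using s0_subspace by (auto simp: real_vector.subspace_def form_simps)
    moreover have "br w x \<in> ?J" if x: "x \<in> ?J" for w x
    proof -
      obtain u y z where w: "u \<in> g1" "y \<in> s0" "z \<in> g3" "w = u + y + z" using g_decompose by blast
      have x0: "x \<in> s0" using x by simp
      have wx: "br w x = br y x" unfolding w(4)
        using g1_s0(1)[OF w(1) x0] s0_g3(2)[OF x0 w(3)] by (simp add: br_simps)
      have "form (br y x) v = 0" if "v \<in> s0" for v
        using skew[of y x v] s0_s[OF w(2)] x lie_idealD(3)[OF s0_ideal s0_s[OF w(2)] that] by simp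
      then show ?thesis unfolding wx using lie_idealD(3)[OF s0_ideal s0_s[OF w(2)] x0] by simp
    qed
    ultimately show ?thesis by (simp add: lie_ideal_def)
  qed
  moreover have "?J \<subseteq> form_kernel form"
  proof
    fix x assume x: "x \<in> ?J"
    have "form x w = 0" for w
    proof -
      obtain u y z where w: "u \<in> g1" "y \<in> s0" "z \<in> g3" "w = u + y + z" using g_decompose by blast
      then show ?thesis using x g1_perp_s0[OF w(1), of x] form_sym[of x u] s0_perp_g3[of x z]
        by (simp add: form_simps)
    qed
    then show "x \<in> form_kernel form" by (simp add: form_kernel_def)
  qed
  ultimately have "?J = {0}" by (rule effective)
  then show ?thesis unfolding nondegenerate_on_def by blast
qed

lemma sr_subset_g3: "sr \<subseteq> g3"
  unfolding g3_def using subspace_0[OF s1_subspace] by force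

lemma s1_subset_g3: "s1 \<subseteq> g3"
  unfolding g3_def using subspace_0[OF sr_subspace] by force

lemma g3_nondegenerate: "nondegenerate_on form g3"
  unfolding nondegenerate_on_def
proof (intro ballI impI)
  fix x assume "x \<in> g3" and perp: "\<forall>y\<in>g3. form x y = 0"
  then obtain p v where x: "p \<in> s1" "v \<in> sr" "x = p + v" by (auto simp: g3_def)
  note srg = subsetD[OF sr_subset_g3] and s1g = subsetD[OF s1_subset_g3]
  have "p = 0"
  proof (rule sr_separates_s1[OF x(1)])
    fix w assume w: "w \<in> sr"
    have "form v w = 0" by (rule sr_perp_r[OF x(2) sr_r[OF w]])
    moreover have "form x w = 0" using perp srg[OF w] by blast
    ultimately show "form w p = 0" using x(3) form_sym[of w p] by (simp add: form_simps)
  qed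
  moreover have "v = 0"
    by (rule s1_separates_sr[OF x(2)]) (use perp s1g x(3) \<open>p = 0\<close> in auto)
  ultimately show "x = 0" using x(3) by simp
qed

lemma invariant_on_s0: "invariant_on br form s0"
  unfolding invariant_on_def using skew s0_s by blast

lemma invariant_on_g3: "invariant_on br form g3"
  unfolding invariant_on_def
proof (intro ballI)
  fix x y z assume "x \<in> g3"
  then obtain p v where x: "p \<in> s" "v \<in> r" "x = p + v" using s1_s sr_r by (auto simp: g3_def)
  then show "form (br x y) z = - form y (br x z)"
    using skew[of p y z] skew[of v y z] by (simp add: br_simps form_simps)
qed

lemma kernel_subset_g1: "form_kernel form \<subseteq> g1"
proof
  fix w assume "w \<in> form_kernel form"
  then have ker: "form w v = 0" for v by (simp add: form_kernel_def)
  obtain x y z where w: "x \<in> g1" "y \<in> s0" "z \<in> g3" "w = x + y + z" using g_decompose by blast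
  have "form y v = 0" if v: "v \<in> s0" for v
    using ker[of v] g1_perp_s0[OF w(1) v] s0_perp_g3[OF v w(3)] form_sym[of z v] w(4)
    by (simp add: form_simps)
  then have "y = 0" using s0_nondegenerate w(2) unfolding nondegenerate_on_def by blast
  have "form z v = 0" if v: "v \<in> g3" for v
    using ker[of v] g1_perp_g3[OF w(1) v] s0_perp_g3[OF w(2) v] w(4) by (simp add: form_simps)
  then have "z = 0" using g3_nondegenerate w(3) unfolding nondegenerate_on_def by blast
  then show "w \<in> g1" using w \<open>y = 0\<close> by simp
qed

lemma ideal_of_subalgebra: "lie_ideal br I UNIV \<Longrightarrow> I \<subseteq> h \<Longrightarrow> lie_ideal br I h"
  by (auto simp: lie_ideal_def)

lemma k_a_disjoint: "k \<inter> a = {0}"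
  using independent_summands[of _ 0 "- _"] subspace_0[OF s_subspace] subspace_neg[OF r_subspace] a_r
    subspace_0[OF k_subspace] subspace_0[OF a_subspace] by force

lemma s1_sr_disjoint: "s1 \<inter> sr = {0}"
  using independent_summands[of 0 _ "- _"] subspace_0[OF k_subspace] subspace_neg[OF r_subspace] sr_r s1_s
    subspace_0[OF s1_subspace] subspace_0[OF sr_subspace] by force

lemma g_independent:
  assumes "x \<in> g1" "y \<in> s0" "z \<in> g3" "x + y + z = 0"
  shows "x = 0 \<and> y = 0 \<and> z = 0"
proof -
  obtain p n where x: "p \<in> k" "n \<in> a" "x = p + n" using assms(1) by (auto simp: g1_def)
  obtain q v where z: "q \<in> s1" "v \<in> sr" "z = q + v" using assms(3) by (auto simp: g3_def)
  have "p + (y + q) + (n + v) = 0" using assms(4) x z by (simp add: algebra_simps)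
  moreover have "y + q \<in> s" using s0_s[OF assms(2)] s1_s[OF z(1)] s_subspace by (simp add: subspace_add)
  moreover have "n + v \<in> r" using a_r[OF x(2)] sr_r[OF z(2)] r_subspace by (simp add: subspace_add)
  ultimately have e: "p = 0" "y + q = 0" "n + v = 0" using independent_summands x(1) by blast+
  have "y = - q" using e(2) by (simp add: eq_neg_iff_add_eq_0)
  then have "y \<in> s0 \<inter> s1" using assms(2) subspace_neg[OF s1_subspace z(1)] by simp
  then have y: "y = 0" using s0_s1_disjoint by blast
  have "n = - v" using e(3) by (simp add: eq_neg_iff_add_eq_0)
  then have "n = 0" using sr_a_disjoint[of n] x(2) subspace_neg[OF sr_subspace z(2)] by simp
  then show ?thesis using e y x z by simp
qed

lemma a_ideal: "lie_ideal br a g1"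
proof -
  have "br x v \<in> a" if "x \<in> g1" "v \<in> a" for x v
    using that k_a r_abelian[OF a_r a_r] by (auto simp: g1_def br_simps)
  moreover have "a \<subseteq> g1"
    unfolding g1_def using subspace_0[OF k_subspace] by force
  ultimately show ?thesis using a_subspace by (simp add: lie_ideal_def)
qed

lemma sr_ideal: "lie_ideal br sr UNIV"
  using sr_mem sr_subspace by (simp add: lie_ideal_def)

lemma orthogonal_decomposition: "orthogonal_direct_product br form UNIV [g1, s0, g3]"
proof -
  have "direct_sum UNIV [g1, s0, g3]"
    by (rule direct_sum_triple)
      (use subalgebra_subspace[OF g1_subalgebra] s0_subspace subalgebra_subspace[OF g3_subalgebra]
        g_decompose g_independent in blast)+
  then show ?thesis
    using g1_ideal s0_ideal_UNIV g3_ideal g1_perp_s0 g1_perp_g3 s0_perp_g3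
    by (simp add: orthogonal_direct_product_def direct_product_def)
qed

lemma g1_semidirect: "semidirect_product br g1 k a"
  unfolding semidirect_product_def
  using g1_subalgebra k_subalgebra a_ideal k_a_disjoint
  by (simp add: direct_sum_pair_iff[OF k_subspace a_subspace] g1_def)

lemma g3_semidirect: "semidirect_product br g3 s1 sr"
  unfolding semidirect_product_def
  using g3_subalgebra lie_ideal_subalgebra[OF s1_ideal] ideal_of_subalgebra[OF sr_ideal sr_subset_g3]
    s1_sr_disjoint
  by (simp add: direct_sum_pair_iff[OF s1_subspace sr_subspace] g3_def)

lemma radical_decomposition: "orthogonal_direct_product br form r [a, sr]"
proof -
  have "r = {x + y |x y. x \<in> a \<and> y \<in> sr}"
    using r_decompose a_r sr_r subspace_add[OF r_subspace] by blast
  moreover have "a \<inter> sr = {0}"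
    using sr_a_disjoint subspace_0[OF a_subspace] subspace_0[OF sr_subspace] by blast
  ultimately have "direct_sum r [a, sr]" by (simp add: direct_sum_pair_iff[OF a_subspace sr_subspace])
  moreover have "lie_ideal br a r"
    using a_subspace a_r r_abelian subspace_0[OF a_subspace] by (auto simp: lie_ideal_def)
  moreover have "form x y = 0" if "x \<in> a" "y \<in> sr" for x y
    using sr_perp_r[OF that(2) a_r[OF that(1)]] form_sym by simp
  ultimately show ?thesis
    using ideal_of_subalgebra[OF sr_ideal sr_subset_r]
    by (simp add: orthogonal_direct_product_def direct_product_def)
qed

lemma s_decomposition: "orthogonal_direct_product br form s [s0, s1]"
proof -
  have "s = {x + y |x y. x \<in> s0 \<and> y \<in> s1}"
    using s_decompose s0_s s1_s subspace_add[OF s_subspace] by blast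
  then have "direct_sum s [s0, s1]"
    using s0_s1_disjoint by (simp add: direct_sum_pair_iff[OF s0_subspace s1_subspace])
  then show ?thesis using s0_ideal s1_ideal s0_perp_s1
    by (simp add: orthogonal_direct_product_def direct_product_def)
qed

text \<open>
  The isomorphism from \<open>sr\<close> to the dual of \<open>s1\<close> sends \<open>v\<close> to \<open>form v\<close> restricted to \<open>s1\<close>; it
  intertwines the actions as \<open>ad x\<close> is skew.
\<close>

lemma g3_metric_cotangent: "metric_cotangent_algebra br form g3 s1 sr"
proof -
  define T where "T = (\<lambda>v y. if y \<in> s1 then form v y else 0)"
  have "inj_on T sr"
  proof (rule inj_onI)
    fix v w assume vw: "v \<in> sr" "w \<in> sr" "T v = T w"
    have "form (v - w) u = 0" if "u \<in> s1" for u
      using fun_cong[OF vw(3), of u] that by (simp add: T_def form_simps)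
    then have "v - w = 0" using vw sr_subspace by (intro s1_separates_sr) (simp_all add: subspace_diff)
    then show "v = w" by simp
  qed
  moreover have "T ` sr = dual_space s1"
  proof (rule equalityI; rule subsetI)
    fix f assume "f \<in> T ` sr"
    then show "f \<in> dual_space s1"
      using s1_subspace by (auto simp: T_def dual_space_def form_simps subspace_add subspace_scale)
  next
    fix f assume f: "f \<in> dual_space s1"
    then obtain v where v: "v \<in> sr" "\<And>u. u \<in> s1 \<Longrightarrow> form v u = f u"
      using s1_functional_represented[of f] by (auto simp: dual_space_def)
    then have "T v = f" using f by (auto simp: T_def dual_space_def fun_eq_iff)
    then show "f \<in> T ` sr" using v(1) by blast
  qed
  ultimately have "bij_betw T sr (dual_space s1)" by (simp add: bij_betw_def)
  moreover have "T (br x v) = coadjoint br s1 x (T v)" if x: "x \<in> s1" for x v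
    using skew[of x v] s1_s[OF x] lie_idealD(3)[OF s1_ideal s1_s[OF x]]
    by (auto simp: T_def coadjoint_def fun_eq_iff)
  moreover have "T (u + v) = (\<lambda>y. T u y + T v y)" "T (c *\<^sub>R v) = (\<lambda>y. c * T v y)" for u v c
    by (auto simp: T_def fun_eq_iff form_simps)
  moreover have "abelian_on br sr" using r_abelian sr_r by (simp add: abelian_on_def)
  ultimately have "cotangent_algebra br g3 s1 sr"
    unfolding cotangent_algebra_def using g3_semidirect by blast
  moreover have "totally_isotropic form sr" using sr_perp_r sr_r by (simp add: totally_isotropic_def)
  ultimately show ?thesis
    using invariant_on_g3 g3_nondegenerate by (simp add: metric_cotangent_algebra_def)
qed

end

lemma (in fd_lie_algebra) radical_ideal: "lie_ideal br (lie_radical br UNIV) UNIV"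
proof -
  let ?U = "\<Union> {I. lie_ideal br I UNIV \<and> solvable_on br I}"
  have "br x y \<in> span ?U" if y: "y \<in> ?U" for x y
  proof -
    obtain I where I: "lie_ideal br I UNIV" "solvable_on br I" "y \<in> I" using y by blast
    then have "br x y \<in> I" using lie_idealD(3)[OF I(1)] by blast
    then show ?thesis using I by (intro span_base) blast
  qed
  then have "br x y \<in> span ?U" if "y \<in> span ?U" for x y
    using span_br_closed[of ?U x y] that by blast
  then show ?thesis by (simp add: lie_ideal_def lie_radical_def)
qed

theorem theoremC:
  fixes br :: "'a::real_normed_vector \<Rightarrow> 'a \<Rightarrow> 'a"
    and form :: "'a \<Rightarrow> 'a \<Rightarrow> real"
    and r l k s :: "'a set"
  assumes "finite_dimensional TYPE('a)"
    and "lie_algebra br"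
    and "r = lie_radical br UNIV"
    and "abelian_on br r"
    and "symmetric_bilinear form"
    and "nil_invariant br form"
    and "\<forall>I. lie_ideal br I UNIV \<and> I \<subseteq> form_kernel form \<longrightarrow> I = {0}"
    and "levi_subalgebra br l"
    and "direct_product br l [k, s]"
    and "compact_type br k"
    and "no_compact_factors br s"
  shows "\<exists>g1 g2 g3 a s0 s1 s1_dual.
      orthogonal_direct_product br form UNIV [g1, g2, g3] \<and>
      semidirect_product br g1 k a \<and>
      g2 = s0 \<and>
      semidirect_product br g3 s1 s1_dual \<and>
      orthogonal_direct_product br form r [a, s1_dual] \<and>
      orthogonal_direct_product br form s [s0, s1] \<and>
      metric_cotangent_algebra br form g3 s1 s1_dual \<and>
      invariant_on br form g2 \<and> nondegenerate_on form g2 \<and>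
      invariant_on br form g3 \<and> nondegenerate_on form g3 \<and>
      form_kernel form \<subseteq> g1"
proof -
  have fdl: "fd_lie_algebra br" using assms(1,2) by (rule fd_lie_algebra.intro)
  interpret fd_lie_algebra br by (rule fdl)
  have ssl: "lie_semisimple br l" and sum: "direct_sum UNIV [l, r]"
    using assms(3,8) by (auto simp: levi_subalgebra_def)
  have k: "lie_ideal br k l" and s: "lie_ideal br s l" and ks: "direct_sum l [k, s]"
    using assms(9) by (auto simp: direct_product_def)
  have r: "lie_ideal br r UNIV" unfolding assms(3) by (rule radical_ideal)
  note rD = lie_idealD[OF r]
  note sub = lie_idealD(1)[OF k] lie_idealD(1)[OF s] rD(1)
    subalgebra_subspace[OF semisimple_subalgebra[OF ssl]]
  have lr: "UNIV = {x + y |x y. x \<in> l \<and> y \<in> r}" "l \<inter> r = {0}"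
    using sum direct_sum_pair_iff[OF sub(4,3)] by blast+
  have kls: "l = {x + y |x y. x \<in> k \<and> y \<in> s}" "k \<inter> s = {0}"
    using ks direct_sum_pair_iff[OF sub(1,2)] by blast+
  have bil: "bilinear form" and sym: "\<And>x y. form x y = form y x"
    using assms(5) by (auto simp: symmetric_bilinear_def)
  have rab: "br x y = 0" if "x \<in> r" "y \<in> r" for x y
    using assms(4) that by (auto simp: abelian_on_def)
  have sss: "lie_semisimple br s" by (rule semisimple_ideal[OF ssl s])
  note skew_nil = nil_invariant_skew_of_ad_nilpotent[OF fdl assms(6)]
  have skew_r: "form (br x u) v = - form u (br x v)" if x: "x \<in> r" for x u v
  proof -
    have "(br x ^^ 2) w = 0" for w
      using rab[OF x rD(4)[OF _ x]] by (simp add: numeral_2_eq_2)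
    then show ?thesis by (intro skew_nil) (auto simp: nilpotent_op_def)
  qed
  have skew_s: "form (br x u) v = - form u (br x v)" if x: "x \<in> s" for x u v
  proof -
    have "x \<in> span (graded_elements s)"
      using graded_elements_span_semisimple[OF sss assms(11)] x by simp
    then show ?thesis
    proof (induction x rule: span_induct_alt)
      case (step c x y)
      then show ?case
        using skew_nil[OF graded_element_nilpotent, of x s u v]
        by (simp add: br_simps bilinear_ladd[OF bil] bilinear_radd[OF bil] bilinear_lmul[OF bil]
            bilinear_rmul[OF bil])
    qed (simp add: bilinear_lzero[OF bil] bilinear_rzero[OF bil])
  qed
  have dec: "\<exists>p\<in>k. \<exists>q\<in>s. \<exists>t\<in>r. w = p + q + t" for w
  proof -
    obtain x t where xt: "x \<in> l" "t \<in> r" "w = x + t" using lr(1) by blast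
    obtain p q where "p \<in> k" "q \<in> s" "x = p + q" using xt(1) kls(1) by blast
    then show ?thesis using xt by blast
  qed
  have ind: "p = 0 \<and> q = 0 \<and> t = 0" if pqt: "p \<in> k" "q \<in> s" "t \<in> r" "p + q + t = 0" for p q t
  proof -
    have "t = - (p + q)" by (rule minus_unique[OF pqt(4), symmetric])
    moreover have "p + q \<in> l" using pqt kls(1) by blast
    ultimately have "t \<in> l" using subspace_neg[OF sub(4), of "p + q"] by (simp only:)
    then have "t \<in> l \<inter> r" using pqt(3) by (rule IntI)
    then have t: "t = 0" using lr(2) by blast
    then have "p = - q" using pqt(4) by (simp add: eq_neg_iff_add_eq_0)
    then have "p \<in> k \<inter> s" using pqt(1,2) subspace_neg[OF sub(2)] by simp
    then show ?thesis using kls(2) t pqt(4) by auto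
  qed
  interpret E: effective_split_lie_algebra br form k s r
    using bil sym assms(7) r rab lie_ideal_subalgebra[OF k] sss
      disjoint_ideals_commute[OF k s kls(2)] dec ind skew_r skew_s
    by unfold_locales blast+
  show ?thesis
    using E.orthogonal_decomposition E.g1_semidirect E.g3_semidirect E.radical_decomposition
      E.s_decomposition E.g3_metric_cotangent E.invariant_on_s0 E.s0_nondegenerate
      E.invariant_on_g3 E.g3_nondegenerate E.kernel_subset_g1
    by blast
qed

end
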